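(* Fix a positive integer $d>0$. Then there are at most finitely many choices of positive integers $k<n$ and (up to isomorphism) globally generated homogeneous vector bundles $\mathcal{F}=\mathcal{F}^{\mathcal{S}}\oplus\mathcal{F}^{\mathcal{Q}}\oplus\mathcal{F}^{\mathrm{line}}$ on $G(k,n)$, decomposed as described in the context, such that $$\mathrm{rank}\,\mathcal{F}=k(n-k)-d\quad\text{and}\quad c_1(\mathcal{F})=n,$$ and such that all of the following hold: (A1) $k\ge 2$; (A2) $n\ge 2k$; (A3) $\mathcal{S}^*$ is not an irreducible component of $\mathcal{F}^{\mathcal{S}}$ and $\mathcal{Q}$ is not an irreducible component of $\mathcal{F}^{\mathcal{Q}}$; (A4) if $n>2k$, then neither $\mathrm{Sym}^2\mathcal{Q}$ nor $\wedge^2\mathcal{Q}$ is an irreducible component of $\mathcal{F}^{\mathcal{Q}}$.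
   Context: Work over $\mathbb{C}$. $G(k,n)$ is the Grassmannian of $k$-dimensional subspaces of $\mathbb{C}^n$, with universal subbundle $\mathcal{S}$ and universal quotient bundle $\mathcal{Q}$ ($0\to\mathcal{S}\to\mathcal{O}^{\oplus n}\to\mathcal{Q}\to0$), $\mathcal{O}(1)$ is the ample generator of the Picard group, and $c_1$ of a bundle is regarded as an integer via $c_1(\mathcal{O}(1))=1$. For $\lambda=(\lambda_1\ge\dots\ge\lambda_k\ge0)$ and $\mu=(\mu_1\ge\dots\ge\mu_{n-k}\ge0)$, $S_\lambda\mathcal{S}^*$ and $S_\mu\mathcal{Q}$ are the Schur functors applied to $\mathcal{S}^*$ and $\mathcal{Q}$. The decomposition means: $\mathcal{F}^{\mathcal{S}}$ is a direct sum of bundles $S_\lambda\mathcal{S}^*$ with $\lambda_1\ne\lambda_k\ge 0$; $\mathcal{F}^{\mathcal{Q}}$ is a direct sum of bundles $S_\mu\mathcal{Q}$ with $\mu_1\ne\mu_{n-k}\ge0$; and $\mathcal{F}^{\mathrm{line}}$ is a direct sum of line bundles $\mathcal{O}(p)$ with $p>0$ (each of the three may be zero). These direct summands are called the irreducible components. *)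

theory Defs
  imports
    "Jordan_Normal_Form.DL_Rank"
    "Jordan_Normal_Form.Gauss_Jordan_Elimination"
    "HOL-Combinatorics.Permutations"
begin

section \<open>The Grassmannian as a homogeneous space\<close>

definition GL :: "nat \<Rightarrow> complex mat set" where
  "GL n = {g \<in> carrier_mat n n. invertible_mat g}"

definition grassmannian :: "nat \<Rightarrow> nat \<Rightarrow> complex vec set set" where
  "grassmannian k n =
     {W. subspace class_ring W (module_vec TYPE(complex) n) \<and>
         vectorspace.dim class_ring (module_vec TYPE(complex) n\<lparr>carrier := W\<rparr>) = k}"

text \<open>The base point of the Grassmannian is the span of the first \<open>k\<close> unit vectors, and
  \<open>GL n\<close> acts on column vectors.\<close>

definition base_point :: "nat \<Rightarrow> nat \<Rightarrow> complex vec set" where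
  "base_point k n = {v \<in> carrier_vec n. \<forall>i. k \<le> i \<and> i < n \<longrightarrow> v $ i = 0}"

definition gr_point :: "nat \<Rightarrow> nat \<Rightarrow> complex mat \<Rightarrow> complex vec set" where
  "gr_point k n g = (\<lambda>v. g *\<^sub>v v) ` base_point k n"

text \<open>The stabiliser of the base point: block upper triangular matrices. The lemmas
  \<open>gr_point_eq_iff\<close> and \<open>grassmannian_eq\<close> below identify the Grassmannian with
  \<open>GL n / parabolic k n\<close>.\<close>

definition parabolic :: "nat \<Rightarrow> nat \<Rightarrow> complex mat set" where
  "parabolic k n = {p \<in> GL n. \<forall>i j. k \<le> i \<and> i < n \<and> j < k \<longrightarrow> p $$ (i, j) = 0}"

text \<open>The coordinate ring of the affine variety \<open>GL n\<close>, generated by the matrix entries and the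
  inverse of the determinant.\<close>

inductive regular :: "nat \<Rightarrow> (complex mat \<Rightarrow> complex) \<Rightarrow> bool" for n where
  regular_const: "regular n (\<lambda>g. c)"
| regular_entry: "i < n \<Longrightarrow> j < n \<Longrightarrow> regular n (\<lambda>g. g $$ (i, j))"
| regular_add: "regular n f \<Longrightarrow> regular n h \<Longrightarrow> regular n (\<lambda>g. f g + h g)"
| regular_mult: "regular n f \<Longrightarrow> regular n h \<Longrightarrow> regular n (\<lambda>g. f g * h g)"
| regular_inverse_det: "regular n (\<lambda>g. inverse (det g))"

text \<open>Regular functions on a Zariski closed subset \<open>X\<close> of \<open>GL n\<close> are the restrictions of regular
  functions on \<open>GL n\<close>.\<close>

definition regular_on :: "nat \<Rightarrow> complex mat set \<Rightarrow> (complex mat \<Rightarrow> complex) \<Rightarrow> bool" where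
  "regular_on n X f \<longleftrightarrow> (\<exists>h. regular n h \<and> (\<forall>g\<in>X. f g = h g))"

definition regular_mat_on ::
    "nat \<Rightarrow> complex mat set \<Rightarrow> nat \<Rightarrow> nat \<Rightarrow> (complex mat \<Rightarrow> complex mat) \<Rightarrow> bool" where
  "regular_mat_on n X a b f \<longleftrightarrow>
     (\<forall>g\<in>X. f g \<in> carrier_mat a b) \<and>
     (\<forall>i<a. \<forall>j<b. regular_on n X (\<lambda>g. f g $$ (i, j)))"

definition regular_vec_on ::
    "nat \<Rightarrow> complex mat set \<Rightarrow> nat \<Rightarrow> (complex mat \<Rightarrow> complex vec) \<Rightarrow> bool" where
  "regular_vec_on n X a f \<longleftrightarrow>
     (\<forall>g\<in>X. f g \<in> carrier_vec a) \<and> (\<forall>i<a. regular_on n X (\<lambda>g. f g $ i))"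


section \<open>Homogeneous vector bundles\<close>

text \<open>A homogeneous vector bundle of rank \<open>r\<close> on \<open>GL n / P\<close>, with \<open>P = parabolic k n\<close>, is
  the associated bundle \<open>GL n \<times>\<^sub>P \<complex>\<^sup>r\<close> of a rational representation \<open>\<rho>\<close> of \<open>P\<close> on
  \<open>\<complex>\<^sup>r\<close>, where \<open>(g p, v)\<close> is identified with \<open>(g, \<rho> p v)\<close>.\<close>

datatype hbundle =
  Bundle (bundle_rank: nat) (bundle_rep: "complex mat \<Rightarrow> complex mat")

definition homogeneous_bundle :: "nat \<Rightarrow> nat \<Rightarrow> hbundle \<Rightarrow> bool" where
  "homogeneous_bundle k n E \<longleftrightarrow>
     (\<forall>p\<in>parabolic k n. bundle_rep E p \<in> GL (bundle_rank E)) \<and>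
     (\<forall>p\<in>parabolic k n. \<forall>q\<in>parabolic k n.
        bundle_rep E (p * q) = bundle_rep E p * bundle_rep E q) \<and>
     regular_mat_on n (parabolic k n) (bundle_rank E) (bundle_rank E) (bundle_rep E)"

text \<open>Morphisms of algebraic vector bundles, not required to be \<open>GL n\<close>-equivariant: the map
  \<open>(g, v) \<mapsto> (g, \<phi> g v)\<close> has to respect the identifications above.\<close>

definition bundle_hom ::
    "nat \<Rightarrow> nat \<Rightarrow> hbundle \<Rightarrow> hbundle \<Rightarrow> (complex mat \<Rightarrow> complex mat) \<Rightarrow> bool" where
  "bundle_hom k n E F \<phi> \<longleftrightarrow>
     regular_mat_on n (GL n) (bundle_rank F) (bundle_rank E) \<phi> \<and>
     (\<forall>g\<in>GL n. \<forall>p\<in>parabolic k n. bundle_rep F p * \<phi> (g * p) = \<phi> g * bundle_rep E p)"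

definition bundle_iso :: "nat \<Rightarrow> nat \<Rightarrow> hbundle \<Rightarrow> hbundle \<Rightarrow> bool" where
  "bundle_iso k n E F \<longleftrightarrow>
     (\<exists>\<phi> \<psi>. bundle_hom k n E F \<phi> \<and> bundle_hom k n F E \<psi> \<and>
        (\<forall>g\<in>GL n. \<psi> g * \<phi> g = 1\<^sub>m (bundle_rank E) \<and> \<phi> g * \<psi> g = 1\<^sub>m (bundle_rank F)))"

definition iso_class :: "nat \<Rightarrow> nat \<Rightarrow> hbundle \<Rightarrow> hbundle set" where
  "iso_class k n E = {F. homogeneous_bundle k n F \<and> bundle_iso k n E F}"

definition global_section :: "nat \<Rightarrow> nat \<Rightarrow> hbundle \<Rightarrow> (complex mat \<Rightarrow> complex vec) \<Rightarrow> bool" where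
  "global_section k n E s \<longleftrightarrow>
     regular_vec_on n (GL n) (bundle_rank E) s \<and>
     (\<forall>g\<in>GL n. \<forall>p\<in>parabolic k n. bundle_rep E p *\<^sub>v s (g * p) = s g)"

definition globally_generated :: "nat \<Rightarrow> nat \<Rightarrow> hbundle \<Rightarrow> bool" where
  "globally_generated k n E \<longleftrightarrow>
     (\<forall>g\<in>GL n. \<forall>v\<in>carrier_vec (bundle_rank E). \<exists>s. global_section k n E s \<and> s g = v)"

definition direct_sum :: "hbundle list \<Rightarrow> hbundle" where
  "direct_sum Es = Bundle (sum_list (map bundle_rank Es))
     (\<lambda>p. diag_block_mat (map (\<lambda>E. bundle_rep E p) Es))"

definition dual :: "hbundle \<Rightarrow> hbundle" where
  "dual E = Bundle (bundle_rank E) (\<lambda>p. transpose_mat (the (mat_inverse (bundle_rep E p))))"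

definition det_bundle :: "hbundle \<Rightarrow> hbundle" where
  "det_bundle E = Bundle 1 (\<lambda>p. mat 1 1 (\<lambda>_. det (bundle_rep E p)))"

text \<open>The universal subbundle has fibre \<open>gr_point k n g\<close> over \<open>g\<close>, and \<open>(g, v)\<close> corresponds
  to the vector \<open>g (v, 0)\<close> in it. In the universal quotient bundle, \<open>(g, v)\<close> corresponds to the
  class of \<open>g (0, v)\<close>.\<close>

definition universal_sub :: "nat \<Rightarrow> nat \<Rightarrow> hbundle" where
  "universal_sub k n = Bundle k (\<lambda>p. mat k k (\<lambda>(i, j). p $$ (i, j)))"

definition universal_quot :: "nat \<Rightarrow> nat \<Rightarrow> hbundle" where
  "universal_quot k n = Bundle (n - k) (\<lambda>p. mat (n - k) (n - k) (\<lambda>(i, j). p $$ (k + i, k + j)))"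

text \<open>The Pluecker line bundle \<open>\<O>(1) = det S\<^sup>*\<close> is the ample generator of the Picard
  group.\<close>

definition line_bundle :: "nat \<Rightarrow> nat \<Rightarrow> int \<Rightarrow> hbundle" where
  "line_bundle k n m = Bundle 1
     (\<lambda>p. mat 1 1 (\<lambda>_. det (bundle_rep (dual (universal_sub k n)) p) powi m))"

text \<open>The first Chern class of \<open>E\<close> is that of \<open>det E\<close>, and the Picard group is identified with
  the integers by \<open>c\<^sub>1(\<O>(1)) = 1\<close>.\<close>

definition c1 :: "nat \<Rightarrow> nat \<Rightarrow> hbundle \<Rightarrow> int" where
  "c1 k n E = (THE m. bundle_iso k n (det_bundle E) (line_bundle k n m))"


section \<open>Schur functors\<close>

text \<open>The tensor power of order \<open>r\<close> of \<open>\<complex>\<^sup>m\<close>: a tensor is given by its coordinates, indexed by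
  lists of length \<open>r\<close> with entries below \<open>m\<close>.\<close>

definition multi_indices :: "nat \<Rightarrow> nat \<Rightarrow> nat list set" where
  "multi_indices m r = {xs. length xs = r \<and> set xs \<subseteq> {..<m}}"

definition tensors :: "nat \<Rightarrow> nat \<Rightarrow> (nat list \<Rightarrow> complex) set" where
  "tensors m r = {t. \<forall>xs. xs \<notin> multi_indices m r \<longrightarrow> t xs = 0}"

definition tensor_act ::
    "nat \<Rightarrow> nat \<Rightarrow> complex mat \<Rightarrow> (nat list \<Rightarrow> complex) \<Rightarrow> nat list \<Rightarrow> complex" where
  "tensor_act m r A t = (\<lambda>xs. if xs \<in> multi_indices m r
     then \<Sum>ys\<in>multi_indices m r. (\<Prod>l<r. A $$ (xs ! l, ys ! l)) * t ys else 0)"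

text \<open>The cells of the Young diagram of a partition, listed row by row; this numbers the cells and
  hence identifies them with the tensor factors.\<close>

definition cells :: "nat list \<Rightarrow> (nat \<times> nat) list" where
  "cells lam = concat (map (\<lambda>i. map (Pair i) [0..<lam ! i]) [0..<length lam])"

definition row_perms :: "nat list \<Rightarrow> (nat \<Rightarrow> nat) set" where
  "row_perms lam = {\<sigma>. \<sigma> permutes {..<sum_list lam} \<and>
     (\<forall>l<sum_list lam. fst (cells lam ! \<sigma> l) = fst (cells lam ! l))}"

definition col_perms :: "nat list \<Rightarrow> (nat \<Rightarrow> nat) set" where
  "col_perms lam = {\<sigma>. \<sigma> permutes {..<sum_list lam} \<and>
     (\<forall>l<sum_list lam. snd (cells lam ! \<sigma> l) = snd (cells lam ! l))}"

definition young_symmetrizer :: "nat list \<Rightarrow> (nat list \<Rightarrow> complex) \<Rightarrow> nat list \<Rightarrow> complex" where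
  "young_symmetrizer lam t = (\<lambda>xs. \<Sum>\<sigma>\<in>row_perms lam. \<Sum>\<tau>\<in>col_perms lam.
     of_int (sign \<tau>) * t (permute_list \<tau> (permute_list \<sigma> xs)))"

text \<open>The Schur functor \<open>S\<^sub>\<lambda>\<close> on \<open>\<complex>\<^sup>m\<close> is the image of the Young symmetrizer, in the convention
  where one row gives symmetric powers and one column gives exterior powers.\<close>

definition schur_space :: "nat \<Rightarrow> nat list \<Rightarrow> (nat list \<Rightarrow> complex) set" where
  "schur_space m lam = young_symmetrizer lam ` tensors m (sum_list lam)"

definition lin_comb ::
    "(nat list \<Rightarrow> complex) list \<Rightarrow> complex vec \<Rightarrow> nat list \<Rightarrow> complex" where
  "lin_comb bs c = (\<lambda>xs. \<Sum>j<length bs. c $ j * (bs ! j) xs)"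

definition is_basis ::
    "(nat list \<Rightarrow> complex) list \<Rightarrow> (nat list \<Rightarrow> complex) set \<Rightarrow> bool" where
  "is_basis bs W \<longleftrightarrow> bij_betw (lin_comb bs) (carrier_vec (length bs)) W"

text \<open>Some basis is fixed to write the action on \<open>S\<^sub>\<lambda> \<complex>\<^sup>m\<close> as matrices; another choice gives
  isomorphic bundles.\<close>

definition schur_basis :: "nat \<Rightarrow> nat list \<Rightarrow> (nat list \<Rightarrow> complex) list" where
  "schur_basis m lam = (SOME bs. is_basis bs (schur_space m lam))"

definition schur_dim :: "nat \<Rightarrow> nat list \<Rightarrow> nat" where
  "schur_dim m lam = length (schur_basis m lam)"

definition schur_coords :: "nat \<Rightarrow> nat list \<Rightarrow> (nat list \<Rightarrow> complex) \<Rightarrow> complex vec" where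
  "schur_coords m lam = the_inv_into (carrier_vec (schur_dim m lam)) (lin_comb (schur_basis m lam))"

definition schur_mat :: "nat \<Rightarrow> nat list \<Rightarrow> complex mat \<Rightarrow> complex mat" where
  "schur_mat m lam A = mat_of_cols (schur_dim m lam)
     (map (\<lambda>b. schur_coords m lam (tensor_act m (sum_list lam) A b)) (schur_basis m lam))"

definition schur :: "nat list \<Rightarrow> hbundle \<Rightarrow> hbundle" where
  "schur lam E = Bundle (schur_dim (bundle_rank E) lam)
     (\<lambda>p. schur_mat (bundle_rank E) lam (bundle_rep E p))"

abbreviation Sym2 :: "hbundle \<Rightarrow> hbundle" where
  "Sym2 E \<equiv> schur [2] E"

abbreviation Wedge2 :: "hbundle \<Rightarrow> hbundle" where
  "Wedge2 E \<equiv> schur [1, 1] E"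


section \<open>Decompositions into irreducible components\<close>

text \<open>Weights \<open>\<lambda>\<^sub>1 \<ge> \<dots> \<ge> \<lambda>\<^sub>m \<ge> 0\<close> with \<open>\<lambda>\<^sub>1 \<noteq> \<lambda>\<^sub>m\<close>.\<close>

definition nonconstant_weight :: "nat \<Rightarrow> nat list \<Rightarrow> bool" where
  "nonconstant_weight m lam \<longleftrightarrow> length lam = m \<and> sorted_wrt (\<ge>) lam \<and> hd lam \<noteq> last lam"

definition sub_components :: "nat \<Rightarrow> nat \<Rightarrow> nat list list \<Rightarrow> hbundle list" where
  "sub_components k n lams = map (\<lambda>lam. schur lam (dual (universal_sub k n))) lams"

definition quot_components :: "nat \<Rightarrow> nat \<Rightarrow> nat list list \<Rightarrow> hbundle list" where
  "quot_components k n mus = map (\<lambda>mu. schur mu (universal_quot k n)) mus"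

definition line_components :: "nat \<Rightarrow> nat \<Rightarrow> int list \<Rightarrow> hbundle list" where
  "line_components k n ps = map (line_bundle k n) ps"

definition decomposition ::
    "nat \<Rightarrow> nat \<Rightarrow> hbundle \<Rightarrow> nat list list \<Rightarrow> nat list list \<Rightarrow> int list \<Rightarrow> bool" where
  "decomposition k n F lams mus ps \<longleftrightarrow>
     (\<forall>lam\<in>set lams. nonconstant_weight k lam) \<and>
     (\<forall>mu\<in>set mus. nonconstant_weight (n - k) mu) \<and>
     (\<forall>p\<in>set ps. p > 0) \<and>
     bundle_iso k n F (direct_sum
       [direct_sum (sub_components k n lams),
        direct_sum (quot_components k n mus),
        direct_sum (line_components k n ps)])"

definition is_component :: "nat \<Rightarrow> nat \<Rightarrow> hbundle \<Rightarrow> hbundle list \<Rightarrow> bool" where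
  "is_component k n E Es \<longleftrightarrow> (\<exists>E'\<in>set Es. bundle_iso k n E' E)"


section \<open>The Grassmannian is \<open>GL n\<close> modulo the parabolic subgroup\<close>


lemma GL_iff: "g \<in> GL n \<longleftrightarrow> g \<in> carrier_mat n n \<and> det g \<noteq> 0"
proof -
  have "invertible_mat g \<longleftrightarrow> det g \<noteq> 0" if g: "g \<in> carrier_mat n n"
  proof
    assume "invertible_mat g"
    then obtain h where h: "g * h = 1\<^sub>m n" "h * g = 1\<^sub>m (dim_row h)"
      using g unfolding invertible_mat_def inverts_mat_def by auto
    have "dim_row h = n" "dim_col h = n"
      using arg_cong[OF h(1), of dim_col] arg_cong[OF h(2), of dim_col] g by auto
    then have "h \<in> carrier_mat n n" by auto
    then have "det g * det h = 1" using h(1) g det_mult[of g n h] by simp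
    then show "det g \<noteq> 0" by auto
  next
    assume "det g \<noteq> 0"
    from det_non_zero_imp_unit[OF g this, of "()"]
    obtain h where "h \<in> carrier_mat n n" "h * g = 1\<^sub>m n" "g * h = 1\<^sub>m n"
      unfolding Units_def ring_mat_def by auto
    then show "invertible_mat g"
      using g unfolding invertible_mat_def inverts_mat_def by auto
  qed
  then show ?thesis unfolding GL_def by auto
qed

lemma GL_inverse:
  assumes "g \<in> GL n"
  obtains h where "h \<in> GL n" "h * g = 1\<^sub>m n" "g * h = 1\<^sub>m n"
proof -
  have g: "g \<in> carrier_mat n n" "det g \<noteq> 0" using assms GL_iff by auto
  from det_non_zero_imp_unit[OF this, of "()"]
  obtain h where h: "h \<in> carrier_mat n n" "h * g = 1\<^sub>m n" "g * h = 1\<^sub>m n"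
    unfolding Units_def ring_mat_def by auto
  have "det h * det g = 1" using h g det_mult[of h n g] by simp
  then have "h \<in> GL n" using h GL_iff by auto
  then show thesis using that h by blast
qed

lemma GL_mult: "g \<in> GL n \<Longrightarrow> h \<in> GL n \<Longrightarrow> g * h \<in> GL n"
  by (auto simp: GL_iff det_mult)

lemma gr_point_mult:
  assumes "g \<in> GL n" "h \<in> GL n"
  shows "gr_point k n (g * h) = (\<lambda>v. g *\<^sub>v v) ` gr_point k n h"
  using assms unfolding gr_point_def image_image GL_def base_point_def
  by (intro image_cong) (auto intro: assoc_mult_mat_vec)

lemma parabolic_iff:
  assumes "k \<le> n" "p \<in> GL n"
  shows "p \<in> parabolic k n \<longleftrightarrow> gr_point k n p = base_point k n"
proof
  assume *: "gr_point k n p = base_point k n"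
  have p: "p \<in> carrier_mat n n" using assms GL_iff by auto
  have "p $$ (i, j) = 0" if "k \<le> i" "i < n" "j < k" for i j
  proof -
    have "unit_vec n j \<in> base_point k n" using that by (auto simp: base_point_def)
    then have "p *\<^sub>v unit_vec n j \<in> base_point k n" using * unfolding gr_point_def by blast
    then have "(p *\<^sub>v unit_vec n j) $ i = 0" using that unfolding base_point_def by auto
    moreover have "(p *\<^sub>v unit_vec n j) $ i = p $$ (i, j)"
      using p that assms by (simp add: scalar_prod_right_unit)
    ultimately show ?thesis by simp
  qed
  then show "p \<in> parabolic k n" using assms unfolding parabolic_def by auto
next
  assume "p \<in> parabolic k n"
  then have p: "p \<in> carrier_mat n n" "det p \<noteq> 0"
    and z: "\<And>i j. k \<le> i \<Longrightarrow> i < n \<Longrightarrow> j < k \<Longrightarrow> p $$ (i, j) = 0"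
    unfolding parabolic_def using GL_iff by auto
  define a where "a = mat k k (\<lambda>(i, j). p $$ (i, j))"
  define b where "b = mat k (n - k) (\<lambda>(i, j). p $$ (i, j + k))"
  define c where "c = mat (n - k) (n - k) (\<lambda>(i, j). p $$ (i + k, j + k))"
  have "p = four_block_mat a b (0\<^sub>m (n - k) k) c"
    using p assms z by (intro eq_matI) (auto simp: a_def b_def c_def)
  then have "det p = det a * det c"
    using det_four_block_mat_lower_left_zero[of a k b "n - k" "0\<^sub>m (n - k) k" c]
    by (simp add: a_def b_def c_def)
  then have a: "a \<in> carrier_mat k k" "det a \<noteq> 0" using p by (auto simp: a_def)
  then obtain a' where a': "a' \<in> carrier_mat k k" "a * a' = 1\<^sub>m k"
    using GL_inverse[of a k] GL_iff by metis
  have act: "p *\<^sub>v v = vec n (\<lambda>i. if i < k then (a *\<^sub>v vec k (\<lambda>i. v $ i)) $ i else 0)"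
    if "v \<in> base_point k n" for v
  proof (rule eq_vecI)
    fix i assume "i < dim_vec (vec n (\<lambda>i. if i < k then (a *\<^sub>v vec k (\<lambda>i. v $ i)) $ i else 0))"
    then have i: "i < n" by simp
    have v: "v \<in> carrier_vec n" "\<And>j. k \<le> j \<Longrightarrow> j < n \<Longrightarrow> v $ j = 0"
      using that unfolding base_point_def by auto
    have "(p *\<^sub>v v) $ i = (\<Sum>j\<in>{0..<n}. p $$ (i, j) * v $ j)"
      using p v i by (simp add: scalar_prod_def)
    also have "\<dots> = (\<Sum>j\<in>{0..<k}. p $$ (i, j) * v $ j)"
      using assms v by (intro sum.mono_neutral_right) auto
    also have "\<dots> = (if i < k then (a *\<^sub>v vec k (\<lambda>i. v $ i)) $ i else 0)"
      using i z by (auto simp: a_def scalar_prod_def)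
    finally show "(p *\<^sub>v v) $ i =
        vec n (\<lambda>i. if i < k then (a *\<^sub>v vec k (\<lambda>i. v $ i)) $ i else 0) $ i"
      using i by simp
  qed (use p in simp)
  show "gr_point k n p = base_point k n"
  proof
    show "gr_point k n p \<subseteq> base_point k n"
      unfolding gr_point_def using act by (auto simp: base_point_def)
    show "base_point k n \<subseteq> gr_point k n p"
    proof
      fix w assume w: "w \<in> base_point k n"
      define u where "u = a' *\<^sub>v vec k (\<lambda>i. w $ i)"
      define v where "v = vec n (\<lambda>i. if i < k then u $ i else 0)"
      have v: "v \<in> base_point k n" by (auto simp: v_def base_point_def)
      have "vec k (\<lambda>i. v $ i) = u"
        using assms a' by (intro eq_vecI) (auto simp: v_def u_def)
      moreover have "a *\<^sub>v u = vec k (\<lambda>i. w $ i)"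
        unfolding u_def using a a' assoc_mult_mat_vec[of a k k a' k "vec k (\<lambda>i. w $ i)"] by simp
      ultimately have "p *\<^sub>v v = vec n (\<lambda>i. if i < k then vec k (\<lambda>i. w $ i) $ i else 0)"
        using act[OF v] by (simp cong: if_cong)
      also have "\<dots> = w" using w by (intro eq_vecI) (auto simp: base_point_def)
      finally show "w \<in> gr_point k n p" using v unfolding gr_point_def by blast
    qed
  qed
qed

lemma gr_point_one: "gr_point k n (1\<^sub>m n) = base_point k n"
  unfolding gr_point_def base_point_def by (auto simp: image_iff)

lemma gr_point_eq_iff:
  assumes "k \<le> n" "g \<in> GL n" "h \<in> GL n"
  shows "gr_point k n g = gr_point k n h \<longleftrightarrow> (\<exists>p\<in>parabolic k n. h = g * p)"
proof
  assume *: "gr_point k n g = gr_point k n h"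
  obtain g' where g': "g' \<in> GL n" "g' * g = 1\<^sub>m n" "g * g' = 1\<^sub>m n"
    using GL_inverse[OF assms(2)] .
  have p: "g' * h \<in> GL n" using g' assms GL_mult by blast
  have "gr_point k n (g' * h) = gr_point k n (g' * g)"
    using * gr_point_mult[OF g'(1) assms(2)] gr_point_mult[OF g'(1) assms(3)] by metis
  then have "g' * h \<in> parabolic k n"
    using g' parabolic_iff[OF assms(1) p] gr_point_one by metis
  moreover have "h = g * (g' * h)"
    using g' assms assoc_mult_mat[of g n n g' n h n] left_mult_one_mat[of h n n]
    by (simp add: GL_iff)
  ultimately show "\<exists>p\<in>parabolic k n. h = g * p" by blast
next
  assume "\<exists>p\<in>parabolic k n. h = g * p"
  then obtain p where p: "p \<in> parabolic k n" "h = g * p" by blast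
  then have "p \<in> GL n" by (simp add: parabolic_def)
  then have "gr_point k n h = (\<lambda>v. g *\<^sub>v v) ` base_point k n"
    using p assms gr_point_mult[of g n p k] parabolic_iff by simp
  then show "gr_point k n g = gr_point k n h" by (simp add: gr_point_def)
qed

lemma gr_point_span:
  assumes "k \<le> n" "g \<in> GL n"
  shows "distinct (cols g)" "module.lin_indpt class_ring (module_vec TYPE(complex) n) (set (cols g))"
    "gr_point k n g =
       LinearCombinations.module.span class_ring (module_vec TYPE(complex) n) (set (take k (cols g)))"
proof -
  interpret vec_space "TYPE(complex)" n .
  have g: "g \<in> carrier_mat n n" "det g \<noteq> 0" using assms GL_iff by auto
  have rk: "rank g = n" using low_rank_det_zero g by blast
  show dist: "distinct (cols g)" using non_distinct_low_rank[OF g(1)] rk by auto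
  show "lin_indpt (set (cols g))" using full_rank_lin_indpt[OF g(1) rk dist] .
  define C where "C = mat n k (\<lambda>(i, j). g $$ (i, j))"
  have C: "C \<in> carrier_mat n k" by (simp add: C_def)
  have cols: "cols C = take k (cols g)"
    using g assms by (intro nth_equalityI) (auto simp: C_def intro!: eq_vecI)
  have distC: "distinct (cols C)" using dist cols by simp
  have Cv: "C *\<^sub>v vec k (\<lambda>i. v $ i) = g *\<^sub>v v" if "v \<in> base_point k n" for v
  proof (rule eq_vecI)
    have v: "v \<in> carrier_vec n" "\<And>j. k \<le> j \<Longrightarrow> j < n \<Longrightarrow> v $ j = 0"
      using that unfolding base_point_def by auto
    fix i assume "i < dim_vec (g *\<^sub>v v)"
    then have i: "i < n" using g by simp
    have "(g *\<^sub>v v) $ i = (\<Sum>j\<in>{0..<n}. g $$ (i, j) * v $ j)"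
      using g v i by (simp add: scalar_prod_def)
    also have "\<dots> = (\<Sum>j\<in>{0..<k}. g $$ (i, j) * v $ j)"
      using assms v by (intro sum.mono_neutral_right) auto
    also have "\<dots> = (C *\<^sub>v vec k (\<lambda>i. v $ i)) $ i"
      using i by (simp add: C_def scalar_prod_def)
    finally show "(C *\<^sub>v vec k (\<lambda>i. v $ i)) $ i = (g *\<^sub>v v) $ i" by simp
  qed (use g C in simp)
  have colsC: "set (cols C) \<subseteq> carrier_vec n" using C cols_dim[of C] by simp
  have "gr_point k n g = span (set (cols C))"
  proof (intro equalityI subsetI)
    fix w assume "w \<in> gr_point k n g"
    then obtain v where "v \<in> base_point k n" "w = g *\<^sub>v v" unfolding gr_point_def by blast
    then have "w = C *\<^sub>v vec k (\<lambda>i. v $ i)" using Cv by simp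
    also have "\<dots> = lincomb (\<lambda>a. vec k (\<lambda>i. v $ i) $ find_first a (cols C)) (set (cols C))"
      using lincomb_eq_mat_mult[OF C _ distC] by simp
    finally show "w \<in> span (set (cols C))" unfolding span_def by (auto simp: class_ring_simps)
  next
    fix w assume "w \<in> span (set (cols C))"
    then obtain a where "w = lincomb a (set (cols C))"
      using finite_span[OF _ ] colsC by auto
    then have w: "w = C *\<^sub>v vec k (\<lambda>i. a (col C i))" using mat_mult_eq_lincomb[OF C distC] by simp
    define v where "v = vec n (\<lambda>i. if i < k then a (col C i) else 0)"
    have v: "v \<in> base_point k n" by (auto simp: v_def base_point_def)
    have "vec k (\<lambda>i. v $ i) = vec k (\<lambda>i. a (col C i))" using assms by (auto simp: v_def)
    then have "w = g *\<^sub>v v" using Cv[OF v] w by simp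
    then show "w \<in> gr_point k n g" using v unfolding gr_point_def by blast
  qed
  then show "gr_point k n g = span (set (take k (cols g)))" using cols by simp
qed

lemma grassmannian_eq:
  assumes "k \<le> n"
  shows "grassmannian k n = gr_point k n ` GL n"
proof -
  interpret vec_space "TYPE(complex)" n .
  show ?thesis
  proof (intro equalityI subsetI)
    fix W assume "W \<in> gr_point k n ` GL n"
    then obtain g where g: "g \<in> GL n" "W = gr_point k n g" by blast
    define B where "B = set (take k (cols g))"
    have gc: "g \<in> carrier_mat n n" using g GL_iff by auto
    have sub: "B \<subseteq> set (cols g)" unfolding B_def by (rule set_take_subset)
    then have B: "B \<subseteq> carrier_vec n" using gc cols_dim[of g] by auto
    have li: "lin_indpt B"
      using subset_li_is_li[OF gr_point_span(2)[OF assms g(1)] sub] .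
    have card: "card B = k"
      unfolding B_def using gr_point_span(1)[OF assms g(1)] gc assms
      by (simp add: distinct_card)
    have W: "W = span B" using gr_point_span(3)[OF assms g(1)] g B_def by simp
    have "vectorspace.dim class_ring (span_vs B) = card B"
      using B li by (intro dim_span) (auto simp: maximal_def B_def)
    moreover have "subspace class_ring W V" using B W span_is_subspace by simp
    ultimately show "W \<in> grassmannian k n" unfolding grassmannian_def using W card by simp
  next
    fix W assume "W \<in> grassmannian k n"
    then have W: "subspace class_ring W V" "vectorspace.dim class_ring (vs W) = k"
      unfolding grassmannian_def by auto
    have Wc: "W \<subseteq> carrier_vec n" using W(1) unfolding subspace_def submodule_def by auto
    have sm: "submodule class_ring W V" using W(1) unfolding subspace_def by auto
    interpret Wv: vectorspace class_ring "vs W" using subspace_is_vs[OF W(1)] .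
    have "Wv.fin_dim"
    proof -
      have "\<exists>A. finite A \<and> maximal A (\<lambda>S. S \<subseteq> carrier (vs W) \<and> Wv.lin_indpt S)"
      proof (rule maximal_exists[where N = n and B = "{}"])
        fix S assume S: "S \<subseteq> carrier (vs W) \<and> Wv.lin_indpt S"
        then have SW: "S \<subseteq> W" by simp
        have "lin_indpt S" using span_li_not_depend(2)[OF SW sm] S by simp
        then show "finite S \<and> card S \<le> n"
          using li_le_dim[OF fin_dim, of S] SW Wc dim_is_n by auto
      qed (auto simp: Wv.lin_dep_def)
      then obtain A where "finite A" "Wv.basis A" using Wv.max_li_is_basis by blast
      then show ?thesis unfolding Wv.fin_dim_def Wv.basis_def by blast
    qed
    then obtain B where B: "finite B" "Wv.basis B" using Wv.finite_basis_exists by blast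
    have BW: "B \<subseteq> W" and gen: "Wv.gen_set B" and li: "Wv.lin_indpt B"
      using B(2) unfolding Wv.basis_def by auto
    have spanB: "span B = W" using span_li_not_depend(1)[OF BW sm] gen by simp
    have liB: "lin_indpt B" using span_li_not_depend(2)[OF BW sm] li by simp
    have cardB: "card B = k" using Wv.dim_basis[OF B] W(2) by simp
    have BC: "B \<subseteq> carrier_vec n" using BW Wc by auto
    obtain E where E: "finite E" "basis E" using finite_basis_exists[OF fin_dim] by blast
    have Ec: "E \<subseteq> carrier_vec n" "span E = carrier_vec n" "card E = n"
      using E dim_basis[OF E] dim_is_n unfolding basis_def by auto
    obtain C where C: "finite C" "C \<subseteq> carrier_vec n" "C \<inter> B = {}"
      "int (card C) \<le> int (card E) - int (card B)" "span (B \<union> C) = span E"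
      using replacement[OF B(1) E(1) _ liB] Ec BC by auto
    have BCf: "finite (B \<union> C)" "B \<union> C \<subseteq> carrier_vec n" "span (B \<union> C) = carrier_vec n"
      using B C BC Ec by auto
    have "card (B \<union> C) \<ge> n"
      using gen_ge_dim[OF BCf(1)] BCf dim_is_n by simp
    moreover have "card (B \<union> C) = card B + card C" using B C by (auto intro: card_Un_disjoint)
    ultimately have card: "card B + card C = n" "card (B \<union> C) = n" using C Ec by auto
    obtain bs where bs: "set bs = B" "distinct bs" using finite_distinct_list[OF B(1)] by blast
    obtain cs where cs: "set cs = C" "distinct cs" using finite_distinct_list[OF C(1)] by blast
    have len: "length bs = k" "length (bs @ cs) = n"
      using distinct_card[OF bs(2)] distinct_card[OF cs(2)] bs cs card cardB by auto
    define g where "g = mat_of_cols n (bs @ cs)"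
    have g: "g \<in> carrier_mat n n" unfolding g_def using len mat_of_cols_carrier(1) by metis
    have cols: "cols g = bs @ cs"
      unfolding g_def using bs cs BCf by (intro cols_mat_of_cols) auto
    have "rank g = vectorspace.dim class_ring (vs (carrier_vec n))"
      unfolding rank_def cols using bs cs BCf by simp
    also have "\<dots> = n" using dim_is_n by (simp add: module_vec_def)
    finally have "g \<in> GL n" using g det_rank_iff GL_iff by blast
    moreover have "gr_point k n g = W"
      using gr_point_span(3)[OF assms \<open>g \<in> GL n\<close>] cols len bs spanB by simp
    ultimately show "W \<in> gr_point k n ` GL n" by blast
  qed
qed

end

theory Submission
  imports Defs "Jordan_Normal_Form.Schur_Decomposition" "HOL-Library.Function_Algebras"
begin

text \<open>Put \<open>m = n - k\<close>. The summands \<open>S\<^sub>\<lambda> S\<^sup>*\<close>, \<open>S\<^sub>\<mu> Q\<close> and \<open>\<O>(p)\<close> have slope \<open>c\<^sub>1 / rank\<close> equal to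
\<open>|\<lambda>| / k\<close>, \<open>|\<mu>| / m\<close> and \<open>p\<close>. Nonconstant weights of size 1 give \<open>S\<^sup>*\<close> and \<open>Q\<close>, and \<open>\<mu>\<close> of size 2 gives
\<open>Sym\<^sup>2 Q\<close> or \<open>\<Lambda>\<^sup>2 Q\<close>, so the hypotheses force \<open>|\<lambda>| \<ge> 2\<close>, \<open>|\<mu>| \<ge> 2\<close>, and \<open>|\<mu>| \<ge> 3\<close> when \<open>k < m\<close>. The rank
\<open>k m - d\<close> and the degree \<open>k + m\<close> leave little room for such summands, and this bounds \<open>n\<close>
(\<open>rank_degree_bound\<close>).

If \<open>k = m\<close>, every summand has slope at least \<open>2 / k\<close>, and the excesses \<open>k c\<^sub>1 - 2 rank\<close> add up to
exactly \<open>2 d > 0\<close>. Some summand has positive excess, at most \<open>2 d\<close>. For \<open>\<O>(p)\<close> this excess is at least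
\<open>k - 2\<close>. For a Schur functor of weight size at least 3 the excess bounds the rank and hence \<open>k c\<^sub>1\<close> by
a multiple of \<open>d\<close>, and \<open>c\<^sub>1\<close> is a positive integer. In both cases \<open>k\<close> is bounded.

If \<open>k < m\<close>, summands \<open>S\<^sub>\<mu> Q\<close> of small slope have to be excluded. The rank of \<open>S\<^sub>\<mu> Q\<close> is at least
\<open>m choose |\<mu>|\<close> (\<open>schur_dim_ge_binomial\<close>), so for \<open>3 \<le> |\<mu>| \<le> m - 2\<close> already this summand has degree at least
\<open>(m - 1 choose 2)\<close>, which exceeds \<open>n\<close> as soon as \<open>m \<ge> 7\<close>. The remaining slopes \<open>|\<mu>| / m\<close> are at least
\<open>(m - 1) / m\<close>. For \<open>k \<ge> 3\<close> all slopes are then at least \<open>2 / k\<close>, whence \<open>k (m - k) \<le> 2 d\<close>; for \<open>k = 2\<close> all are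
at least \<open>(m - 1) / m\<close>, whence \<open>m \<le> d + 4\<close>.

Once \<open>n\<close> is bounded, positivity of the rank of every Schur functor (\<open>schur_dim_pos\<close>) bounds the number
of summands and the degree bounds the size of the weights, so only finitely many direct sums are left,
and an isomorphism class is determined by its direct sum (\<open>iso_class_cong\<close>).

The slopes rest on two computations. First, \<open>det S\<^sub>\<lambda>\<close> is a character of \<open>GL m\<close>; every character of \<open>GL m\<close>
factors through the determinant, and its values on scalar matrices show that it is the power of the
determinant of exponent \<open>dim S\<^sub>\<lambda> \<cdot> |\<lambda>| / m\<close> (\<open>character_eq_det_power\<close>, \<open>det_schur_mat\<close>). Secondly, the degree of
a line bundle is well defined because \<open>\<O>(a) \<cong> \<O>(b)\<close> implies \<open>a = b\<close> (\<open>line_bundle_iso_imp_eq\<close>).\<close>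

section \<open>Regular functions\<close>

lemma regular_sum:
  "(\<And>i. i \<in> I \<Longrightarrow> regular n (f i)) \<Longrightarrow> regular n (\<lambda>g. \<Sum>i\<in>I. f i g)"
  by (induction I rule: infinite_finite_induct) (auto intro: regular_const regular_add)

lemma regular_prod:
  "(\<And>i. i \<in> I \<Longrightarrow> regular n (f i)) \<Longrightarrow> regular n (\<lambda>g. \<Prod>i\<in>I. f i g)"
  by (induction I rule: infinite_finite_induct) (auto intro: regular_const regular_mult)

lemma regular_power: "regular n f \<Longrightarrow> regular n (\<lambda>g. f g ^ e)"
  by (induction e) (auto intro: regular_const regular_mult)

lemma regular_onI: "regular n h \<Longrightarrow> (\<And>g. g \<in> X \<Longrightarrow> f g = h g) \<Longrightarrow> regular_on n X f"
  unfolding regular_on_def by blast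

lemma regular_on_cong:
  "regular_on n X f \<Longrightarrow> (\<And>g. g \<in> X \<Longrightarrow> f' g = f g) \<Longrightarrow> regular_on n X f'"
  unfolding regular_on_def by auto

lemma regular_on_const: "regular_on n X (\<lambda>g. c)"
  by (rule regular_onI[OF regular_const]) simp

lemma regular_on_mult:
  assumes "regular_on n X f" "regular_on n X h"
  shows "regular_on n X (\<lambda>g. f g * h g)"
proof -
  obtain f' h' where "regular n f'" "regular n h'" "\<forall>g\<in>X. f g = f' g" "\<forall>g\<in>X. h g = h' g"
    using assms unfolding regular_on_def by blast
  then show ?thesis by (intro regular_onI[OF regular_mult[of n f' h']]) auto
qed

lemma regular_on_sum:
  assumes "\<And>i. i \<in> I \<Longrightarrow> regular_on n X (f i)"
  shows "regular_on n X (\<lambda>g. \<Sum>i\<in>I. f i g)"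
proof -
  obtain h where "\<And>i. i \<in> I \<Longrightarrow> regular n (h i) \<and> (\<forall>g\<in>X. f i g = h i g)"
    using assms unfolding regular_on_def by metis
  then show ?thesis
    by (intro regular_onI[OF regular_sum[of I n h]]) (auto intro: sum.cong)
qed

lemma regular_on_prod:
  assumes "\<And>i. i \<in> I \<Longrightarrow> regular_on n X (f i)"
  shows "regular_on n X (\<lambda>g. \<Prod>i\<in>I. f i g)"
proof -
  obtain h where "\<And>i. i \<in> I \<Longrightarrow> regular n (h i) \<and> (\<forall>g\<in>X. f i g = h i g)"
    using assms unfolding regular_on_def by metis
  then show ?thesis
    by (intro regular_onI[OF regular_prod[of I n h]]) (auto intro: prod.cong)
qed

lemma regular_det: "regular_on n (GL n) det"
proof (rule regular_onI)
  show "regular n (\<lambda>g. \<Sum>p\<in>{p. p permutes {0..<n}}. signof p * (\<Prod>i = 0..<n. g $$ (i, p i)))"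
    by (intro regular_sum regular_mult regular_const regular_prod regular_entry)
       (auto dest: permutes_in_image)
next
  fix g assume "g \<in> GL n"
  then show "det g = (\<Sum>p\<in>{p. p permutes {0..<n}}. signof p * (\<Prod>i = 0..<n. g $$ (i, p i)))"
    using det_def'[of g n] GL_iff by auto
qed

lemma regular_on_det:
  assumes "regular_mat_on n X r r f"
  shows "regular_on n X (\<lambda>g. det (f g))"
proof (rule regular_on_cong)
  show "regular_on n X
     (\<lambda>g. \<Sum>p\<in>{p. p permutes {0..<r}}. signof p * (\<Prod>i = 0..<r. f g $$ (i, p i)))"
    using assms unfolding regular_mat_on_def
    by (intro regular_on_sum regular_on_mult regular_on_const regular_on_prod)
       (auto dest: permutes_in_image)
next
  fix g assume "g \<in> X"
  then show "det (f g) =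
      (\<Sum>p\<in>{p. p permutes {0..<r}}. signof p * (\<Prod>i = 0..<r. f g $$ (i, p i)))"
    using assms det_def'[of "f g" r] unfolding regular_mat_on_def by auto
qed

lemma regular_mat_on_const: "A \<in> carrier_mat a b \<Longrightarrow> regular_mat_on n X a b (\<lambda>g. A)"
  unfolding regular_mat_on_def by (auto intro: regular_on_const)

lemma regular_mat_on_mult:
  assumes f: "regular_mat_on n X a b f" and h: "regular_mat_on n X b c h"
  shows "regular_mat_on n X a c (\<lambda>g. f g * h g)"
  unfolding regular_mat_on_def
proof (intro conjI ballI allI impI)
  fix g assume g: "g \<in> X"
  then show "f g * h g \<in> carrier_mat a c"
    using f h unfolding regular_mat_on_def by (auto intro: mult_carrier_mat)
next
  fix i j assume ij: "i < a" "j < c"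
  show "regular_on n X (\<lambda>g. (f g * h g) $$ (i, j))"
  proof (rule regular_on_cong)
    show "regular_on n X (\<lambda>g. \<Sum>l\<in>{0..<b}. f g $$ (i, l) * h g $$ (l, j))"
      using f h ij unfolding regular_mat_on_def by (intro regular_on_sum regular_on_mult) auto
    fix g assume "g \<in> X"
    then have "f g \<in> carrier_mat a b" "h g \<in> carrier_mat b c"
      using f h unfolding regular_mat_on_def by auto
    then show "(f g * h g) $$ (i, j) = (\<Sum>l\<in>{0..<b}. f g $$ (i, l) * h g $$ (l, j))"
      using ij by (simp add: scalar_prod_def)
  qed
qed


section \<open>Morphisms of homogeneous bundles\<close>

text \<open>The part of homogeneity that composing morphisms uses: it makes the matrix products associative. Schur
functors satisfy it by construction.\<close>

definition square_rep :: "nat \<Rightarrow> nat \<Rightarrow> hbundle \<Rightarrow> bool" where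
  "square_rep k n E \<longleftrightarrow>
     (\<forall>p\<in>parabolic k n. bundle_rep E p \<in> carrier_mat (bundle_rank E) (bundle_rank E))"

lemma homogeneous_square_rep: "homogeneous_bundle k n E \<Longrightarrow> square_rep k n E"
  unfolding homogeneous_bundle_def square_rep_def GL_def by auto

lemma parabolic_GL: "p \<in> parabolic k n \<Longrightarrow> p \<in> GL n"
  by (simp add: parabolic_def)

lemma bundle_hom_const:
  assumes "A \<in> carrier_mat (bundle_rank F) (bundle_rank E)"
    and "\<And>p. p \<in> parabolic k n \<Longrightarrow> bundle_rep F p * A = A * bundle_rep E p"
  shows "bundle_hom k n E F (\<lambda>g. A)"
  using assms unfolding bundle_hom_def by (auto intro: regular_mat_on_const)

lemma bundle_iso_refl: "square_rep k n E \<Longrightarrow> bundle_iso k n E E"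
  unfolding bundle_iso_def square_rep_def
  by (intro exI[of _ "\<lambda>g. 1\<^sub>m (bundle_rank E)"] conjI bundle_hom_const)
     (auto simp: left_mult_one_mat right_mult_one_mat)

lemma bundle_iso_sym: "bundle_iso k n E F \<Longrightarrow> bundle_iso k n F E"
  unfolding bundle_iso_def by blast

lemma bundle_hom_comp:
  assumes "bundle_hom k n E F \<phi>" "bundle_hom k n F G \<psi>"
    and "square_rep k n E" "square_rep k n F" "square_rep k n G"
  shows "bundle_hom k n E G (\<lambda>g. \<psi> g * \<phi> g)"
  unfolding bundle_hom_def
proof (intro conjI ballI)
  show "regular_mat_on n (GL n) (bundle_rank G) (bundle_rank E) (\<lambda>g. \<psi> g * \<phi> g)"
    using assms unfolding bundle_hom_def by (blast intro: regular_mat_on_mult)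
next
  fix g p assume g: "g \<in> GL n" and p: "p \<in> parabolic k n"
  let ?e = "bundle_rank E" and ?f = "bundle_rank F" and ?g = "bundle_rank G"
  have gp: "g * p \<in> GL n" using GL_mult g parabolic_GL p by blast
  have c: "\<phi> x \<in> carrier_mat ?f ?e" "\<psi> x \<in> carrier_mat ?g ?f" if "x \<in> GL n" for x
    using assms that unfolding bundle_hom_def regular_mat_on_def by auto
  have r: "bundle_rep E p \<in> carrier_mat ?e ?e" "bundle_rep F p \<in> carrier_mat ?f ?f"
    "bundle_rep G p \<in> carrier_mat ?g ?g"
    using assms p unfolding square_rep_def by auto
  have "bundle_rep G p * (\<psi> (g * p) * \<phi> (g * p)) = (bundle_rep G p * \<psi> (g * p)) * \<phi> (g * p)"
    using c[OF gp] r by (metis assoc_mult_mat)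
  also have "\<dots> = (\<psi> g * bundle_rep F p) * \<phi> (g * p)"
    using assms g p unfolding bundle_hom_def by simp
  also have "\<dots> = \<psi> g * (bundle_rep F p * \<phi> (g * p))"
    using c[OF gp] c[OF g] r by (metis assoc_mult_mat)
  also have "\<dots> = \<psi> g * (\<phi> g * bundle_rep E p)"
    using assms g p unfolding bundle_hom_def by simp
  also have "\<dots> = \<psi> g * \<phi> g * bundle_rep E p"
    using c[OF g] r by (metis assoc_mult_mat)
  finally show "bundle_rep G p * (\<psi> (g * p) * \<phi> (g * p)) = \<psi> g * \<phi> g * bundle_rep E p" .
qed

lemma bundle_iso_trans:
  assumes "bundle_iso k n E F" "bundle_iso k n F G"
    and "square_rep k n E" "square_rep k n F" "square_rep k n G"
  shows "bundle_iso k n E G"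
proof -
  let ?e = "bundle_rank E" and ?f = "bundle_rank F" and ?g = "bundle_rank G"
  obtain \<phi> \<psi> where 1: "bundle_hom k n E F \<phi>" "bundle_hom k n F E \<psi>"
    "\<And>g. g \<in> GL n \<Longrightarrow> \<psi> g * \<phi> g = 1\<^sub>m ?e \<and> \<phi> g * \<psi> g = 1\<^sub>m ?f"
    using assms(1) unfolding bundle_iso_def by blast
  obtain \<phi>' \<psi>' where 2: "bundle_hom k n F G \<phi>'" "bundle_hom k n G F \<psi>'"
    "\<And>g. g \<in> GL n \<Longrightarrow> \<psi>' g * \<phi>' g = 1\<^sub>m ?f \<and> \<phi>' g * \<psi>' g = 1\<^sub>m ?g"
    using assms(2) unfolding bundle_iso_def by blast
  have cancel: "(A * B) * (C * D) = 1\<^sub>m r"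
    if "A \<in> carrier_mat r s" "B \<in> carrier_mat s t" "C \<in> carrier_mat t s" "D \<in> carrier_mat s r"
      "B * C = 1\<^sub>m s" "A * D = 1\<^sub>m r" for A B C D :: "complex mat" and r s t
  proof -
    have "(A * B) * (C * D) = A * (B * (C * D))"
      using that by (intro assoc_mult_mat) auto
    also have "B * (C * D) = (B * C) * D"
      using that by (intro assoc_mult_mat[symmetric]) auto
    finally show ?thesis using that by simp
  qed
  have car: "\<phi> g \<in> carrier_mat ?f ?e" "\<psi> g \<in> carrier_mat ?e ?f"
    "\<phi>' g \<in> carrier_mat ?g ?f" "\<psi>' g \<in> carrier_mat ?f ?g" if "g \<in> GL n" for g
    using 1 2 that unfolding bundle_hom_def regular_mat_on_def by auto
  show ?thesis unfolding bundle_iso_def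
  proof (intro exI conjI ballI)
    show "bundle_hom k n E G (\<lambda>g. \<phi>' g * \<phi> g)" by (rule bundle_hom_comp[OF 1(1) 2(1) assms(3-5)])
    show "bundle_hom k n G E (\<lambda>g. \<psi> g * \<psi>' g)" by (rule bundle_hom_comp[OF 2(2) 1(2) assms(5,4,3)])
    fix g assume g: "g \<in> GL n"
    show "\<psi> g * \<psi>' g * (\<phi>' g * \<phi> g) = 1\<^sub>m ?e"
      by (rule cancel[of _ _ ?f _ ?g]) (use 1(3)[OF g] 2(3)[OF g] car[OF g] in auto)
    show "\<phi>' g * \<phi> g * (\<psi> g * \<psi>' g) = 1\<^sub>m ?g"
      by (rule cancel[of _ _ ?f _ ?e]) (use 1(3)[OF g] 2(3)[OF g] car[OF g] in auto)
  qed
qed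

text \<open>This reduces the count of isomorphism classes to a count of decompositions.\<close>

lemma iso_class_cong:
  assumes "homogeneous_bundle k n F" "square_rep k n E" "bundle_iso k n F E"
  shows "iso_class k n F = iso_class k n E"
proof -
  have "bundle_iso k n F G \<longleftrightarrow> bundle_iso k n E G" if "homogeneous_bundle k n G" for G
    using assms(2,3) homogeneous_square_rep[OF assms(1)] homogeneous_square_rep[OF that]
      bundle_iso_trans[of k n F E G] bundle_iso_trans[of k n E F G] bundle_iso_sym[of k n F E]
    by metis
  then show ?thesis unfolding iso_class_def by auto
qed

text \<open>Both dimensions are the trace of the respective identity, and \<open>A B\<close> and \<open>B A\<close> have the same trace.\<close>

lemma inverse_pair_imp_eq_dim:
  assumes A: "A \<in> carrier_mat a b" and B: "B \<in> carrier_mat b a"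
    and "A * B = 1\<^sub>m a" "B * A = (1\<^sub>m b :: complex mat)"
  shows "a = b"
proof -
  have "of_nat a = (\<Sum>i<a. (A * B) $$ (i, i))" using assms by simp
  also have "\<dots> = (\<Sum>i<a. \<Sum>j<b. A $$ (i, j) * B $$ (j, i))"
    using A B by (intro sum.cong) (auto simp: scalar_prod_def atLeast0LessThan)
  also have "\<dots> = (\<Sum>j<b. \<Sum>i<a. B $$ (j, i) * A $$ (i, j))"
    by (subst sum.swap) (simp add: mult.commute)
  also have "\<dots> = (\<Sum>j<b. (B * A) $$ (j, j))"
    using A B by (intro sum.cong) (auto simp: scalar_prod_def atLeast0LessThan)
  also have "\<dots> = of_nat b" using assms by simp
  finally show ?thesis using of_nat_eq_iff by blast
qed

lemma one_in_GL: "1\<^sub>m n \<in> GL n"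
  by (simp add: GL_iff)

lemma bundle_iso_rank:
  assumes "bundle_iso k n E F"
  shows "bundle_rank E = bundle_rank F"
proof -
  obtain \<phi> \<psi> where 1: "bundle_hom k n E F \<phi>" "bundle_hom k n F E \<psi>"
    "\<forall>g\<in>GL n. \<psi> g * \<phi> g = 1\<^sub>m (bundle_rank E) \<and> \<phi> g * \<psi> g = 1\<^sub>m (bundle_rank F)"
    using assms unfolding bundle_iso_def by blast
  show ?thesis
    by (rule inverse_pair_imp_eq_dim[of "\<psi> (1\<^sub>m n)" _ _ "\<phi> (1\<^sub>m n)"])
       (use 1 one_in_GL in \<open>auto simp: bundle_hom_def regular_mat_on_def\<close>)
qed

lemma regular_mat_on_1x1: "regular_on n X f \<Longrightarrow> regular_mat_on n X 1 1 (\<lambda>g. mat 1 1 (\<lambda>_. f g))"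
  unfolding regular_mat_on_def by auto

lemma mat_1x1_mult: "mat 1 1 (\<lambda>_. a) * mat 1 1 (\<lambda>_. b) = mat 1 1 (\<lambda>_. a * b :: complex)"
  by (intro eq_matI) (auto simp: scalar_prod_def)

(* The simplifier writes the dimension 1 as Suc 0. *)
declare mat_1x1_mult [simplified, simp]

lemma bundle_hom_1x1:
  assumes "regular_on n (GL n) f"
    and "bundle_rank E = 1" "bundle_rank F = 1"
    and "\<And>p. p \<in> parabolic k n \<Longrightarrow> bundle_rep E p = mat 1 1 (\<lambda>_. a p)"
    and "\<And>p. p \<in> parabolic k n \<Longrightarrow> bundle_rep F p = mat 1 1 (\<lambda>_. b p)"
    and "\<And>g p. g \<in> GL n \<Longrightarrow> p \<in> parabolic k n \<Longrightarrow> b p * f (g * p) = f g * a p"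
  shows "bundle_hom k n E F (\<lambda>g. mat 1 1 (\<lambda>_. f g))"
  unfolding bundle_hom_def using assms(2-6) regular_mat_on_1x1[OF assms(1)]
  by simp

text \<open>Line bundles with cocycles \<open>a\<close> and \<open>b\<close> are isomorphic through a nowhere vanishing regular function \<open>f\<close>;
that the inverse of \<open>f\<close> is compatible with the cocycles follows from the compatibility of \<open>f\<close>.\<close>

lemma bundle_iso_1x1:
  assumes "regular_on n (GL n) f" "regular_on n (GL n) h" "\<And>g. g \<in> GL n \<Longrightarrow> f g * h g = 1"
    and "bundle_rank E = 1" "bundle_rank F = 1"
    and "\<And>p. p \<in> parabolic k n \<Longrightarrow> bundle_rep E p = mat 1 1 (\<lambda>_. a p)"
    and "\<And>p. p \<in> parabolic k n \<Longrightarrow> bundle_rep F p = mat 1 1 (\<lambda>_. b p)"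
    and "\<And>g p. g \<in> GL n \<Longrightarrow> p \<in> parabolic k n \<Longrightarrow> b p * f (g * p) = f g * a p"
  shows "bundle_iso k n E F"
  unfolding bundle_iso_def
proof (intro exI conjI ballI)
  show "bundle_hom k n E F (\<lambda>g. mat 1 1 (\<lambda>_. f g))"
    by (rule bundle_hom_1x1) (use assms in auto)
  show "bundle_hom k n F E (\<lambda>g. mat 1 1 (\<lambda>_. h g))"
  proof (rule bundle_hom_1x1)
    fix g p assume g: "g \<in> GL n" and p: "p \<in> parabolic k n"
    then have gp: "g * p \<in> GL n" using GL_mult parabolic_GL by blast
    have "a p * h (g * p) = (h g * (f g * a p)) * h (g * p)"
      using assms(3)[OF g] by (simp add: mult.commute mult.left_commute)
    also have "\<dots> = h g * b p * (f (g * p) * h (g * p))"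
      using assms(8)[OF g p, symmetric] by simp
    finally show "a p * h (g * p) = h g * b p" using assms(3)[OF gp] by simp
  qed (use assms in auto)
  fix g assume g: "g \<in> GL n"
  have [simp]: "mat (Suc 0) (Suc 0) (\<lambda>_. 1::complex) = 1\<^sub>m (Suc 0)" by (intro eq_matI) auto
  show "mat 1 1 (\<lambda>_. h g) * mat 1 1 (\<lambda>_. f g) = 1\<^sub>m (bundle_rank E)"
    using assms(3)[OF g] assms(4) by (simp add: mult.commute)
  show "mat 1 1 (\<lambda>_. f g) * mat 1 1 (\<lambda>_. h g) = 1\<^sub>m (bundle_rank F)"
    using assms(3)[OF g] assms(5) by simp
qed

text \<open>The determinants of mutually inverse isomorphisms are mutually inverse.\<close>

lemma bundle_iso_det_bundle:
  assumes iso: "bundle_iso k n E F" and sq: "square_rep k n E" "square_rep k n F"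
  shows "bundle_iso k n (det_bundle E) (det_bundle F)"
proof -
  define r where "r = bundle_rank E"
  have r: "bundle_rank E = r" "bundle_rank F = r"
    using bundle_iso_rank[OF iso] by (auto simp: r_def)
  obtain \<phi> \<psi> where 1: "bundle_hom k n E F \<phi>" "bundle_hom k n F E \<psi>"
    "\<And>g. g \<in> GL n \<Longrightarrow> \<phi> g * \<psi> g = 1\<^sub>m r"
    using iso r unfolding bundle_iso_def by auto
  have reg: "regular_mat_on n (GL n) r r \<phi>" "regular_mat_on n (GL n) r r \<psi>"
    using 1 r unfolding bundle_hom_def by auto
  then have c: "\<phi> g \<in> carrier_mat r r" "\<psi> g \<in> carrier_mat r r" if "g \<in> GL n" for g
    using that unfolding regular_mat_on_def by auto
  have s: "bundle_rep E p \<in> carrier_mat r r" "bundle_rep F p \<in> carrier_mat r r"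
    if "p \<in> parabolic k n" for p using that sq r unfolding square_rep_def by auto
  show ?thesis
  proof (rule bundle_iso_1x1)
    show "regular_on n (GL n) (\<lambda>g. det (\<phi> g))" "regular_on n (GL n) (\<lambda>g. det (\<psi> g))"
      using regular_on_det reg by auto
    show "det (\<phi> g) * det (\<psi> g) = 1" if "g \<in> GL n" for g
      using det_mult[OF c(1)[OF that] c(2)[OF that]] 1(3)[OF that] by simp
    fix g p assume g: "g \<in> GL n" and p: "p \<in> parabolic k n"
    then have gp: "g * p \<in> GL n" using GL_mult parabolic_GL by blast
    have "bundle_rep F p * \<phi> (g * p) = \<phi> g * bundle_rep E p"
      using 1 g p unfolding bundle_hom_def by blast
    then show "det (bundle_rep F p) * det (\<phi> (g * p)) = det (\<phi> g) * det (bundle_rep E p)"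
      using det_mult[OF s(2)[OF p] c(1)[OF gp]] det_mult[OF c(1)[OF g] s(1)[OF p]] by simp
  qed (auto simp: det_bundle_def)
qed


section \<open>Line bundles of different degree are not isomorphic\<close>

lemma regular_along_polynomial_path:
  assumes "regular n h" and "\<And>i j. i < n \<Longrightarrow> j < n \<Longrightarrow> \<exists>q. \<forall>z. \<gamma> z $$ (i, j) = poly q z"
    and "\<And>z. det (\<gamma> z) = c"
  shows "\<exists>q. \<forall>z. h (\<gamma> z) = poly q z"
  using assms(1)
proof induction
  case (regular_const c)
  show ?case by (intro exI[of _ "[:c:]"]) simp
next
  case (regular_add f h)
  then obtain p q where "\<forall>z. f (\<gamma> z) = poly p z" "\<forall>z. h (\<gamma> z) = poly q z" by blast
  then show ?case by (intro exI[of _ "p + q"]) simp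
next
  case (regular_mult f h)
  then obtain p q where "\<forall>z. f (\<gamma> z) = poly p z" "\<forall>z. h (\<gamma> z) = poly q z" by blast
  then show ?case by (intro exI[of _ "p * q"]) simp
next
  case regular_inverse_det
  show ?case using assms(3) by (intro exI[of _ "[:inverse c:]"]) simp
qed (use assms(2) in blast)

text \<open>Along the path, \<open>f\<close> and \<open>f'\<close> become polynomials in one variable with product 1, and such polynomials are
constant.\<close>

lemma unit_along_polynomial_path:
  assumes "regular_on n (GL n) f" "regular_on n (GL n) f'" "\<And>g. g \<in> GL n \<Longrightarrow> f g * f' g = 1"
    and "\<And>i j. i < n \<Longrightarrow> j < n \<Longrightarrow> \<exists>q. \<forall>z. \<gamma> z $$ (i, j) = poly q z"
    and "\<And>z. det (\<gamma> z) = c" "\<And>z. \<gamma> z \<in> GL n"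
  shows "\<exists>a. \<forall>z. f (\<gamma> z) = a"
proof -
  obtain h h' where h: "regular n h" "regular n h'" "\<forall>g\<in>GL n. f g = h g" "\<forall>g\<in>GL n. f' g = h' g"
    using assms(1,2) unfolding regular_on_def by blast
  obtain p where p: "\<forall>z. h (\<gamma> z) = poly p z"
    using regular_along_polynomial_path[OF h(1) assms(4,5)] by blast
  obtain q where q: "\<forall>z. h' (\<gamma> z) = poly q z"
    using regular_along_polynomial_path[OF h(2) assms(4,5)] by blast
  have "poly (p * q) z = poly 1 z" for z
    using p q h assms(3)[OF assms(6)[of z]] assms(6) by simp
  then have "p * q = 1" using poly_eq_poly_eq_iff by blast
  then have "p \<noteq> 0" "q \<noteq> 0" by auto
  then have "degree p = 0" using degree_mult_eq[of p q] \<open>p * q = 1\<close> by simp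
  then obtain a where "p = [:a:]" by (rule degree_eq_zeroE)
  then show ?thesis using p h assms(6) by auto
qed

definition mat2 :: "'a \<Rightarrow> 'a \<Rightarrow> 'a \<Rightarrow> 'a \<Rightarrow> 'a mat" where
  "mat2 a b c d =
     mat 2 2 (\<lambda>(i, j). if i = 0 then if j = 0 then a else b else if j = 0 then c else d)"

lemma mat2_carrier [simp]: "mat2 a b c d \<in> carrier_mat 2 2"
  by (simp add: mat2_def)

lemma mat2_mult:
  "mat2 a b c d * mat2 a' b' c' d' =
   mat2 (a * a' + b * c') (a * b' + b * d') (c * a' + d * c') (c * b' + d * d' :: complex)"
  by (intro eq_matI) (auto simp: mat2_def scalar_prod_def numeral_2_eq_2 less_Suc_eq)

lemma mat2_one: "mat2 1 0 0 1 = (1\<^sub>m 2 :: complex mat)"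
  by (intro eq_matI) (auto simp: mat2_def less_Suc_eq numeral_2_eq_2)

lemma block_diag_mult:
  fixes A :: "'a :: comm_ring_1 mat"
  assumes "A \<in> carrier_mat r r" "C \<in> carrier_mat r r" "B \<in> carrier_mat s s" "D \<in> carrier_mat s s"
  shows "four_block_mat A (0\<^sub>m r s) (0\<^sub>m s r) B * four_block_mat C (0\<^sub>m r s) (0\<^sub>m s r) D
    = four_block_mat (A * C) (0\<^sub>m r s) (0\<^sub>m s r) (B * D)"
  using assms mult_four_block_mat[of A r r "0\<^sub>m r s" s "0\<^sub>m s r" s B C r "0\<^sub>m r s" s "0\<^sub>m s r" D]
  by simp

text \<open>The embedding of 2 by 2 matrices in rows and columns \<open>l\<close> and \<open>l + 1\<close>.\<close>

definition embed2 :: "nat \<Rightarrow> nat \<Rightarrow> complex mat \<Rightarrow> complex mat" where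
  "embed2 l m X = four_block_mat (1\<^sub>m l) (0\<^sub>m l (2 + m)) (0\<^sub>m (2 + m) l)
     (four_block_mat X (0\<^sub>m 2 m) (0\<^sub>m m 2) (1\<^sub>m m))"

lemma embed2_carrier: "X \<in> carrier_mat 2 2 \<Longrightarrow> embed2 l m X \<in> carrier_mat (l + (2 + m)) (l + (2 + m))"
  unfolding embed2_def by (intro four_block_carrier_mat) auto

lemma embed2_mult:
  assumes "X \<in> carrier_mat 2 2" "Y \<in> carrier_mat 2 2"
  shows "embed2 l m X * embed2 l m Y = embed2 l m (X * Y)"
  using assms unfolding embed2_def
  by (subst block_diag_mult) (auto intro: four_block_carrier_mat simp: block_diag_mult)

lemma det_embed2:
  assumes "X \<in> carrier_mat 2 2"
  shows "det (embed2 l m X) = det X"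
proof -
  have "det (four_block_mat X (0\<^sub>m 2 m) (0\<^sub>m m 2) (1\<^sub>m m)) = det X"
    using det_four_block_mat_lower_left_zero[OF assms, of "0\<^sub>m 2 m" m "0\<^sub>m m 2" "1\<^sub>m m"] by simp
  moreover have "four_block_mat X (0\<^sub>m 2 m) (0\<^sub>m m 2) (1\<^sub>m m) \<in> carrier_mat (2 + m) (2 + m)"
    using assms by (intro four_block_carrier_mat) auto
  ultimately show ?thesis
    unfolding embed2_def
    using det_four_block_mat_lower_left_zero[of "1\<^sub>m l :: complex mat" l "0\<^sub>m l (2 + m)" "2 + m"
        "0\<^sub>m (2 + m) l"] by simp
qed

lemma det_mat2_triangular:
  "det (mat2 a b 0 d) = (a * d :: complex)" "det (mat2 a 0 c d) = (a * d :: complex)"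
proof -
  show "det (mat2 a b 0 d) = a * d"
    by (subst det_upper_triangular[of _ 2])
       (auto simp: prod_list_diag_prod upper_triangular_def mat2_def numeral_2_eq_2)
  show "det (mat2 a 0 c d) = a * d"
    by (subst det_lower_triangular[of 2])
       (auto simp: prod_list_diag_prod mat2_def numeral_2_eq_2)
qed

lemma embed2_one: "embed2 l m (1\<^sub>m 2) = 1\<^sub>m (l + (2 + m))"
  by (simp add: embed2_def)

lemma embed2_GL:
  assumes "X \<in> carrier_mat 2 2" "Y \<in> carrier_mat 2 2" "X * Y = 1\<^sub>m 2"
  shows "embed2 l m X \<in> GL (l + (2 + m))"
proof -
  have "embed2 l m X * embed2 l m Y = 1\<^sub>m (l + (2 + m))"
    using assms by (simp add: embed2_mult embed2_one)
  then have "det (embed2 l m X) * det (embed2 l m Y) = 1"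
    using det_mult[OF embed2_carrier[OF assms(1)] embed2_carrier[OF assms(2)], of l m] by simp
  then show ?thesis using embed2_carrier[OF assms(1)] by (auto simp: GL_iff)
qed

lemma embed2_index:
  assumes "i < l + (2 + m)" "j < l + (2 + m)" "X \<in> carrier_mat 2 2"
  shows "embed2 l m X $$ (i, j) =
    (if l \<le> i \<and> i < l + 2 \<and> l \<le> j \<and> j < l + 2 then X $$ (i - l, j - l) else if i = j then 1 else 0)"
  using assms unfolding embed2_def by auto

lemma embed2_polynomial:
  assumes "\<And>i j. i < 2 \<Longrightarrow> j < 2 \<Longrightarrow> \<exists>q. \<forall>z. X z $$ (i, j) = poly q z" "\<And>z. X z \<in> carrier_mat 2 2"
    and "i < l + (2 + m)" "j < l + (2 + m)"
  shows "\<exists>q. \<forall>z. embed2 l m (X z) $$ (i, j) = poly q z"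
proof (cases "l \<le> i \<and> i < l + 2 \<and> l \<le> j \<and> j < l + 2")
  case True
  then have "i - l < 2" "j - l < 2" by auto
  then obtain q where "\<forall>z. X z $$ (i - l, j - l) = poly q z" using assms(1) by blast
  then show ?thesis using True assms by (auto simp: embed2_index)
next
  case False
  show ?thesis
    by (intro exI[of _ "if i = j then 1 else 0"] allI)
       (simp only: embed2_index[OF assms(3,4,2)] if_not_P[OF False] poly_1 poly_0 split: if_split, simp)
qed

lemma mat_inverse_GL:
  assumes "A \<in> GL k"
  obtains B where "mat_inverse A = Some B" "A * B = 1\<^sub>m k" "B * A = 1\<^sub>m k" "B \<in> carrier_mat k k"
proof (cases "mat_inverse A")
  case None
  have A: "A \<in> carrier_mat k k" "det A \<noteq> 0" using assms GL_iff by auto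
  show ?thesis using mat_inverse(1)[OF A(1) None, of "()"] det_non_zero_imp_unit[OF A, of "()"] by simp
next
  case (Some B)
  then show ?thesis using that mat_inverse(2)[OF _ Some] assms GL_iff by auto
qed

definition block_sub :: "nat \<Rightarrow> complex mat \<Rightarrow> complex mat" where
  "block_sub k p = mat k k (\<lambda>(i, j). p $$ (i, j))"

definition block_quot :: "nat \<Rightarrow> nat \<Rightarrow> complex mat \<Rightarrow> complex mat" where
  "block_quot k n p = mat (n - k) (n - k) (\<lambda>(i, j). p $$ (k + i, k + j))"

lemma block_carrier [simp]:
  "block_sub k p \<in> carrier_mat k k" "block_quot k n p \<in> carrier_mat (n - k) (n - k)"
  by (auto simp: block_sub_def block_quot_def)

lemma det_parabolic:
  assumes "p \<in> parabolic k n" "k \<le> n"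
  shows "det p = det (block_sub k p) * det (block_quot k n p)"
proof -
  have p: "p \<in> carrier_mat n n" "\<And>i j. k \<le> i \<Longrightarrow> i < n \<Longrightarrow> j < k \<Longrightarrow> p $$ (i, j) = 0"
    using assms unfolding parabolic_def GL_iff by auto
  have "p = four_block_mat (block_sub k p) (mat k (n - k) (\<lambda>(i, j). p $$ (i, k + j)))
     (0\<^sub>m (n - k) k) (block_quot k n p)"
    using p assms by (intro eq_matI) (auto simp: block_sub_def block_quot_def)
  then show ?thesis
    using det_four_block_mat_lower_left_zero[of "block_sub k p" k
        "mat k (n - k) (\<lambda>(i, j). p $$ (i, k + j))" "n - k" "0\<^sub>m (n - k) k" "block_quot k n p"]
    by simp
qed

lemma blocks_GL:
  assumes "p \<in> parabolic k n" "k \<le> n"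
  shows "block_sub k p \<in> GL k" "block_quot k n p \<in> GL (n - k)"
  using det_parabolic[OF assms] parabolic_GL[OF assms(1)] by (auto simp: GL_iff)

lemma dual_sub_rep:
  assumes "p \<in> parabolic k n" "k \<le> n"
  shows "bundle_rep (dual (universal_sub k n)) p \<in> GL k"
    and "det (bundle_rep (dual (universal_sub k n)) p) = inverse (det (block_sub k p))"
proof -
  obtain B where B: "mat_inverse (block_sub k p) = Some B" "block_sub k p * B = 1\<^sub>m k"
    "B \<in> carrier_mat k k" using mat_inverse_GL[OF blocks_GL(1)[OF assms]] .
  have "det (block_sub k p) * det B = 1"
    using det_mult[OF block_carrier(1) B(3), of p] B by simp
  then have d: "det B = inverse (det (block_sub k p))"
    by (metis inverse_unique)
  have r: "bundle_rep (dual (universal_sub k n)) p = transpose_mat B"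
    using B by (simp add: dual_def universal_sub_def block_sub_def)
  show "det (bundle_rep (dual (universal_sub k n)) p) = inverse (det (block_sub k p))"
    using r d det_transpose[OF B(3)] by simp
  then show "bundle_rep (dual (universal_sub k n)) p \<in> GL k"
    using r B(3) blocks_GL(1)[OF assms] by (auto simp: GL_iff)
qed

lemma line_bundle_rep:
  assumes "p \<in> parabolic k n" "k \<le> n"
  shows "bundle_rep (line_bundle k n m) p = mat 1 1 (\<lambda>_. inverse (det (block_sub k p)) powi m)"
  using dual_sub_rep[OF assms] by (simp add: line_bundle_def)

text \<open>The bundles are compared on a projective line, the image of an embedded \<open>SL\<^sub>2\<close>. The paths \<open>U\<close> and \<open>V\<close> lift
the two affine charts of this line, and \<open>V (1 / z) P z = U z\<close> with \<open>P z\<close> in the parabolic subgroup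
describes the change of charts. An isomorphism from \<open>\<O>(a)\<close> to \<open>\<O>(b)\<close> is a nowhere vanishing function,
hence constant along \<open>U\<close> and along \<open>V\<close>, while its values on \<open>U z\<close> and \<open>V (1 / z)\<close> differ by the factor
\<open>z\<close> to the power \<open>b - a\<close>.\<close>

lemma line_bundle_iso_imp_eq:
  assumes kn: "0 < k" "k < n" and iso: "bundle_iso k n (line_bundle k n a) (line_bundle k n b)"
  shows "a = b"
proof -
  obtain l m where lm: "k = l + 1" "n = l + (2 + m)"
    using kn by (intro that[of "k - 1" "n - k - 1"]) auto
  obtain \<phi> \<psi> where 1: "bundle_hom k n (line_bundle k n a) (line_bundle k n b) \<phi>"
    "bundle_hom k n (line_bundle k n b) (line_bundle k n a) \<psi>"
    "\<And>g. g \<in> GL n \<Longrightarrow> \<phi> g * \<psi> g = 1\<^sub>m 1"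
    using iso unfolding bundle_iso_def by (auto simp: line_bundle_def)
  have reg: "regular_mat_on n (GL n) 1 1 \<phi>" "regular_mat_on n (GL n) 1 1 \<psi>"
    using 1 unfolding bundle_hom_def by (auto simp: line_bundle_def)
  define f where "f g = det (\<phi> g)" for g
  define f' where "f' g = det (\<psi> g)" for g
  have f: "regular_on n (GL n) f" "regular_on n (GL n) f'"
    unfolding f_def f'_def by (rule regular_on_det[OF reg(1)], rule regular_on_det[OF reg(2)])
  have c: "\<phi> g \<in> carrier_mat 1 1" "\<psi> g \<in> carrier_mat 1 1" if "g \<in> GL n" for g
    using reg that unfolding regular_mat_on_def by auto
  have ff: "f g * f' g = 1" if "g \<in> GL n" for g
    unfolding f_def f'_def using det_mult[OF c[OF that]] 1(3)[OF that] by simp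
  have eq: "inverse (det (block_sub k p)) powi b * f (g * p)
      = f g * inverse (det (block_sub k p)) powi a"
    if g: "g \<in> GL n" and p: "p \<in> parabolic k n" for g p
  proof -
    have gp: "g * p \<in> GL n" using GL_mult g parabolic_GL p by blast
    have "bundle_rep (line_bundle k n b) p * \<phi> (g * p) = \<phi> g * bundle_rep (line_bundle k n a) p"
      using 1(1) g p unfolding bundle_hom_def by blast
    moreover have lc: "bundle_rep (line_bundle k n m) p \<in> carrier_mat 1 1" for m
      using line_bundle_rep[OF p] kn by simp
    ultimately have "det (bundle_rep (line_bundle k n b) p) * f (g * p)
        = f g * det (bundle_rep (line_bundle k n a) p)"
      unfolding f_def using det_mult[OF lc c(1)[OF gp]] det_mult[OF c(1)[OF g] lc] by metis
    then show ?thesis using line_bundle_rep[OF p] kn by (simp add: det_single)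
  qed
  define U where "U z = embed2 l m (mat2 1 0 z 1)" for z
  define V where "V z = embed2 l m (mat2 z (-1) 1 0)" for z
  define P where "P z = embed2 l m (mat2 z 1 0 (inverse z))" for z
  have poly: "\<exists>q. \<forall>z::complex. mat2 (poly q1 z) (poly q2 z) (poly q3 z) (poly q4 z) $$ (i, j) = poly q z"
    if "i < 2" "j < 2" for q1 q2 q3 q4 i j
    using that by (auto simp: mat2_def)
  have "\<exists>u. \<forall>z. f (U z) = u"
  proof (rule unit_along_polynomial_path[OF f ff])
    show "\<exists>q. \<forall>z. U z $$ (i, j) = poly q z" if "i < n" "j < n" for i j
      unfolding U_def using poly[where ?q1.0 = 1 and ?q2.0 = 0 and ?q3.0 = "[:0,1:]" and ?q4.0 = 1] that
      by (intro embed2_polynomial) (auto simp: lm)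
    show "U z \<in> GL n" for z
      unfolding U_def lm by (rule embed2_GL[of _ "mat2 1 0 (-z) 1"]) (auto simp: mat2_mult mat2_one)
    show "det (U z) = 1" for z
      by (simp add: U_def det_embed2 det_mat2_triangular)
  qed
  then obtain u where u: "\<And>z. f (U z) = u" by blast
  have "\<exists>v. \<forall>z. f (V z) = v"
  proof (rule unit_along_polynomial_path[OF f ff])
    show "\<exists>q. \<forall>z. V z $$ (i, j) = poly q z" if "i < n" "j < n" for i j
      unfolding V_def using poly[where ?q1.0 = "[:0,1:]" and ?q2.0 = "-1" and ?q3.0 = 1 and ?q4.0 = 0] that
      by (intro embed2_polynomial) (auto simp: lm)
    show "V z \<in> GL n" for z
      unfolding V_def lm by (rule embed2_GL[of _ "mat2 0 1 (-1) z"]) (auto simp: mat2_mult mat2_one)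
    have "det (V z) = det (mat2 1 z 0 1 * mat2 0 (-1) 1 0)" for z
      by (simp add: V_def det_embed2 mat2_mult)
    then show "det (V z) = det (mat2 0 (-1) 1 0)" for z
      using det_mult[OF mat2_carrier mat2_carrier, of 1 z 0 1 0 "-1" 1 0]
      by (simp add: det_mat2_triangular)
  qed
  then obtain v where v: "\<And>z. f (V z) = v" by blast
  have VG: "V z \<in> GL n" for z
    unfolding V_def lm by (rule embed2_GL[of _ "mat2 0 1 (-1) z"]) (auto simp: mat2_mult mat2_one)
  have main: "inverse z powi b * u = v * inverse z powi a" if z: "z \<noteq> 0" for z
  proof -
    have "P z \<in> GL n"
      unfolding P_def lm using z
      by (intro embed2_GL[of _ "mat2 (inverse z) (-1) 0 z"]) (auto simp: mat2_mult mat2_one)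
    then have p: "P z \<in> parabolic k n"
      unfolding parabolic_def by (auto simp: P_def lm embed2_index mat2_def)
    have "block_sub k (P z) = multrow_mat k l z"
      by (intro eq_matI) (auto simp: block_sub_def P_def lm embed2_index mat2_def multrow_mat_def)
    then have d: "det (block_sub k (P z)) = z" using det_multrow_mat[of l k z] lm by simp
    have "V (inverse z) * P z = U z"
      unfolding V_def P_def U_def using z by (simp add: embed2_mult mat2_mult)
    then show ?thesis using eq[OF VG p, of "inverse z"] d u v by simp
  qed
  have "u \<noteq> 0" using u[of 0] ff[of "U 0"] embed2_one[of l m] one_in_GL[of n]
    by (auto simp: U_def mat2_one lm)
  moreover have "u = v" using main[of 1] by simp
  \<comment> \<open>Any \<open>z\<close> whose modulus is not 1 separates the exponents.\<close>
  ultimately have "(2::complex) powi b = 2 powi a"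
    using main[of "inverse 2"] by simp
  then have "norm ((2::complex) powi b) = norm ((2::complex) powi a)" by simp
  then have "(2::real) powi b = 2 powi a" by (simp add: norm_power_int)
  then show ?thesis
    using power_int_strict_increasing[of a b "2::real"] power_int_strict_increasing[of b a "2::real"]
    by (cases a b rule: linorder_cases) auto
qed


section \<open>Determinants of direct sums and first Chern classes\<close>

text \<open>The determinant is multiplicative on block triangular matrices; this is the additivity of \<open>c\<^sub>1\<close>.\<close>

lemma det_diag_block_mat:
  assumes "\<And>A. A \<in> set As \<Longrightarrow> square_mat A"
  shows "det (diag_block_mat As) = prod_list (map det As :: complex list)"
  using assms
proof (induction As)
  case (Cons A As)
  define B where "B = diag_block_mat As"
  have "square_mat B" unfolding B_def by (rule diag_block_mat_square) (use Cons.prems in simp)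
  then obtain s where B: "B \<in> carrier_mat s s" by (metis carrier_mat_triv square_mat.elims(2))
  obtain r where A: "A \<in> carrier_mat r r"
    using Cons.prems[of A] by (metis carrier_mat_triv list.set_intros(1) square_mat.elims(2))
  have "det B = prod_list (map det As)" unfolding B_def by (rule Cons.IH) (use Cons.prems in simp)
  moreover have "diag_block_mat (A # As) = four_block_mat A (0\<^sub>m r s) (0\<^sub>m s r) B"
    using A B by (simp add: B_def[symmetric] Let_def)
  ultimately show ?case
    using det_four_block_mat_lower_left_zero[OF A _ refl B, of "0\<^sub>m r s"] by simp
qed simp

lemma square_rep_direct_sum:
  assumes "\<And>E. E \<in> set Es \<Longrightarrow> square_rep k n E"
  shows "square_rep k n (direct_sum Es)"
  unfolding square_rep_def
proof
  fix p assume p: "p \<in> parabolic k n"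
  have "map dim_row (map (\<lambda>E. bundle_rep E p) Es) = map bundle_rank Es"
    "map dim_col (map (\<lambda>E. bundle_rep E p) Es) = map bundle_rank Es"
    using assms p unfolding square_rep_def by auto
  then show "bundle_rep (direct_sum Es) p
      \<in> carrier_mat (bundle_rank (direct_sum Es)) (bundle_rank (direct_sum Es))"
    by (intro carrier_matI) (simp_all only: direct_sum_def dim_diag_block_mat hbundle.sel)
qed

lemma det_direct_sum:
  assumes "\<And>E. E \<in> set Es \<Longrightarrow> square_rep k n E" "p \<in> parabolic k n"
  shows "det (bundle_rep (direct_sum Es) p) = prod_list (map (\<lambda>E. det (bundle_rep E p)) Es)"
proof -
  have "square_mat (bundle_rep E p)" if "E \<in> set Es" for E
    using assms(1)[OF that] assms(2) unfolding square_rep_def by auto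
  then show ?thesis
    using det_diag_block_mat[of "map (\<lambda>E. bundle_rep E p) Es"] by (auto simp: direct_sum_def o_def)
qed

text \<open>The determinant of \<open>Q\<close> is \<open>det p\<close> times a cocycle of \<open>\<O>(1)\<close>. The factor \<open>det p ^ e\<close> does not change the isomorphism
class, because \<open>det\<close> is a nowhere vanishing regular function on the whole of \<open>GL n\<close>.\<close>

lemma c1_eqI:
  assumes kn: "0 < k" "k < n" and sq: "square_rep k n F" "square_rep k n E"
    and iso: "bundle_iso k n F E"
    and det: "\<And>p. p \<in> parabolic k n \<Longrightarrow>
      det (bundle_rep E p) = inverse (det (block_sub k p)) powi M * det p ^ e"
  shows "c1 k n F = M"
proof -
  have sqdet: "square_rep k n (det_bundle F)" for F by (simp add: square_rep_def det_bundle_def)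
  have sqline: "square_rep k n (line_bundle k n m)" for m by (simp add: square_rep_def line_bundle_def)
  have "bundle_iso k n (det_bundle E) (line_bundle k n M)"
  proof (rule bundle_iso_1x1)
    obtain h where h: "regular n h" "\<forall>g\<in>GL n. det g = h g"
      using regular_det unfolding regular_on_def by blast
    show "regular_on n (GL n) (\<lambda>g. det g ^ e)"
      by (rule regular_onI[OF regular_power[OF h(1)]]) (use h in auto)
    show "regular_on n (GL n) (\<lambda>g. inverse (det g) ^ e)"
      by (rule regular_onI[OF regular_power[OF regular_inverse_det]]) auto
    show "det g ^ e * inverse (det g) ^ e = 1" if "g \<in> GL n" for g
      using that by (auto simp: GL_iff simp flip: power_mult_distrib)
    show "bundle_rep (line_bundle k n M) p = mat 1 1 (\<lambda>_. inverse (det (block_sub k p)) powi M)"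
      if "p \<in> parabolic k n" for p using line_bundle_rep[OF that] kn by simp
    show "inverse (det (block_sub k p)) powi M * det (g * p) ^ e = det g ^ e * det (bundle_rep E p)"
      if "g \<in> GL n" "p \<in> parabolic k n" for g p
      using that parabolic_GL[OF that(2)] det[OF that(2)] det_mult[of g n p]
      by (simp add: GL_iff power_mult_distrib)
  qed (auto simp: det_bundle_def line_bundle_def)
  then have iso': "bundle_iso k n (det_bundle F) (line_bundle k n M)"
    by (rule bundle_iso_trans[OF bundle_iso_det_bundle[OF iso sq] _ sqdet sqdet sqline])
  have "m = M" if "bundle_iso k n (det_bundle F) (line_bundle k n m)" for m
    by (rule line_bundle_iso_imp_eq[OF kn
          bundle_iso_trans[OF bundle_iso_sym[OF that] iso' sqline sqdet sqline]])
  with iso' show ?thesis unfolding c1_def by (rule the_equality)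
qed


section \<open>Characters of the general linear group\<close>

lemma character_one:
  fixes f :: "complex mat \<Rightarrow> complex"
  assumes "\<And>A B. A \<in> GL m \<Longrightarrow> B \<in> GL m \<Longrightarrow> f (A * B) = f A * f B"
    and "\<And>A. A \<in> GL m \<Longrightarrow> f A \<noteq> 0"
  shows "f (1\<^sub>m m) = 1"
  using assms(1)[OF one_in_GL one_in_GL] assms(2)[OF one_in_GL[of m]] by simp

lemma block_diag_GL:
  assumes "A \<in> GL r" "B \<in> GL s"
  shows "four_block_mat A (0\<^sub>m r s) (0\<^sub>m s r) B \<in> GL (r + s)"
  using assms det_four_block_mat_lower_left_zero[of A r "0\<^sub>m r s" s "0\<^sub>m s r" B]
  by (auto simp: GL_iff)

definition scalar1 :: "complex \<Rightarrow> complex mat" where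
  "scalar1 u = mat 1 1 (\<lambda>_. u)"

lemma scalar1_carrier: "scalar1 u \<in> carrier_mat 1 1"
  by (simp add: scalar1_def)

lemma scalar1_carrier_Suc [simp]: "scalar1 u \<in> carrier_mat (Suc 0) (Suc 0)"
  by (simp add: scalar1_def)

lemma scalar1_neutral [simp]:
  "scalar1 u * 1\<^sub>m (Suc 0) = scalar1 u" "1\<^sub>m (Suc 0) * scalar1 u = scalar1 u"
  "scalar1 u + 0\<^sub>m (Suc 0) (Suc 0) = scalar1 u"
  using right_mult_one_mat[OF scalar1_carrier[of u]] left_mult_one_mat[OF scalar1_carrier[of u]]
    right_add_zero_mat[OF scalar1_carrier[of u]] by simp_all

lemma zero_mult_scalar1 [simp]: "0\<^sub>m m (Suc 0) * scalar1 u = 0\<^sub>m m (Suc 0)"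
  by (rule left_mult_zero_mat) simp

lemma det_scalar1 [simp]: "det (scalar1 u) = u"
  by (simp add: scalar1_def det_single)

lemma scalar1_GL: "u \<noteq> 0 \<Longrightarrow> scalar1 u \<in> GL 1"
  by (simp add: GL_iff)

lemma scalar1_mult: "scalar1 a * scalar1 b = scalar1 (a * b)"
  by (simp add: scalar1_def)

text \<open>Conjugation by \<open>diag (2, 1, \<dots>, 1)\<close> replaces \<open>v\<close> by \<open>2 v\<close>, and so does squaring the matrix. The value of
a character is therefore equal to its own square.\<close>

lemma character_transvection:
  fixes f :: "complex mat \<Rightarrow> complex"
  assumes mult: "\<And>A B. A \<in> GL (Suc m) \<Longrightarrow> B \<in> GL (Suc m) \<Longrightarrow> f (A * B) = f A * f B"
    and nz: "\<And>A. A \<in> GL (Suc m) \<Longrightarrow> f A \<noteq> 0"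
    and v: "v \<in> carrier_mat 1 m"
  shows "f (four_block_mat (1\<^sub>m 1) v (0\<^sub>m m 1) (1\<^sub>m m)) = 1"
proof -
  define V where "V w = four_block_mat (1\<^sub>m 1) w (0\<^sub>m m 1) (1\<^sub>m m)" for w :: "complex mat"
  define D where "D = four_block_mat (scalar1 2) (0\<^sub>m 1 m) (0\<^sub>m m 1) (1\<^sub>m m)"
  have V: "V w \<in> GL (Suc m)" if "w \<in> carrier_mat 1 m" for w
    using that det_four_block_mat_lower_left_zero[of "1\<^sub>m 1" 1 w m "0\<^sub>m m 1" "1\<^sub>m m"]
      four_block_carrier_mat[of "1\<^sub>m 1" 1 1 "1\<^sub>m m" m m w "0\<^sub>m m 1"]
    by (simp add: V_def GL_iff)
  have D: "D \<in> GL (Suc m)"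
    using block_diag_GL[OF scalar1_GL one_in_GL, of 2 m] by (simp add: D_def)
  have "D * V v = four_block_mat (scalar1 2) (2 \<cdot>\<^sub>m v) (0\<^sub>m m 1) (1\<^sub>m m)"
  proof -
    have "scalar1 2 * v = 2 \<cdot>\<^sub>m v" using v by (intro eq_matI) (auto simp: scalar1_def scalar_prod_def)
    then show ?thesis
      unfolding D_def V_def using v
      by (subst mult_four_block_mat[of _ 1 1 _ m _ m _ _ 1 _ m]) auto
  qed
  moreover have "V v * V v * D = four_block_mat (scalar1 2) (2 \<cdot>\<^sub>m v) (0\<^sub>m m 1) (1\<^sub>m m)"
  proof -
    have "v + v = 2 \<cdot>\<^sub>m v" using v by (intro eq_matI) auto
    then have "V v * V v = V (2 \<cdot>\<^sub>m v)"
      unfolding V_def using v by (subst mult_four_block_mat[of _ 1 1 _ m _ m _ _ 1 _ m]) auto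
    then show ?thesis
      unfolding D_def V_def using v by (simp add: mult_four_block_mat[of _ 1 1 _ m _ m _ _ 1 _ m])
  qed
  ultimately have "f D * f (V v) = f (V v) * f (V v) * f D"
    using mult[OF D V[OF v]] mult[OF V[OF v] V[OF v]] mult[OF GL_mult[OF V[OF v] V[OF v]] D] by metis
  then show ?thesis using nz[OF D] nz[OF V[OF v]] by (simp add: V_def)
qed

text \<open>The two diagonal matrices are conjugate by a cyclic permutation matrix.\<close>

lemma character_swap:
  fixes f :: "complex mat \<Rightarrow> complex"
  assumes mult: "\<And>A B. A \<in> GL (Suc m) \<Longrightarrow> B \<in> GL (Suc m) \<Longrightarrow> f (A * B) = f A * f B"
    and nz: "\<And>A. A \<in> GL (Suc m) \<Longrightarrow> f A \<noteq> 0" and u: "u \<noteq> 0"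
  shows "f (four_block_mat (scalar1 u) (0\<^sub>m 1 m) (0\<^sub>m m 1) (1\<^sub>m m))
    = f (four_block_mat (1\<^sub>m m) (0\<^sub>m m 1) (0\<^sub>m 1 m) (scalar1 u))"
proof -
  define X where "X = four_block_mat (scalar1 u) (0\<^sub>m 1 m) (0\<^sub>m m 1) (1\<^sub>m m)"
  define Y where "Y = four_block_mat (1\<^sub>m m) (0\<^sub>m m 1) (0\<^sub>m 1 m) (scalar1 u)"
  define P :: "complex mat" where "P = mat (Suc m) (Suc m) (\<lambda>(i, j). if j = (if i < m then Suc i else 0) then 1 else 0)"
  define Q :: "complex mat" where "Q = mat (Suc m) (Suc m) (\<lambda>(i, j). if i = (if j < m then Suc j else 0) then 1 else 0)"
  have PA: "(P * A) $$ (i, j) = A $$ (if i < m then Suc i else 0, j)"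
    if "A \<in> carrier_mat (Suc m) (Suc m)" "i < Suc m" "j < Suc m" for A i j
    using that by (auto simp: P_def scalar_prod_def if_distrib[of "\<lambda>x. x * _"] sum.delta cong: if_cong)
  have AP: "(A * P) $$ (i, j) = A $$ (i, if j = 0 then m else j - 1)"
    if "A \<in> carrier_mat (Suc m) (Suc m)" "i < Suc m" "j < Suc m" for A i j
  proof -
    have "(A * P) $$ (i, j) = (\<Sum>l\<in>{0..<Suc m}. A $$ (i, l) * (if j = (if l < m then Suc l else 0) then 1 else 0))"
      using that by (simp add: P_def scalar_prod_def)
    also have "\<dots> = (\<Sum>l\<in>{0..<Suc m}. if l = (if j = 0 then m else j - 1) then A $$ (i, l) else 0)"
      using that by (intro sum.cong) auto
    finally show ?thesis using that by (cases j) (auto simp: sum.delta)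
  qed
  have X: "X \<in> GL (Suc m)" using block_diag_GL[OF scalar1_GL[OF u] one_in_GL, of m] by (simp add: X_def)
  have Y: "Y \<in> GL (Suc m)" using block_diag_GL[OF one_in_GL scalar1_GL[OF u], of m] by (simp add: Y_def)
  have Pc: "P \<in> carrier_mat (Suc m) (Suc m)" "Q \<in> carrier_mat (Suc m) (Suc m)" by (auto simp: P_def Q_def)
  have "P * Q = 1\<^sub>m (Suc m)"
    using Pc by (intro eq_matI) (auto simp: PA Q_def simp del: index_mult_mat(1))
  then have P: "P \<in> GL (Suc m)" using Pc det_mult[OF Pc] by (auto simp: GL_iff)
  have "P * X = Y * P"
    using Pc X Y
    by (intro eq_matI) (auto simp: PA AP GL_iff X_def Y_def scalar1_def simp del: index_mult_mat(1))
  then have "f P * f X = f Y * f P" using mult[OF P X] mult[OF Y P] by metis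
  then show ?thesis using nz[OF P] by (simp add: X_def Y_def)
qed

text \<open>Induction on the size, along \<open>(u, v; 0, U') = (1, 0; 0, U') (u, 0; 0, 1) (1, v / u; 0, 1)\<close>. The last factor is
killed by every character; the induction hypothesis, applied to the restriction of \<open>f\<close> to the lower
right block, and \<open>character_swap\<close> move both determinants to the last diagonal position.\<close>

lemma character_triangular:
  fixes f :: "complex mat \<Rightarrow> complex"
  assumes "\<And>A B. A \<in> GL m \<Longrightarrow> B \<in> GL m \<Longrightarrow> f (A * B) = f A * f B"
    and "\<And>A. A \<in> GL m \<Longrightarrow> f A \<noteq> 0"
    and "U \<in> GL m" "upper_triangular U" "0 < m"
  shows "f U = f (four_block_mat (1\<^sub>m (m - 1)) (0\<^sub>m (m - 1) 1) (0\<^sub>m 1 (m - 1)) (scalar1 (det U)))"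
  using assms
proof (induction m arbitrary: f U)
  case (Suc m)
  note mult = Suc.prems(1) and nz = Suc.prems(2)
  define E where "E A = four_block_mat (1\<^sub>m 1) (0\<^sub>m 1 m) (0\<^sub>m m 1) A" for A :: "complex mat"
  define L where "L u = four_block_mat (scalar1 u) (0\<^sub>m 1 m) (0\<^sub>m m 1) (1\<^sub>m m)" for u
  define R where "R m u = four_block_mat (1\<^sub>m m) (0\<^sub>m m 1) (0\<^sub>m 1 m) (scalar1 u)" for m u
  define u where "u = U $$ (0, 0)"
  define v where "v = mat 1 m (\<lambda>(i, j). U $$ (0, Suc j))"
  define U' where "U' = mat m m (\<lambda>(i, j). U $$ (Suc i, Suc j))"
  have U: "U \<in> carrier_mat (Suc m) (Suc m)" "det U \<noteq> 0" using Suc.prems(3) by (auto simp: GL_iff)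
  have block: "U = four_block_mat (scalar1 u) v (0\<^sub>m m 1) U'"
  proof (rule eq_matI)
    fix i j assume "i < dim_row (four_block_mat (scalar1 u) v (0\<^sub>m m 1) U')"
      "j < dim_col (four_block_mat (scalar1 u) v (0\<^sub>m m 1) U')"
    then have "i < Suc m" "j < Suc m" by (auto simp: scalar1_def U'_def)
    then show "U $$ (i, j) = four_block_mat (scalar1 u) v (0\<^sub>m m 1) U' $$ (i, j)"
      using U Suc.prems(4) unfolding upper_triangular_def
      by (cases i; cases j) (auto simp: u_def v_def U'_def scalar1_def)
  qed (use U in \<open>auto simp: scalar1_def U'_def\<close>)
  have U': "U' \<in> carrier_mat m m" and v: "v \<in> carrier_mat 1 m" by (auto simp: U'_def v_def)
  have det: "det U = u * det U'"
    unfolding block using det_four_block_mat_lower_left_zero[OF _ v refl U', of "scalar1 u"] by simp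
  then have u: "u \<noteq> 0" and U'G: "U' \<in> GL m" using U U' by (auto simp: GL_iff)
  define w where "w = inverse u \<cdot>\<^sub>m v"
  have w: "w \<in> carrier_mat 1 m" using v by (simp add: w_def)
  have sw: "scalar1 u * w = v"
    using v u by (intro eq_matI) (auto simp: scalar1_def w_def scalar_prod_def)
  define V where "V = four_block_mat (1\<^sub>m 1) w (0\<^sub>m m 1) (1\<^sub>m m)"
  have "U = E U' * (L u * V)"
  proof -
    have "L u * V = four_block_mat (scalar1 u) v (0\<^sub>m m 1) (1\<^sub>m m)"
      unfolding L_def V_def sw[symmetric] using w
      by (subst mult_four_block_mat[of _ 1 1 _ m _ m _ _ 1 _ m]) (use v sw in auto)
    then show ?thesis
      unfolding E_def block using v U'
      by (simp add: mult_four_block_mat[of _ 1 1 _ m _ m _ _ 1 _ m])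
  qed
  moreover have EG: "E A \<in> GL (Suc m)" if "A \<in> GL m" for A
    using block_diag_GL[OF one_in_GL[of 1] that] by (simp add: E_def)
  moreover have LG: "L u \<in> GL (Suc m)"
    using block_diag_GL[OF scalar1_GL[OF u] one_in_GL, of m] by (simp add: L_def)
  moreover have VG: "V \<in> GL (Suc m)"
    using w det_four_block_mat_lower_left_zero[of "1\<^sub>m 1" 1 w m "0\<^sub>m m 1" "1\<^sub>m m"]
      four_block_carrier_mat[of "1\<^sub>m 1" 1 1 "1\<^sub>m m" m m w "0\<^sub>m m 1"]
    by (simp add: V_def GL_iff)
  moreover have "f V = 1" unfolding V_def by (rule character_transvection[OF mult nz w])
  ultimately have fU: "f U = f (E U') * f (L u)"
    using mult[OF EG[OF U'G] GL_mult[OF LG VG]] mult[OF LG VG] by simp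
  have swap: "f (L u) = f (R m u)"
    unfolding L_def R_def by (rule character_swap[OF mult nz u])
  show ?case
  proof (cases m)
    case 0
    then have "U' = 1\<^sub>m 0" "E U' = 1\<^sub>m 1" by (auto simp: U'_def E_def intro!: eq_matI)
    then have "f (E U') = 1" "det U = u" using character_one[OF mult nz] det 0 by auto
    then show ?thesis using fU swap 0 by (simp add: R_def)
  next
    case (Suc m')
    have Em: "E A * E B = E (A * B)" if "A \<in> GL m" "B \<in> GL m" for A B
      unfolding E_def using that by (subst block_diag_mult) (auto simp: GL_iff)
    have "upper_triangular U'"
      using Suc.prems(4) U unfolding upper_triangular_def by (auto simp: U'_def)
    have fE: "f (E (A * B)) = f (E A) * f (E B)" if "A \<in> GL m" "B \<in> GL m" for A B
      using mult[OF EG EG] Em that by simp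
    have "f (E U') = f (E (R m' (det U')))"
      using Suc.IH[of "\<lambda>A. f (E A)" U', OF fE nz[OF EG] U'G \<open>upper_triangular U'\<close>] Suc
      by (simp add: R_def)
    moreover have ER: "E (R m' t) = R m t" for t
      unfolding E_def R_def Suc by (intro eq_matI) (auto simp: scalar1_def)
    moreover have "R m (det U') \<in> GL (Suc m)" "R m u \<in> GL (Suc m)"
      using block_diag_GL[OF one_in_GL scalar1_GL[OF u], of m]
        block_diag_GL[OF one_in_GL scalar1_GL, of "det U'" m] U'G by (auto simp: R_def GL_iff)
    moreover have "R m (det U') * R m u = R m (det U)"
      unfolding R_def by (simp add: block_diag_mult[of _ m] scalar1_mult det mult.commute)
    ultimately show ?thesis using fU swap mult[of "R m (det U')" "R m u"] Suc by (simp add: R_def)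
  qed
qed simp

text \<open>Over the complex numbers every matrix is conjugate to an upper triangular one.\<close>

lemma character_depends_on_det:
  fixes f :: "complex mat \<Rightarrow> complex"
  assumes mult: "\<And>A B. A \<in> GL m \<Longrightarrow> B \<in> GL m \<Longrightarrow> f (A * B) = f A * f B"
    and nz: "\<And>A. A \<in> GL m \<Longrightarrow> f A \<noteq> 0"
    and A: "A \<in> GL m" "0 < m"
  shows "f A = f (four_block_mat (1\<^sub>m (m - 1)) (0\<^sub>m (m - 1) 1) (0\<^sub>m 1 (m - 1)) (scalar1 (det A)))"
proof -
  have Ac: "A \<in> carrier_mat m m" using A GL_iff by auto
  obtain as where as: "char_poly A = (\<Prod>a\<leftarrow>as. [:- a, 1:])"
    using char_poly_factorized[OF Ac] by auto
  obtain U P Q where s: "schur_decomposition A as = (U, P, Q)" by (cases "schur_decomposition A as")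
  from schur_decomposition[OF Ac as s]
  have w: "similar_mat_wit A U P Q" and tri: "upper_triangular U" by auto
  note D = similar_mat_witD2[OF Ac w]
  have "det P * det Q = 1" using det_mult[of P m Q] D by simp
  moreover have "det A = det U"
    by (rule det_similar) (use w in \<open>auto simp: similar_mat_def\<close>)
  ultimately have G: "P \<in> GL m" "Q \<in> GL m" "U \<in> GL m" using D A by (auto simp: GL_iff)
  have "f P * f Q = 1" using mult[OF G(1,2)] D character_one[OF mult nz] by simp
  moreover have "f A = f P * f U * f Q"
    using D mult[OF GL_mult[OF G(1,3)] G(2)] mult[OF G(1,3)] by simp
  ultimately have "f A = f U" by (simp add: mult.commute mult.left_commute)
  then show ?thesis using character_triangular[OF mult nz G(3) tri A(2)] \<open>det A = det U\<close> by simp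
qed

lemma complex_root_exists: "0 < m \<Longrightarrow> \<exists>s::complex. s ^ m = t"
  by (intro exI[of _ "rcis (root m (cmod t)) (Arg t / m)"]) (simp add: DeMoivre2 rcis_cmod_Arg)

text \<open>A matrix of determinant \<open>s ^ m\<close> has the same character value as the scalar matrix \<open>s\<close>, namely \<open>s ^ N\<close>. The
choice of \<open>s\<close> is free up to an \<open>m\<close>-th root of unity, so \<open>\<omega> ^ N = 1\<close> for a primitive one, \<open>m\<close> divides \<open>N\<close>, and
\<open>s ^ N\<close> is a power of the determinant.\<close>

lemma character_eq_det_power:
  fixes f :: "complex mat \<Rightarrow> complex"
  assumes mult: "\<And>A B. A \<in> GL m \<Longrightarrow> B \<in> GL m \<Longrightarrow> f (A * B) = f A * f B"
    and nz: "\<And>A. A \<in> GL m \<Longrightarrow> f A \<noteq> 0" and m: "0 < m"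
    and scalar: "\<And>s. s \<noteq> 0 \<Longrightarrow> f (s \<cdot>\<^sub>m 1\<^sub>m m) = s ^ N"
  obtains e where "m * e = N" "\<And>A. A \<in> GL m \<Longrightarrow> f A = det A ^ e"
proof -
  have scalarG: "s \<cdot>\<^sub>m 1\<^sub>m m \<in> GL m" if "s \<noteq> 0" for s :: complex
    using that by (simp add: GL_iff det_smult)
  have root: "f A = s ^ N" if A: "A \<in> GL m" and s: "s ^ m = det A" for A s
  proof -
    have "s \<noteq> 0" using s A m by (auto simp: GL_iff zero_power)
    have "det (s \<cdot>\<^sub>m 1\<^sub>m m) = det A" using s by (simp add: det_smult)
    then have "f A = f (s \<cdot>\<^sub>m 1\<^sub>m m)"
      using character_depends_on_det[OF mult nz A m]
        character_depends_on_det[OF mult nz scalarG[OF \<open>s \<noteq> 0\<close>] m] by simp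
    then show ?thesis using scalar[OF \<open>s \<noteq> 0\<close>] by simp
  qed
  \<comment> \<open>A primitive \<open>m\<close>-th root of unity, an \<open>m\<close>-th root of the determinant of the identity.\<close>
  define \<omega> where "\<omega> = cis (2 * pi / real m)"
  have "\<omega> ^ m = 1" using m by (simp add: \<omega>_def DeMoivre)
  then have "\<omega> ^ N = 1" using root[OF one_in_GL, of \<omega>] character_one[OF mult nz] by simp
  then have "cis (2 * pi * real N / real m) = 1"
    by (simp add: \<omega>_def DeMoivre mult.commute)
  then obtain j :: int where "2 * pi * real N / real m = of_int j * (2 * pi)"
    unfolding complex_eq_iff by (auto simp: cos_one_2pi_int)
  then have "real N = real_of_int j * real m" using m by (simp add: field_simps)
  then have "int N = j * int m" by (metis of_int_eq_iff of_int_mult of_int_of_nat_eq)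
  then have "int m dvd int N" by simp
  then obtain e where e: "N = m * e" by (metis dvdE int_dvd_int_iff)
  show thesis
  proof
    show "m * e = N" using e by simp
    fix A assume A: "A \<in> GL m"
    obtain s where s: "s ^ m = det A" using complex_root_exists[OF m] by blast
    show "f A = det A ^ e" using root[OF A s] e s by (metis power_mult)
  qed
qed


section \<open>Bases of finite-dimensional spaces of tensors\<close>

text \<open>Together with pointwise addition this makes tensors a vector space, so that bases in the sense of
\<open>is_basis\<close> can be compared with independent spanning sets.\<close>

definition scale_tensor :: "complex \<Rightarrow> (nat list \<Rightarrow> complex) \<Rightarrow> nat list \<Rightarrow> complex" where
  "scale_tensor c t = (\<lambda>xs. c * t xs)"

interpretation fun_space: vector_space scale_tensor
  by unfold_locales (auto simp: scale_tensor_def fun_eq_iff algebra_simps)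

lemma sum_fun_apply: "(\<Sum>i\<in>I. f i) x = (\<Sum>i\<in>I. f i x :: complex)"
  by (induction I rule: infinite_finite_induct) auto

lemma lin_comb_eq_sum: "lin_comb bs c = (\<Sum>j<length bs. scale_tensor (c $ j) (bs ! j))"
  by (simp add: fun_eq_iff lin_comb_def sum_fun_apply scale_tensor_def)

lemma is_basisI:
  assumes d: "distinct bs" and ind: "fun_space.independent (set bs)" and sp: "fun_space.span (set bs) = W"
  shows "is_basis bs W"
proof -
  \<comment> \<open>The position of a vector in the list turns coordinates into coefficients indexed by vectors.\<close>
  define idx where "idx v = (THE j. j < length bs \<and> bs ! j = v)" for v
  have idx: "idx (bs ! j) = j" if "j < length bs" for j
    unfolding idx_def using that d by (auto simp: nth_eq_iff_index_eq)
  have reindex: "(\<Sum>v\<in>set bs. scale_tensor (g v) v) = (\<Sum>j<length bs. scale_tensor (g (bs ! j)) (bs ! j))" for g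
    by (rule sum.reindex_bij_betw[OF bij_betw_nth[OF d refl refl], symmetric, of "\<lambda>v. scale_tensor (g v) v"])
  have lc: "lin_comb bs c = (\<Sum>v\<in>set bs. scale_tensor (c $ idx v) v)" for c
    unfolding reindex lin_comb_eq_sum by (intro sum.cong) (auto simp: idx)
  show ?thesis unfolding is_basis_def bij_betw_def
  proof
    show "inj_on (lin_comb bs) (carrier_vec (length bs))"
    proof (rule inj_onI)
      fix c c' assume c: "c \<in> carrier_vec (length bs)" "c' \<in> carrier_vec (length bs)"
        and eq: "lin_comb bs c = lin_comb bs c'"
      have "(\<Sum>v\<in>set bs. scale_tensor (c $ idx v - c' $ idx v) v) = 0"
        using eq unfolding lc by (simp add: fun_space.scale_left_diff_distrib sum_subtractf)
      then have "c $ idx v - c' $ idx v = 0" if "v \<in> set bs" for v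
        using fun_space.independentD[OF ind finite_set subset_refl _ that, of "\<lambda>v. c $ idx v - c' $ idx v"]
        by simp
      then have "c $ j = c' $ j" if "j < length bs" for j
        using idx[OF that] that by (metis eq_iff_diff_eq_0 nth_mem)
      then show "c = c'" using c by (intro eq_vecI) auto
    qed
    show "lin_comb bs ` carrier_vec (length bs) = W"
    proof (intro equalityI subsetI)
      fix w assume "w \<in> lin_comb bs ` carrier_vec (length bs)"
      then show "w \<in> W" unfolding sp[symmetric] fun_space.span_finite[OF finite_set] lc by auto
    next
      fix w assume "w \<in> W"
      then obtain u where "w = (\<Sum>v\<in>set bs. scale_tensor (u v) v)"
        unfolding sp[symmetric] fun_space.span_finite[OF finite_set] by auto
      then have "w = lin_comb bs (vec (length bs) (\<lambda>j. u (bs ! j)))"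
        unfolding reindex lin_comb_eq_sum by (auto intro: sum.cong)
      then show "w \<in> lin_comb bs ` carrier_vec (length bs)" by auto
    qed
  qed
qed

lemma basis_exists_of_subspace:
  assumes "fun_space.subspace W" "finite T" "W \<subseteq> fun_space.span T"
  shows "\<exists>bs. is_basis bs W"
proof -
  obtain B where B: "B \<subseteq> W" "fun_space.independent B" "W \<subseteq> fun_space.span B"
    using fun_space.maximal_independent_subset by blast
  have "finite B" using fun_space.independent_span_bound[OF assms(2) B(2)] B assms by blast
  then obtain bs where "set bs = B" "distinct bs" using finite_distinct_list by blast
  moreover have "fun_space.span B = W" using B assms fun_space.span_minimal by blast
  ultimately show ?thesis using is_basisI B by blast
qed

lemma independent_card_le_basis:
  assumes "is_basis bs W" "S \<subseteq> W" "fun_space.independent S"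
  shows "card S \<le> length bs"
proof -
  have "w \<in> fun_space.span (set bs)" if "w \<in> W" for w
  proof -
    have "w \<in> lin_comb bs ` carrier_vec (length bs)"
      using that assms(1) unfolding is_basis_def bij_betw_def by simp
    then obtain c where "w = lin_comb bs c" by blast
    then show ?thesis unfolding lin_comb_eq_sum
      by (auto intro!: fun_space.span_sum intro: fun_space.span_scale[OF fun_space.span_base])
  qed
  then have "card S \<le> card (set bs)"
    using fun_space.independent_span_bound[OF finite_set assms(3)] assms(2) by blast
  then show ?thesis using card_length le_trans by blast
qed

text \<open>Evaluation at the points \<open>p j\<close> shows that the tensors \<open>v i\<close> are linearly independent.\<close>

lemma card_le_basis_of_test_points:
  assumes "is_basis bs W" "finite I" "\<And>i. i \<in> I \<Longrightarrow> v i \<in> W"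
    and "\<And>i. i \<in> I \<Longrightarrow> v i (p i) \<noteq> 0" "\<And>i j. i \<in> I \<Longrightarrow> j \<in> I \<Longrightarrow> i \<noteq> j \<Longrightarrow> v i (p j) = 0"
  shows "card I \<le> length bs"
proof -
  have inj: "inj_on v I" using assms(4,5) by (metis inj_onI)
  have "fun_space.independent (v ` I)"
    unfolding fun_space.independent_explicit_finite_subsets
  proof (intro allI impI ballI)
    fix S u x assume S: "S \<subseteq> v ` I" "finite S" "(\<Sum>w\<in>S. scale_tensor (u w) w) = 0" and x: "x \<in> S"
    obtain i where i: "i \<in> I" "x = v i" using S x by blast
    have "0 = (\<Sum>w\<in>S. u w * w (p i))"
      using arg_cong[OF S(3), of "\<lambda>t. t (p i)"] by (simp add: sum_fun_apply scale_tensor_def)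
    also have "\<dots> = (\<Sum>w\<in>{x}. u w * w (p i))"
      using S x i assms(5) by (intro sum.mono_neutral_right) auto
    finally show "u x = 0" using assms(4) i by simp
  qed
  then have "card (v ` I) \<le> length bs"
    using independent_card_le_basis[OF assms(1)] assms(3) by blast
  then show ?thesis using card_image[OF inj] by simp
qed


section \<open>Tensor powers\<close>

definition delta :: "nat list \<Rightarrow> nat list \<Rightarrow> complex" where
  "delta ys = (\<lambda>xs. if xs = ys then 1 else 0)"

lemma finite_multi_indices [simp]: "finite (multi_indices m r)"
  using finite_lists_length_eq[of "{..<m}" r] by (simp add: multi_indices_def conj_commute)

lemma delta_tensors: "ys \<in> multi_indices m r \<Longrightarrow> delta ys \<in> tensors m r"
  by (auto simp: tensors_def delta_def)

lemma tensors_span: "tensors m r \<subseteq> fun_space.span (delta ` multi_indices m r)"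
proof
  fix t assume t: "t \<in> tensors m r"
  have "t = (\<Sum>ys\<in>multi_indices m r. scale_tensor (t ys) (delta ys))"
  proof
    fix xs
    have "(\<Sum>ys\<in>multi_indices m r. scale_tensor (t ys) (delta ys) xs)
        = (\<Sum>ys\<in>multi_indices m r. if xs = ys then t ys else 0)"
      by (intro sum.cong) (auto simp: scale_tensor_def delta_def)
    then show "t xs = (\<Sum>ys\<in>multi_indices m r. scale_tensor (t ys) (delta ys)) xs"
      using t by (auto simp: sum_fun_apply tensors_def)
  qed
  also have "\<dots> \<in> fun_space.span (delta ` multi_indices m r)"
    by (intro fun_space.span_sum fun_space.span_scale fun_space.span_base) auto
  finally show "t \<in> fun_space.span (delta ` multi_indices m r)" .
qed

lemma multi_indices_nth: "xs \<in> multi_indices m r \<Longrightarrow> l < r \<Longrightarrow> xs ! l < m"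
  unfolding multi_indices_def by (auto dest!: nth_mem)

text \<open>Expanding a product of sums over words. This is what makes \<open>tensor_act\<close> multiplicative.\<close>

lemma prod_sum_multi_indices:
  "(\<Prod>l<r. \<Sum>j<m. F l j) = (\<Sum>zs\<in>multi_indices m r. \<Prod>l<r. F l (zs ! l) :: complex)"
proof (induction r arbitrary: F)
  case 0
  have "multi_indices m 0 = {[]}" by (auto simp: multi_indices_def)
  then show ?case by simp
next
  case (Suc r)
  have bij: "bij_betw (\<lambda>(j, zs). j # zs) ({..<m} \<times> multi_indices m r) (multi_indices m (Suc r))"
    by (rule bij_betw_byWitness[where f' = "\<lambda>zs. (hd zs, tl zs)"])
       (auto simp: multi_indices_def length_Suc_conv)
  have "(\<Prod>l<Suc r. \<Sum>j<m. F l j) = (\<Sum>j<m. F 0 j) * (\<Sum>zs\<in>multi_indices m r. \<Prod>l<r. F (Suc l) (zs ! l))"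
    unfolding prod.lessThan_Suc_shift Suc.IH ..
  also have "\<dots> = (\<Sum>(j, zs)\<in>{..<m} \<times> multi_indices m r. F 0 j * (\<Prod>l<r. F (Suc l) (zs ! l)))"
    by (simp add: sum_product sum.cartesian_product)
  also have "\<dots> = (\<Sum>(j, zs)\<in>{..<m} \<times> multi_indices m r. \<Prod>l<Suc r. F l ((j # zs) ! l))"
    by (intro sum.cong) (auto simp: prod.lessThan_Suc_shift simp del: prod.lessThan_Suc)
  also have "\<dots> = (\<Sum>zs\<in>multi_indices m (Suc r). \<Prod>l<Suc r. F l (zs ! l))"
    by (subst sum.reindex_bij_betw[OF bij, symmetric]) (simp add: case_prod_unfold)
  finally show ?case .
qed

lemma tensor_act_tensors: "tensor_act m r A t \<in> tensors m r"
  by (simp add: tensors_def tensor_act_def)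

lemma tensor_act_mult:
  assumes "A \<in> carrier_mat m m" "B \<in> carrier_mat m m"
  shows "tensor_act m r (A * B) t = tensor_act m r A (tensor_act m r B t)"
proof
  fix xs
  show "tensor_act m r (A * B) t xs = tensor_act m r A (tensor_act m r B t) xs"
  proof (cases "xs \<in> multi_indices m r")
    case True
    have p: "(\<Prod>l<r. (A * B) $$ (xs ! l, ys ! l)) =
        (\<Sum>zs\<in>multi_indices m r. (\<Prod>l<r. A $$ (xs ! l, zs ! l)) * (\<Prod>l<r. B $$ (zs ! l, ys ! l)))"
      if "ys \<in> multi_indices m r" for ys
    proof -
      have "(\<Prod>l<r. (A * B) $$ (xs ! l, ys ! l)) = (\<Prod>l<r. \<Sum>j<m. A $$ (xs ! l, j) * B $$ (j, ys ! l))"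
        using assms multi_indices_nth[OF True] multi_indices_nth[OF that]
        by (intro prod.cong) (auto simp: scalar_prod_def atLeast0LessThan)
      then show ?thesis by (simp add: prod_sum_multi_indices prod.distrib)
    qed
    have "tensor_act m r (A * B) t xs = (\<Sum>ys\<in>multi_indices m r. \<Sum>zs\<in>multi_indices m r.
        (\<Prod>l<r. A $$ (xs ! l, zs ! l)) * ((\<Prod>l<r. B $$ (zs ! l, ys ! l)) * t ys))"
      using True by (simp add: tensor_act_def p sum_distrib_right mult.assoc)
    also have "\<dots> = (\<Sum>zs\<in>multi_indices m r. (\<Prod>l<r. A $$ (xs ! l, zs ! l)) *
        (\<Sum>ys\<in>multi_indices m r. (\<Prod>l<r. B $$ (zs ! l, ys ! l)) * t ys))"
      by (subst sum.swap) (simp add: sum_distrib_left)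
    also have "\<dots> = tensor_act m r A (tensor_act m r B t) xs"
      using True by (simp add: tensor_act_def)
    finally show ?thesis .
  qed (simp add: tensor_act_def)
qed

lemma tensor_act_scalar:
  assumes "t \<in> tensors m r"
  shows "tensor_act m r (s \<cdot>\<^sub>m 1\<^sub>m m) t = scale_tensor (s ^ r) t"
proof
  fix xs
  show "tensor_act m r (s \<cdot>\<^sub>m 1\<^sub>m m) t xs = scale_tensor (s ^ r) t xs"
  proof (cases "xs \<in> multi_indices m r")
    case True
    have "(\<Prod>l<r. (s \<cdot>\<^sub>m 1\<^sub>m m) $$ (xs ! l, ys ! l)) = (if xs = ys then s ^ r else 0)"
      if ys: "ys \<in> multi_indices m r" for ys
    proof (cases "xs = ys")
      case False
      then obtain l where "l < r" "xs ! l \<noteq> ys ! l"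
        using True ys unfolding multi_indices_def by (auto simp: list_eq_iff_nth_eq)
      then have "\<exists>l\<in>{..<r}. (s \<cdot>\<^sub>m 1\<^sub>m m) $$ (xs ! l, ys ! l) = 0"
        using multi_indices_nth[OF True] multi_indices_nth[OF ys] by (intro bexI[of _ l]) auto
      then show ?thesis using False by (simp add: prod_zero_iff)
    next
      case eq: True
      have "(\<Prod>l<r. (s \<cdot>\<^sub>m 1\<^sub>m m) $$ (xs ! l, ys ! l)) = (\<Prod>l<r. s)"
        using multi_indices_nth[OF ys] eq by (intro prod.cong) auto
      then show ?thesis using eq by simp
    qed
    then have "(\<Sum>ys\<in>multi_indices m r. (\<Prod>l<r. (s \<cdot>\<^sub>m 1\<^sub>m m) $$ (xs ! l, ys ! l)) * t ys)
        = (\<Sum>ys\<in>multi_indices m r. if xs = ys then s ^ r * t ys else 0)"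
      by (intro sum.cong refl) simp
    then have "tensor_act m r (s \<cdot>\<^sub>m 1\<^sub>m m) t xs
        = (\<Sum>ys\<in>multi_indices m r. if xs = ys then s ^ r * t ys else 0)"
      using True by (simp add: tensor_act_def)
    then show ?thesis using True by (simp add: scale_tensor_def)
  qed (use assms in \<open>simp add: tensor_act_def tensors_def scale_tensor_def\<close>)
qed

lemma permute_multi_indices_iff:
  assumes "\<pi> permutes {..<r}"
  shows "permute_list \<pi> xs \<in> multi_indices m r \<longleftrightarrow> xs \<in> multi_indices m r"
  using assms by (auto simp: multi_indices_def)

lemma bij_permute_multi_indices:
  assumes "\<pi> permutes {..<r}"
  shows "bij_betw (permute_list \<pi>) (multi_indices m r) (multi_indices m r)"
proof (rule bij_betw_byWitness[where f' = "permute_list (inv_into UNIV \<pi>)"])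
  have inv: "inv_into UNIV \<pi> permutes {..<r}" using permutes_inv[OF assms] .
  have *: "permute_list f (permute_list g xs) = xs"
    if "f permutes {..<r}" "g \<circ> f = id" "xs \<in> multi_indices m r" for f g xs
  proof -
    have "permute_list f (permute_list g xs) = permute_list (g \<circ> f) xs"
      using that by (intro permute_list_compose[symmetric]) (auto simp: multi_indices_def)
    then show ?thesis using that by simp
  qed
  show "\<forall>xs\<in>multi_indices m r. permute_list (inv_into UNIV \<pi>) (permute_list \<pi> xs) = xs"
    using * inv permutes_inv_o[OF assms] by blast
  show "\<forall>xs\<in>multi_indices m r. permute_list \<pi> (permute_list (inv_into UNIV \<pi>) xs) = xs"
    using * assms permutes_inv_o[OF assms] by blast
  show "permute_list \<pi> ` multi_indices m r \<subseteq> multi_indices m r"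
    using permute_multi_indices_iff[OF assms] by blast
  show "permute_list (inv_into UNIV \<pi>) ` multi_indices m r \<subseteq> multi_indices m r"
    using permute_multi_indices_iff[OF inv] by blast
qed

text \<open>The action of matrices on a tensor power commutes with permutations of the tensor factors.\<close>

lemma tensor_act_permute:
  assumes \<pi>: "\<pi> permutes {..<r}"
  shows "tensor_act m r A (\<lambda>xs. t (permute_list \<pi> xs)) xs = tensor_act m r A t (permute_list \<pi> xs)"
proof (cases "xs \<in> multi_indices m r")
  case True
  have "(\<Prod>l<r. A $$ (permute_list \<pi> xs ! l, permute_list \<pi> ys ! l)) = (\<Prod>l<r. A $$ (xs ! l, ys ! l))"
    if ys: "ys \<in> multi_indices m r" for ys
  proof -
    have len: "length xs = r" "length ys = r" using True ys by (auto simp: multi_indices_def)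
    have "(\<Prod>l<r. A $$ (permute_list \<pi> xs ! l, permute_list \<pi> ys ! l))
        = (\<Prod>l<r. A $$ (xs ! \<pi> l, ys ! \<pi> l))"
      using \<pi> len by (intro prod.cong) (auto simp: permute_list_nth)
    also have "\<dots> = (\<Prod>l<r. A $$ (xs ! l, ys ! l))"
      by (rule prod.reindex_bij_betw[OF permutes_imp_bij[OF \<pi>], of "\<lambda>l. A $$ (xs ! l, ys ! l)"])
    finally show ?thesis .
  qed
  then have "tensor_act m r A (\<lambda>xs. t (permute_list \<pi> xs)) xs
      = (\<Sum>ys\<in>multi_indices m r. (\<Prod>l<r. A $$ (permute_list \<pi> xs ! l, permute_list \<pi> ys ! l))
          * t (permute_list \<pi> ys))"
    using True by (auto simp: tensor_act_def intro!: sum.cong)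
  also have "\<dots> = (\<Sum>ys\<in>multi_indices m r. (\<Prod>l<r. A $$ (permute_list \<pi> xs ! l, ys ! l)) * t ys)"
    by (rule sum.reindex_bij_betw[OF bij_permute_multi_indices[OF \<pi>]])
  finally show ?thesis using True permute_multi_indices_iff[OF \<pi>] by (simp add: tensor_act_def)
qed (simp add: tensor_act_def permute_multi_indices_iff[OF \<pi>])

lemma tensor_act_sum:
  "tensor_act m r A (\<lambda>xs. \<Sum>i\<in>I. c i * t i xs) = (\<lambda>xs. \<Sum>i\<in>I. c i * tensor_act m r A (t i) xs)"
proof
  fix xs
  show "tensor_act m r A (\<lambda>xs. \<Sum>i\<in>I. c i * t i xs) xs = (\<Sum>i\<in>I. c i * tensor_act m r A (t i) xs)"
  proof (cases "xs \<in> multi_indices m r")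
    case True
    have "tensor_act m r A (\<lambda>xs. \<Sum>i\<in>I. c i * t i xs) xs =
      (\<Sum>ys\<in>multi_indices m r. \<Sum>i\<in>I. c i * ((\<Prod>l<r. A $$ (xs ! l, ys ! l)) * t i ys))"
      using True by (auto simp: tensor_act_def sum_distrib_left mult.left_commute intro!: sum.cong)
    also have "\<dots> = (\<Sum>i\<in>I. c i * tensor_act m r A (t i) xs)"
      using True by (subst sum.swap) (simp add: tensor_act_def sum_distrib_left)
    finally show ?thesis .
  qed (simp add: tensor_act_def)
qed


section \<open>Schur functors as representations\<close>

lemma finite_row_col_perms: "finite (row_perms lam)" "finite (col_perms lam)"
  unfolding row_perms_def col_perms_def
  by (rule finite_subset[OF _ finite_permutations[of "{..<sum_list lam}"]], auto)+

lemma young_symmetrizer_act: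
  "young_symmetrizer lam (tensor_act m (sum_list lam) A t)
   = tensor_act m (sum_list lam) A (young_symmetrizer lam t)"
proof -
  let ?r = "sum_list lam"
  have *: "tensor_act m ?r A t (permute_list \<tau> (permute_list \<sigma> xs))
      = tensor_act m ?r A (\<lambda>xs. t (permute_list \<tau> (permute_list \<sigma> xs))) xs"
    if "\<sigma> \<in> row_perms lam" "\<tau> \<in> col_perms lam" for \<sigma> \<tau> xs
    using that tensor_act_permute[of \<sigma> ?r m A "\<lambda>xs. t (permute_list \<tau> xs)" xs]
      tensor_act_permute[of \<tau> ?r m A t "permute_list \<sigma> xs"]
    by (simp add: row_perms_def col_perms_def)
  have y: "young_symmetrizer lam t = (\<lambda>xs. \<Sum>q\<in>row_perms lam \<times> col_perms lam.
      of_int (sign (snd q)) * t (permute_list (snd q) (permute_list (fst q) xs)))" for t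
    by (simp add: young_symmetrizer_def sum.cartesian_product case_prod_unfold)
  show ?thesis unfolding y tensor_act_sum
    by (auto simp: fun_eq_iff * intro!: sum.cong)
qed

lemma young_symmetrizer_tensors:
  assumes "t \<in> tensors m (sum_list lam)"
  shows "young_symmetrizer lam t \<in> tensors m (sum_list lam)"
  unfolding tensors_def
proof (intro CollectI allI impI)
  fix xs assume xs: "xs \<notin> multi_indices m (sum_list lam)"
  have "t (permute_list \<tau> (permute_list \<sigma> xs)) = 0"
    if "\<sigma> \<in> row_perms lam" "\<tau> \<in> col_perms lam" for \<sigma> \<tau>
    using that assms xs permute_multi_indices_iff[of \<sigma> "sum_list lam"]
      permute_multi_indices_iff[of \<tau> "sum_list lam"]
    by (simp add: row_perms_def col_perms_def tensors_def)
  then show "young_symmetrizer lam t xs = 0" by (simp add: young_symmetrizer_def)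
qed

lemma schur_space_subspace: "fun_space.subspace (schur_space m lam)"
  unfolding fun_space.subspace_def
proof (intro conjI ballI allI)
  let ?r = "sum_list lam"
  have "young_symmetrizer lam 0 = 0" by (simp add: young_symmetrizer_def fun_eq_iff)
  moreover have "0 \<in> tensors m ?r" by (simp add: tensors_def)
  ultimately show "0 \<in> schur_space m lam" unfolding schur_space_def by (metis imageI)
  fix x assume "x \<in> schur_space m lam"
  then obtain t where t: "t \<in> tensors m ?r" "x = young_symmetrizer lam t"
    unfolding schur_space_def by blast
  show "scale_tensor c x \<in> schur_space m lam" for c
  proof -
    have "scale_tensor c x = young_symmetrizer lam (scale_tensor c t)"
      by (simp add: t young_symmetrizer_def scale_tensor_def sum_distrib_left mult.left_commute)
    moreover have "scale_tensor c t \<in> tensors m ?r" using t by (simp add: tensors_def scale_tensor_def)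
    ultimately show ?thesis unfolding schur_space_def by blast
  qed
  fix y assume "y \<in> schur_space m lam"
  then obtain u where u: "u \<in> tensors m ?r" "y = young_symmetrizer lam u"
    unfolding schur_space_def by blast
  have "x + y = young_symmetrizer lam (t + u)"
    by (simp add: t u young_symmetrizer_def fun_eq_iff sum.distrib distrib_left)
  moreover have "t + u \<in> tensors m ?r" using t u by (simp add: tensors_def)
  ultimately show "x + y \<in> schur_space m lam" unfolding schur_space_def by blast
qed

lemma schur_space_tensors: "schur_space m lam \<subseteq> tensors m (sum_list lam)"
  unfolding schur_space_def using young_symmetrizer_tensors by blast

text \<open>The basis chosen in the definition of \<open>S\<^sub>\<lambda>\<close> exists because \<open>S\<^sub>\<lambda>\<close> is a subspace of the finite-dimensional
space of tensors.\<close>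

lemma schur_basis: "is_basis (schur_basis m lam) (schur_space m lam)"
  unfolding schur_basis_def
proof (rule someI_ex, rule basis_exists_of_subspace[OF schur_space_subspace])
  show "finite (delta ` multi_indices m (sum_list lam))" by simp
  show "schur_space m lam \<subseteq> fun_space.span (delta ` multi_indices m (sum_list lam))"
    using schur_space_tensors tensors_span by blast
qed

lemma schur_space_act:
  assumes "w \<in> schur_space m lam"
  shows "tensor_act m (sum_list lam) A w \<in> schur_space m lam"
  using assms young_symmetrizer_act[of lam m A] tensor_act_tensors
  unfolding schur_space_def by (metis (no_types, lifting) image_iff)

lemma schur_coords:
  assumes "w \<in> schur_space m lam"
  shows "schur_coords m lam w \<in> carrier_vec (schur_dim m lam)"
    "lin_comb (schur_basis m lam) (schur_coords m lam w) = w"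
proof -
  have b: "inj_on (lin_comb (schur_basis m lam)) (carrier_vec (schur_dim m lam))"
    "w \<in> lin_comb (schur_basis m lam) ` carrier_vec (schur_dim m lam)"
    using schur_basis assms unfolding is_basis_def bij_betw_def schur_dim_def by auto
  show "schur_coords m lam w \<in> carrier_vec (schur_dim m lam)"
    unfolding schur_coords_def by (rule the_inv_into_into[OF b]) simp
  show "lin_comb (schur_basis m lam) (schur_coords m lam w) = w"
    unfolding schur_coords_def by (rule f_the_inv_into_f[OF b])
qed

lemma lin_comb_schur_basis_inj:
  assumes "c \<in> carrier_vec (schur_dim m lam)" "c' \<in> carrier_vec (schur_dim m lam)"
    and "lin_comb (schur_basis m lam) c = lin_comb (schur_basis m lam) c'"
  shows "c = c'"
  using schur_basis assms unfolding is_basis_def bij_betw_def schur_dim_def by (meson inj_onD)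

lemma lin_comb_in_schur_space:
  "c \<in> carrier_vec (schur_dim m lam) \<Longrightarrow> lin_comb (schur_basis m lam) c \<in> schur_space m lam"
  using schur_basis unfolding is_basis_def bij_betw_def schur_dim_def by blast

lemma schur_basis_nth_in: "j < schur_dim m lam \<Longrightarrow> schur_basis m lam ! j \<in> schur_space m lam"
proof -
  assume j: "j < schur_dim m lam"
  have "lin_comb (schur_basis m lam) (unit_vec (schur_dim m lam) j) = schur_basis m lam ! j"
  proof
    fix xs
    have "lin_comb (schur_basis m lam) (unit_vec (schur_dim m lam) j) xs
        = (\<Sum>i<schur_dim m lam. if j = i then (schur_basis m lam ! i) xs else 0)"
      unfolding lin_comb_def schur_dim_def[symmetric] using j by (intro sum.cong) auto
    then show "lin_comb (schur_basis m lam) (unit_vec (schur_dim m lam) j) xs = (schur_basis m lam ! j) xs"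
      using j by simp
  qed
  then show ?thesis using lin_comb_in_schur_space[of "unit_vec (schur_dim m lam) j" m lam] by simp
qed

lemma schur_mat_carrier [simp]: "schur_mat m lam A \<in> carrier_mat (schur_dim m lam) (schur_dim m lam)"
  unfolding schur_mat_def by (rule carrier_matI) (auto simp: schur_dim_def)

lemma schur_mat_vec_carrier:
  "c \<in> carrier_vec (schur_dim m lam) \<Longrightarrow> schur_mat m lam A *\<^sub>v c \<in> carrier_vec (schur_dim m lam)"
  by (rule mult_mat_vec_carrier[OF schur_mat_carrier])

text \<open>Through \<open>lin_comb\<close>, which is injective on coordinate vectors, all identities between the matrices of \<open>S\<^sub>\<lambda>\<close>
reduce to identities of the action on tensors.\<close>

lemma schur_mat_act:
  assumes c: "c \<in> carrier_vec (schur_dim m lam)"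
  shows "lin_comb (schur_basis m lam) (schur_mat m lam A *\<^sub>v c)
    = tensor_act m (sum_list lam) A (lin_comb (schur_basis m lam) c)"
proof -
  define D where "D = schur_dim m lam"
  define bs where "bs = schur_basis m lam"
  define a where "a j = schur_coords m lam (tensor_act m (sum_list lam) A (bs ! j))" for j
  have D: "length bs = D" by (simp add: D_def bs_def schur_dim_def)
  have entry: "schur_mat m lam A $$ (i, j) = a j $ i" if "i < D" "j < D" for i j
    using that D unfolding schur_mat_def by (simp add: mat_of_cols_index a_def D_def bs_def)
  have a: "(\<Sum>i<D. a j $ i * (bs ! i) xs) = tensor_act m (sum_list lam) A (bs ! j) xs" if "j < D" for j xs
    using schur_coords(2)[OF schur_space_act[OF schur_basis_nth_in], of j m lam A] that
    unfolding lin_comb_def D[unfolded bs_def] by (auto simp: a_def bs_def D_def fun_eq_iff schur_dim_def)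
  have "lin_comb bs (schur_mat m lam A *\<^sub>v c) xs = tensor_act m (sum_list lam) A (lin_comb bs c) xs" for xs
  proof -
    have v: "(schur_mat m lam A *\<^sub>v c) $ i = (\<Sum>j<D. c $ j * a j $ i)" if "i < D" for i
      using c that schur_mat_carrier[of m lam A]
      by (auto simp: scalar_prod_def D_def[symmetric] entry atLeast0LessThan mult.commute intro!: sum.cong)
    have "lin_comb bs (schur_mat m lam A *\<^sub>v c) xs
        = (\<Sum>i<D. \<Sum>j<D. c $ j * (a j $ i * (bs ! i) xs))"
      unfolding lin_comb_def D by (intro sum.cong refl) (simp add: v sum_distrib_right mult.assoc)
    also have "\<dots> = (\<Sum>j<D. c $ j * tensor_act m (sum_list lam) A (bs ! j) xs)"
      by (subst sum.swap) (auto simp: a simp flip: sum_distrib_left)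
    also have "\<dots> = tensor_act m (sum_list lam) A (lin_comb bs c) xs"
      unfolding lin_comb_def D tensor_act_sum ..
    finally show ?thesis .
  qed
  then show ?thesis by (auto simp: bs_def)
qed

lemma mat_eqI_mult_vec:
  assumes "M \<in> carrier_mat a b" "N \<in> carrier_mat a b"
    and "\<And>c. c \<in> carrier_vec b \<Longrightarrow> M *\<^sub>v c = (N *\<^sub>v c :: complex vec)"
  shows "M = N"
proof (rule eq_matI)
  fix i j assume "i < dim_row N" "j < dim_col N"
  then have ij: "i < a" "j < b" using assms by auto
  have "X $$ (i, j) = (X *\<^sub>v unit_vec b j) $ i" if "X \<in> carrier_mat a b" for X :: "complex mat"
    using that ij by (simp add: scalar_prod_right_unit)
  from this[OF assms(1)] this[OF assms(2)] show "M $$ (i, j) = N $$ (i, j)"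
    using assms(3)[of "unit_vec b j"] by simp
qed (use assms in auto)

lemma one_smult_mat: "(1 :: complex) \<cdot>\<^sub>m M = M"
  by (intro eq_matI) auto

lemma schur_mat_mult:
  assumes "A \<in> carrier_mat m m" "B \<in> carrier_mat m m"
  shows "schur_mat m lam (A * B) = schur_mat m lam A * schur_mat m lam B"
proof (rule mat_eqI_mult_vec[of _ "schur_dim m lam" "schur_dim m lam"])
  fix c :: "complex vec" assume c: "c \<in> carrier_vec (schur_dim m lam)"
  have Bc: "schur_mat m lam B *\<^sub>v c \<in> carrier_vec (schur_dim m lam)"
    by (rule mult_mat_vec_carrier[OF schur_mat_carrier c])
  have "lin_comb (schur_basis m lam) (schur_mat m lam (A * B) *\<^sub>v c)
      = lin_comb (schur_basis m lam) (schur_mat m lam A *\<^sub>v (schur_mat m lam B *\<^sub>v c))"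
    using c Bc by (simp add: schur_mat_act tensor_act_mult[OF assms])
  then have "schur_mat m lam (A * B) *\<^sub>v c = schur_mat m lam A *\<^sub>v (schur_mat m lam B *\<^sub>v c)"
    by (rule lin_comb_schur_basis_inj[OF schur_mat_vec_carrier[OF c] schur_mat_vec_carrier[OF Bc]])
  then show "schur_mat m lam (A * B) *\<^sub>v c = schur_mat m lam A * schur_mat m lam B *\<^sub>v c"
    using assoc_mult_mat_vec[OF schur_mat_carrier schur_mat_carrier c] by simp
qed (auto intro: mult_carrier_mat[OF schur_mat_carrier schur_mat_carrier])

lemma schur_mat_scalar:
  "schur_mat m lam (s \<cdot>\<^sub>m 1\<^sub>m m) = s ^ sum_list lam \<cdot>\<^sub>m 1\<^sub>m (schur_dim m lam)"
proof (rule mat_eqI_mult_vec[of _ "schur_dim m lam" "schur_dim m lam"])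
  fix c :: "complex vec" assume c: "c \<in> carrier_vec (schur_dim m lam)"
  let ?s = "s ^ sum_list lam"
  have c': "?s \<cdot>\<^sub>m 1\<^sub>m (schur_dim m lam) *\<^sub>v c = ?s \<cdot>\<^sub>v c"
    using c by (intro eq_vecI) (auto simp: row_smult)
  have "lin_comb (schur_basis m lam) (schur_mat m lam (s \<cdot>\<^sub>m 1\<^sub>m m) *\<^sub>v c)
      = scale_tensor ?s (lin_comb (schur_basis m lam) c)"
    using schur_mat_act[OF c] tensor_act_scalar[of _ m "sum_list lam" s]
      lin_comb_in_schur_space[OF c] schur_space_tensors by (metis subsetD)
  also have "\<dots> = lin_comb (schur_basis m lam) (?s \<cdot>\<^sub>v c)"
    using c by (auto simp: lin_comb_def scale_tensor_def sum_distrib_left schur_dim_def mult.assoc fun_eq_iff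
        intro!: sum.cong)
  finally show "schur_mat m lam (s \<cdot>\<^sub>m 1\<^sub>m m) *\<^sub>v c = ?s \<cdot>\<^sub>m 1\<^sub>m (schur_dim m lam) *\<^sub>v c"
    unfolding c' using c by (intro lin_comb_schur_basis_inj[OF schur_mat_vec_carrier[OF c]]) auto
qed auto

text \<open>The exponent comes from scalar matrices: \<open>s\<close> acts on \<open>S\<^sub>\<lambda>\<close> by \<open>s\<close> to the power \<open>|\<lambda>|\<close>.\<close>

lemma det_schur_mat:
  assumes "0 < m"
  obtains e where "m * e = schur_dim m lam * sum_list lam"
    "\<And>A. A \<in> GL m \<Longrightarrow> det (schur_mat m lam A) = det A ^ e"
proof (rule character_eq_det_power[of m "\<lambda>A. det (schur_mat m lam A)"])
  show mult: "det (schur_mat m lam (A * B)) = det (schur_mat m lam A) * det (schur_mat m lam B)"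
    if "A \<in> GL m" "B \<in> GL m" for A B
    using that schur_mat_mult[of A m B lam] det_mult[OF schur_mat_carrier schur_mat_carrier]
    by (simp add: GL_iff)
  show scalar: "det (schur_mat m lam (s \<cdot>\<^sub>m 1\<^sub>m m)) = s ^ (schur_dim m lam * sum_list lam)" for s
    by (simp add: schur_mat_scalar det_smult mult.commute flip: power_mult)
  have one: "det (schur_mat m lam (1\<^sub>m m)) = 1" using scalar[of 1] by (simp add: one_smult_mat)
  show "det (schur_mat m lam A) \<noteq> 0" if A: "A \<in> GL m" for A
  proof -
    obtain B where "B \<in> GL m" "B * A = 1\<^sub>m m" using GL_inverse[OF A] .
    then show ?thesis using mult[OF _ A, of B] one by auto
  qed
qed (use assms that in auto)


section \<open>Dimensions of Schur functors\<close>

lemma length_cells: "length (cells lam) = sum_list lam"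
proof -
  have "length (cells lam) = sum_list (map ((!) lam) [0..<length lam])"
    by (simp add: cells_def length_concat o_def)
  then show ?thesis by (simp add: map_nth)
qed

lemma distinct_cells: "distinct (cells lam)"
proof -
  have "distinct (concat (map (\<lambda>i. map (Pair i) [0..<lam ! i]) is))" if "distinct is" for "is"
    using that by (induction "is") (auto simp: distinct_map inj_on_def)
  then show ?thesis unfolding cells_def by simp
qed

lemma fst_cells: "l < sum_list lam \<Longrightarrow> fst (cells lam ! l) < length lam"
proof -
  assume "l < sum_list lam"
  then have "cells lam ! l \<in> set (cells lam)" by (simp add: length_cells)
  then show ?thesis by (auto simp: cells_def)
qed

text \<open>A cell is determined by its row and its column.\<close>

lemma row_col_perm_id:
  assumes "\<tau> \<in> col_perms lam" "\<And>l. l < sum_list lam \<Longrightarrow> fst (cells lam ! \<tau> l) = fst (cells lam ! l)"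
  shows "\<tau> = id"
proof -
  have p: "\<tau> permutes {..<sum_list lam}" using assms(1) by (simp add: col_perms_def)
  show ?thesis
  proof
    fix l show "\<tau> l = id l"
    proof (cases "l < sum_list lam")
      case True
      then have "\<tau> l < sum_list lam" using permutes_in_image[OF p] by auto
      moreover have "cells lam ! \<tau> l = cells lam ! l"
        using assms True by (simp add: col_perms_def prod_eq_iff)
      ultimately show ?thesis
        using True distinct_cells[of lam] by (simp add: nth_eq_iff_index_eq length_cells)
    qed (use p in \<open>auto simp: permutes_def\<close>)
  qed
qed

text \<open>If no nontrivial column permutation contributes, all signs are positive and the coefficient of the word
in its own symmetrization counts the row permutations that fix it.\<close>

lemma young_symmetrizer_delta_nonzero:
  assumes len: "length xs = sum_list lam"
    and triv: "\<And>\<sigma> \<tau>. \<sigma> \<in> row_perms lam \<Longrightarrow> \<tau> \<in> col_perms lam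
      \<Longrightarrow> permute_list \<tau> (permute_list \<sigma> xs) = xs \<Longrightarrow> \<tau> = id"
  shows "young_symmetrizer lam (delta xs) xs \<noteq> 0"
proof -
  let ?r = "sum_list lam"
  have id: "id \<in> row_perms lam" "id \<in> col_perms lam"
    by (auto simp: row_perms_def col_perms_def permutes_id)
  have inner: "(\<Sum>\<tau>\<in>col_perms lam. of_int (sign \<tau>) * delta xs (permute_list \<tau> (permute_list \<sigma> xs)))
      = (if permute_list \<sigma> xs = xs then 1 else 0 :: complex)" if "\<sigma> \<in> row_perms lam" for \<sigma>
  proof -
    have "(\<Sum>\<tau>\<in>col_perms lam. of_int (sign \<tau>) * delta xs (permute_list \<tau> (permute_list \<sigma> xs)))
      = (\<Sum>\<tau>\<in>{id}. of_int (sign \<tau>) * delta xs (permute_list \<tau> (permute_list \<sigma> xs)))"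
      using triv[OF that] id finite_row_col_perms(2)
      by (intro sum.mono_neutral_right) (auto simp: delta_def)
    then show ?thesis by (simp add: delta_def sign_id)
  qed
  have "young_symmetrizer lam (delta xs) xs
      = (\<Sum>\<sigma>\<in>row_perms lam. if permute_list \<sigma> xs = xs then 1 else 0)"
    unfolding young_symmetrizer_def by (intro sum.cong refl inner)
  also have "\<dots> = of_nat (card {\<sigma> \<in> row_perms lam. permute_list \<sigma> xs = xs})"
    using finite_row_col_perms(1) by (simp add: sum.If_cases Int_def)
  finally have *: "young_symmetrizer lam (delta xs) xs
      = of_nat (card {\<sigma> \<in> row_perms lam. permute_list \<sigma> xs = xs})" .
  have "id \<in> {\<sigma> \<in> row_perms lam. permute_list \<sigma> xs = xs}" using id by simp
  then have "card {\<sigma> \<in> row_perms lam. permute_list \<sigma> xs = xs} \<noteq> 0"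
    using finite_row_col_perms(1)[of lam] by (metis (no_types, lifting) card_0_eq empty_iff finite_Collect_conjI finite_subset mem_Collect_eq subsetI)
  then show ?thesis using * by simp
qed

text \<open>The highest weight vector does not vanish: it comes from the word that labels every cell by its row. A
column permutation fixes this word, up to a row permutation, only if it preserves the rows.\<close>

lemma schur_dim_pos:
  assumes "length lam = m"
  shows "0 < schur_dim m lam"
proof -
  let ?r = "sum_list lam"
  define xs where "xs = map fst (cells lam)"
  have len: "length xs = ?r" by (simp add: xs_def length_cells)
  have nth: "xs ! l = fst (cells lam ! l)" if "l < ?r" for l
    using that by (simp add: xs_def length_cells)
  have xs: "xs \<in> multi_indices m ?r"
    using assms fst_cells len by (auto simp: multi_indices_def in_set_conv_nth nth)
  have "young_symmetrizer lam (delta xs) xs \<noteq> 0"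
  proof (rule young_symmetrizer_delta_nonzero[OF len])
    fix \<sigma> \<tau> assume st: "\<sigma> \<in> row_perms lam" "\<tau> \<in> col_perms lam"
      and eq: "permute_list \<tau> (permute_list \<sigma> xs) = xs"
    have p: "\<sigma> permutes {..<?r}" "\<tau> permutes {..<?r}" using st by (auto simp: row_perms_def col_perms_def)
    show "\<tau> = id"
    proof (rule row_col_perm_id[OF st(2)])
      fix l assume l: "l < ?r"
      then have tl: "\<tau> l < ?r" "\<sigma> (\<tau> l) < ?r"
        using permutes_in_image[OF p(1)] permutes_in_image[OF p(2)] by auto
      have "xs ! l = xs ! \<sigma> (\<tau> l)"
        using arg_cong[OF eq, of "\<lambda>ys. ys ! l"] l tl p len by (simp add: permute_list_nth)
      then show "fst (cells lam ! \<tau> l) = fst (cells lam ! l)"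
        using nth l tl st by (simp add: row_perms_def)
    qed
  qed
  moreover have "young_symmetrizer lam (delta xs) \<in> schur_space m lam"
    using delta_tensors[OF xs] unfolding schur_space_def by blast
  ultimately have "card {xs} \<le> length (schur_basis m lam)"
    by (intro card_le_basis_of_test_points[OF schur_basis, where p = "\<lambda>x. x"
          and v = "\<lambda>x. young_symmetrizer lam (delta x)"]) auto
  then have "1 \<le> schur_dim m lam" unfolding schur_dim_def by (rule order_trans[rotated]) simp
  then show ?thesis by linarith
qed

lemma permute_distinct_id:
  assumes "distinct xs" "\<pi> permutes {..<length xs}" "permute_list \<pi> xs = xs"
  shows "\<pi> = id"
proof
  fix l show "\<pi> l = id l"
  proof (cases "l < length xs")
    case True
    have "xs ! \<pi> l = xs ! l" using assms True by (metis permute_list_nth)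
    moreover have "\<pi> l < length xs" using permutes_in_image[OF assms(2)] True by auto
    ultimately show ?thesis using assms(1) True by (simp add: nth_eq_iff_index_eq)
  qed (use assms(2) in \<open>auto simp: permutes_def\<close>)
qed

text \<open>Each set of \<open>|\<lambda>|\<close> letters contributes a weight vector of \<open>S\<^sub>\<lambda>\<close>, the symmetrization of the word that lists
these letters. It is nonzero since only the identity fixes a word with distinct letters, and the
vectors of different sets have disjoint supports.\<close>

lemma schur_dim_ge_binomial: "m choose (sum_list lam) \<le> schur_dim m lam"
proof -
  let ?r = "sum_list lam"
  define I where "I = {A. A \<subseteq> {..<m} \<and> card A = ?r}"
  have fin: "finite A" if "A \<in> I" for A using that finite_subset unfolding I_def by blast
  have card: "card I = m choose ?r" using n_subsets[of "{..<m}" ?r] by (simp add: I_def)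
  have sl: "distinct (sorted_list_of_set A)" "set (sorted_list_of_set A) = A"
    "length (sorted_list_of_set A) = ?r" if "A \<in> I" for A
    using that fin[OF that] by (auto simp: I_def)
  have "card I \<le> length (schur_basis m lam)"
  proof (rule card_le_basis_of_test_points[OF schur_basis, where p = sorted_list_of_set
        and v = "\<lambda>A. young_symmetrizer lam (delta (sorted_list_of_set A))"])
    show "finite I" unfolding I_def by (rule finite_subset[of _ "Pow {..<m}"]) auto
    fix A assume A: "A \<in> I"
    have "sorted_list_of_set A \<in> multi_indices m ?r"
      using sl[OF A] A by (auto simp: multi_indices_def I_def)
    then show "young_symmetrizer lam (delta (sorted_list_of_set A)) \<in> schur_space m lam"
      using delta_tensors unfolding schur_space_def by blast
    let ?xs = "sorted_list_of_set A"
    show "young_symmetrizer lam (delta ?xs) ?xs \<noteq> 0"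
    proof (rule young_symmetrizer_delta_nonzero[OF sl(3)[OF A]])
      fix \<sigma> \<tau> assume st: "\<sigma> \<in> row_perms lam" "\<tau> \<in> col_perms lam"
        and eq: "permute_list \<tau> (permute_list \<sigma> ?xs) = ?xs"
      have p: "\<sigma> permutes {..<?r}" "\<tau> permutes {..<?r}" using st by (auto simp: row_perms_def col_perms_def)
      have "permute_list (\<sigma> \<circ> \<tau>) ?xs = ?xs"
        using eq p sl(3)[OF A] by (simp add: permute_list_compose)
      then have "\<sigma> \<circ> \<tau> = id"
        using permute_distinct_id[OF sl(1)[OF A]] permutes_compose[OF p(2,1)] sl(3)[OF A] by simp
      then have inv: "\<sigma> (\<tau> l) = l" for l by (metis comp_apply id_apply)
      show "\<tau> = id"
      proof (rule row_col_perm_id[OF st(2)])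
        fix l assume "l < ?r"
        then have "\<tau> l < ?r" using permutes_in_image[OF p(2)] by auto
        then have "fst (cells lam ! \<sigma> (\<tau> l)) = fst (cells lam ! \<tau> l)"
          using st by (simp add: row_perms_def)
        then show "fst (cells lam ! \<tau> l) = fst (cells lam ! l)" by (simp add: inv)
      qed
    qed
  next
    fix A B assume AB: "A \<in> I" "B \<in> I" "A \<noteq> B"
    have "delta (sorted_list_of_set A) (permute_list \<tau> (permute_list \<sigma> (sorted_list_of_set B))) = 0"
      if "\<sigma> \<in> row_perms lam" "\<tau> \<in> col_perms lam" for \<sigma> \<tau>
    proof -
      have "set (permute_list \<tau> (permute_list \<sigma> (sorted_list_of_set B))) = B"
        using that sl[OF AB(2)] by (simp add: row_perms_def col_perms_def)
      then show ?thesis using sl(2)[OF AB(1)] AB(3) by (auto simp: delta_def)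
    qed
    then show "young_symmetrizer lam (delta (sorted_list_of_set A)) (sorted_list_of_set B) = 0"
      by (simp add: young_symmetrizer_def)
  qed
  then show ?thesis by (simp add: card schur_dim_def)
qed


section \<open>Weights of size one and two\<close>

lemma cells_append_zeros: "cells (lam @ replicate j 0) = cells lam"
proof -
  let ?f = "\<lambda>i. map (Pair i) [0..<(lam @ replicate j 0) ! i]"
  have "cells (lam @ replicate j 0) = concat (map ?f ([0..<length lam] @ [length lam..<length lam + j]))"
    unfolding cells_def length_append length_replicate
    by (simp only: upt_add_eq_append[of 0 "length lam" j, OF le0])
  also have "\<dots> = concat (map ?f [0..<length lam]) @ concat (map ?f [length lam..<length lam + j])"
    by (simp only: map_append concat_append)
  also have "map ?f [0..<length lam] = map (\<lambda>i. map (Pair i) [0..<lam ! i]) [0..<length lam]"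
    by (intro map_cong) (auto simp: nth_append)
  also have "?f i = []" if "i \<in> set [length lam..<length lam + j]" for i
    using that by (auto simp: nth_append)
  then have "concat (map ?f [length lam..<length lam + j]) = []"
    by (simp only: concat_eq_Nil_conv set_map) blast
  finally show ?thesis by (simp add: cells_def)
qed

text \<open>Only the cells enter the construction, and empty rows have none. Hence \<open>(2, 0, \<dots>, 0)\<close> and
\<open>(1, 1, 0, \<dots>, 0)\<close> give literally \<open>Sym2\<close> and \<open>Wedge2\<close>.\<close>

lemma schur_append_zeros: "schur (lam @ replicate j 0) = schur lam"
proof -
  have s: "sum_list (lam @ replicate j 0) = sum_list lam" by (simp add: sum_list_replicate)
  have p: "row_perms (lam @ replicate j 0) = row_perms lam" "col_perms (lam @ replicate j 0) = col_perms lam"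
    unfolding row_perms_def col_perms_def s cells_append_zeros by simp_all
  have y: "young_symmetrizer (lam @ replicate j 0) = young_symmetrizer lam"
    by (intro ext) (simp only: young_symmetrizer_def p)
  have b: "schur_basis m (lam @ replicate j 0) = schur_basis m lam" for m
    unfolding schur_basis_def schur_space_def s y ..
  have c: "schur_coords m (lam @ replicate j 0) = schur_coords m lam" for m
    unfolding schur_coords_def schur_dim_def b ..
  show ?thesis
    by (intro ext) (simp only: schur_def schur_mat_def schur_dim_def b c s)
qed

lemma schur_space_1: "schur_space m [1] = tensors m 1"
proof -
  have "row_perms [1] = {id}" "col_perms [1] = {id}"
    by (auto simp: row_perms_def col_perms_def permutes_id lessThan_Suc)
  then have "young_symmetrizer [1] t = t" for t
    by (auto simp: young_symmetrizer_def sign_id)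
  then show ?thesis by (simp add: schur_space_def)
qed

lemma multi_indices_1: "multi_indices m 1 = (\<lambda>i. [i]) ` {..<m}"
  by (auto simp: multi_indices_def length_Suc_conv)

lemma singleton_multi_indices [simp]: "[i] \<in> multi_indices m (Suc 0) \<longleftrightarrow> i < m"
  by (auto simp: multi_indices_def)

lemma tensor_act_1:
  assumes "i < m"
  shows "tensor_act m 1 A t [i] = (\<Sum>j<m. A $$ (i, j) * t [j])"
proof -
  have "tensor_act m 1 A t [i] = (\<Sum>ys\<in>(\<lambda>i. [i]) ` {..<m}. A $$ (i, hd ys) * t ys)"
    using assms unfolding tensor_act_def multi_indices_1
    by (auto simp: intro!: sum.cong)
  also have "\<dots> = (\<Sum>j<m. A $$ (i, j) * t [j])"
    by (subst sum.reindex) (auto simp: inj_on_def)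
  finally show ?thesis .
qed

text \<open>\<open>S\<^sub>1\<close> is the space of all tensors of order one. \<open>P\<close> reads off the coordinates of such a tensor, and \<open>Q\<close>
expresses it in the chosen basis.\<close>

lemma schur_1_conjugate:
  obtains P Q where "P \<in> carrier_mat m (schur_dim m [1])" "Q \<in> carrier_mat (schur_dim m [1]) m"
    "P * Q = 1\<^sub>m m" "Q * P = 1\<^sub>m (schur_dim m [1])"
    "\<And>A. A \<in> carrier_mat m m \<Longrightarrow> A * P = P * schur_mat m [1] A"
proof -
  define D where "D = schur_dim m [1]"
  define L where "L = lin_comb (schur_basis m [1])"
  define tens where "tens v = (\<lambda>xs. if xs \<in> multi_indices m 1 then v $ hd xs else 0 :: complex)" for v
  define P where "P = mat m D (\<lambda>(i, j). (schur_basis m [1] ! j) [i])"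
  define Q where "Q = mat D m (\<lambda>(j, i). schur_coords m [1] (tens (unit_vec m i)) $ j)"
  have P: "P \<in> carrier_mat m D" and Q: "Q \<in> carrier_mat D m" by (auto simp: P_def Q_def)
  have tens: "tens v \<in> schur_space m [1]" for v
    unfolding schur_space_1 by (simp add: tensors_def tens_def)
  have Pc: "(P *\<^sub>v c) $ i = L c [i]" if "c \<in> carrier_vec D" "i < m" for c i
    using that by (simp add: P_def L_def lin_comb_def scalar_prod_def D_def schur_dim_def
        atLeast0LessThan mult.commute)
  have L_eq: "t = u" if "t \<in> tensors m 1" "u \<in> tensors m 1" "\<And>i. i < m \<Longrightarrow> t [i] = u [i]"
    for t u :: "nat list \<Rightarrow> complex"
  proof
    fix xs show "t xs = u xs"
      using that unfolding tensors_def multi_indices_1 by (cases "xs \<in> (\<lambda>i. [i]) ` {..<m}") auto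
  qed
  have L_in: "L c \<in> tensors m 1" if "c \<in> carrier_vec D" for c
    using lin_comb_in_schur_space[of c m "[1]"] that unfolding L_def D_def schur_space_1 by simp
  have Qv: "L (Q *\<^sub>v v) = tens v" if v: "v \<in> carrier_vec m" for v
  proof (rule L_eq)
    have Qvc: "Q *\<^sub>v v \<in> carrier_vec D" using Q v by (rule mult_mat_vec_carrier)
    show "L (Q *\<^sub>v v) \<in> tensors m 1" by (rule L_in[OF Qvc])
    show "tens v \<in> tensors m 1" using tens schur_space_1 by simp
    fix i assume i: "i < m"
    have lc: "(\<Sum>j<D. schur_coords m [1] (tens (unit_vec m l)) $ j * (schur_basis m [1] ! j) [i])
        = tens (unit_vec m l) [i]" for l
      using fun_cong[OF schur_coords(2)[OF tens[of "unit_vec m l"]], of "[i]"]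
      by (simp add: lin_comb_def D_def schur_dim_def)
    have "L (Q *\<^sub>v v) [i] = (\<Sum>j<D. \<Sum>l<m. v $ l * (schur_coords m [1] (tens (unit_vec m l)) $ j * (schur_basis m [1] ! j) [i]))"
      unfolding L_def lin_comb_def schur_dim_def[symmetric] D_def[symmetric]
    proof (intro sum.cong refl)
      fix j assume "j \<in> {..<D}"
      then have "(Q *\<^sub>v v) $ j = (\<Sum>l<m. v $ l * schur_coords m [1] (tens (unit_vec m l)) $ j)"
        using v by (simp add: Q_def scalar_prod_def atLeast0LessThan mult.commute)
      then show "(Q *\<^sub>v v) $ j * (schur_basis m [1] ! j) [i]
        = (\<Sum>l<m. v $ l * (schur_coords m [1] (tens (unit_vec m l)) $ j * (schur_basis m [1] ! j) [i]))"
        by (simp add: sum_distrib_right mult.assoc)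
    qed
    also have "\<dots> = (\<Sum>l<m. v $ l * tens (unit_vec m l) [i])"
      by (subst sum.swap) (simp only: lc sum_distrib_left[symmetric])
    also have "\<dots> = (\<Sum>l<m. if l = i then v $ i else 0)"
      using i by (intro sum.cong) (auto simp: tens_def)
    finally show "L (Q *\<^sub>v v) [i] = tens v [i]" using i by (simp add: tens_def)
  qed
  have inj: "c = c'" if "c \<in> carrier_vec D" "c' \<in> carrier_vec D" "L c = L c'" for c c'
    using lin_comb_schur_basis_inj that unfolding L_def D_def by blast
  show thesis
  proof (rule that[of P Q])
    show "P \<in> carrier_mat m (schur_dim m [1])" "Q \<in> carrier_mat (schur_dim m [1]) m"
      using P Q by (auto simp: D_def)
    show "P * Q = 1\<^sub>m m"
    proof (rule mat_eqI_mult_vec)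
      fix v :: "complex vec" assume v: "v \<in> carrier_vec m"
      have "P *\<^sub>v (Q *\<^sub>v v) = v"
        using P Q v by (intro eq_vecI) (auto simp: Pc Qv tens_def multi_indices_1 simp del: index_mult_mat_vec)
      then show "P * Q *\<^sub>v v = 1\<^sub>m m *\<^sub>v v" using assoc_mult_mat_vec[OF P Q v] v by simp
    qed (use P Q in auto)
    show "Q * P = 1\<^sub>m (schur_dim m [1])"
    proof (rule mat_eqI_mult_vec)
      fix c :: "complex vec" assume "c \<in> carrier_vec (schur_dim m [1])"
      then have c: "c \<in> carrier_vec D" by (simp add: D_def)
      have Pcc: "P *\<^sub>v c \<in> carrier_vec m" using P c by (rule mult_mat_vec_carrier)
      have "L (Q *\<^sub>v (P *\<^sub>v c)) = L c"
        unfolding Qv[OF Pcc]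
        by (rule L_eq[OF _ L_in[OF c]])
           (use c in \<open>auto simp: tens_def tensors_def multi_indices_1 Pc simp del: index_mult_mat_vec\<close>)
      then have "Q *\<^sub>v (P *\<^sub>v c) = c"
        by (intro inj mult_mat_vec_carrier[OF Q Pcc] c)
      then show "Q * P *\<^sub>v c = 1\<^sub>m (schur_dim m [1]) *\<^sub>v c"
        using assoc_mult_mat_vec[OF Q P c] c by (simp add: D_def)
    qed (use P Q in \<open>auto simp: D_def\<close>)
    fix A :: "complex mat" assume A: "A \<in> carrier_mat m m"
    have S: "schur_mat m [1] A \<in> carrier_mat D D" by (simp add: D_def)
    show "A * P = P * schur_mat m [1] A"
    proof (rule mat_eqI_mult_vec)
      fix c :: "complex vec" assume c: "c \<in> carrier_vec D"
      have Sc: "schur_mat m [1] A *\<^sub>v c \<in> carrier_vec D" using S c by (rule mult_mat_vec_carrier)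
      have "A *\<^sub>v (P *\<^sub>v c) = P *\<^sub>v (schur_mat m [1] A *\<^sub>v c)"
      proof (rule eq_vecI)
        fix i assume "i < dim_vec (P *\<^sub>v (schur_mat m [1] A *\<^sub>v c))"
        then have i: "i < m" using P by simp
        have "(A *\<^sub>v (P *\<^sub>v c)) $ i = (\<Sum>j<m. A $$ (i, j) * (P *\<^sub>v c) $ j)"
          using A P c i by (simp add: scalar_prod_def atLeast0LessThan)
        also have "\<dots> = tensor_act m 1 A (L c) [i]"
          unfolding tensor_act_1[OF i] by (intro sum.cong) (auto simp: Pc[OF c])
        also have "\<dots> = L (schur_mat m [1] A *\<^sub>v c) [i]"
          using schur_mat_act[of c m "[1]" A] c by (simp add: L_def D_def)
        finally show "(A *\<^sub>v (P *\<^sub>v c)) $ i = (P *\<^sub>v (schur_mat m [1] A *\<^sub>v c)) $ i"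
          using Pc[OF Sc i] by simp
      qed (use A P in auto)
      then show "A * P *\<^sub>v c = P * schur_mat m [1] A *\<^sub>v c"
        using assoc_mult_mat_vec[OF A P c] assoc_mult_mat_vec[OF P S c] by simp
    qed (use A P S in auto)
  qed
qed

lemma schur_1_iso:
  assumes "square_rep k n E"
  shows "bundle_iso k n (schur [1] E) E"
proof -
  let ?m = "bundle_rank E"
  obtain P Q where PQ: "P \<in> carrier_mat ?m (schur_dim ?m [1])" "Q \<in> carrier_mat (schur_dim ?m [1]) ?m"
    "P * Q = 1\<^sub>m ?m" "Q * P = 1\<^sub>m (schur_dim ?m [1])"
    "\<And>A. A \<in> carrier_mat ?m ?m \<Longrightarrow> A * P = P * schur_mat ?m [1] A"
    using schur_1_conjugate[of ?m] by blast
  have QA: "schur_mat ?m [1] A * Q = Q * A" if A: "A \<in> carrier_mat ?m ?m" for A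
  proof -
    let ?S = "schur_mat ?m [1] A" and ?D = "schur_dim ?m [1]"
    have S: "?S \<in> carrier_mat ?D ?D" by simp
    have "?S * Q = 1\<^sub>m ?D * (?S * Q)"
      by (rule left_mult_one_mat[OF mult_carrier_mat[OF S PQ(2)], symmetric])
    also have "\<dots> = (Q * P) * (?S * Q)" by (simp only: PQ(4))
    also have "\<dots> = Q * (P * (?S * Q))"
      by (rule assoc_mult_mat[OF PQ(2,1) mult_carrier_mat[OF S PQ(2)]])
    also have "P * (?S * Q) = (P * ?S) * Q"
      by (rule assoc_mult_mat[OF PQ(1) S PQ(2), symmetric])
    also have "\<dots> = (A * P) * Q" using PQ(5)[OF A] by simp
    also have "\<dots> = A * (P * Q)" by (rule assoc_mult_mat[OF A PQ(1,2)])
    also have "\<dots> = A" using PQ(3) A by simp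
    finally show ?thesis .
  qed
  show ?thesis unfolding bundle_iso_def
  proof (intro exI conjI ballI)
    show "bundle_hom k n (schur [1] E) E (\<lambda>g. P)"
      by (rule bundle_hom_const) (use PQ assms in \<open>auto simp: schur_def square_rep_def\<close>)
    show "bundle_hom k n E (schur [1] E) (\<lambda>g. Q)"
      by (rule bundle_hom_const) (use PQ(2) QA assms in \<open>auto simp: schur_def square_rep_def\<close>)
  qed (use PQ in \<open>auto simp: schur_def\<close>)
qed

lemma square_rep_schur: "square_rep k n (schur lam E)"
  by (simp add: square_rep_def schur_def)


section \<open>Rank and degree of a sum of irreducible bundles\<close>

text \<open>The exponent of \<open>det\<close> in \<open>det S\<^sub>\<lambda>\<close>; the division is exact.\<close>

definition schur_degree :: "nat \<Rightarrow> nat list \<Rightarrow> nat" where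
  "schur_degree m lam = schur_dim m lam * sum_list lam div m"

lemma schur_degree_spec:
  assumes "0 < m"
  shows "m * schur_degree m lam = schur_dim m lam * sum_list lam"
    and "A \<in> GL m \<Longrightarrow> det (schur_mat m lam A) = det A ^ schur_degree m lam"
proof -
  obtain e where e: "m * e = schur_dim m lam * sum_list lam"
    "\<And>A. A \<in> GL m \<Longrightarrow> det (schur_mat m lam A) = det A ^ e"
    using det_schur_mat[OF assms] by blast
  have "schur_degree m lam = e" using assms unfolding schur_degree_def e(1)[symmetric] by simp
  then show "m * schur_degree m lam = schur_dim m lam * sum_list lam"
    "A \<in> GL m \<Longrightarrow> det (schur_mat m lam A) = det A ^ schur_degree m lam" using e by auto
qed

definition model_bundle :: "nat \<Rightarrow> nat \<Rightarrow> nat list list \<Rightarrow> nat list list \<Rightarrow> int list \<Rightarrow> hbundle" where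
  "model_bundle k n lams mus ps = direct_sum
       [direct_sum (sub_components k n lams),
        direct_sum (quot_components k n mus),
        direct_sum (line_components k n ps)]"

lemma square_rep_components:
  "E \<in> set (sub_components k n lams) \<Longrightarrow> square_rep k n E"
  "E \<in> set (quot_components k n mus) \<Longrightarrow> square_rep k n E"
  "E \<in> set (line_components k n ps) \<Longrightarrow> square_rep k n E"
proof -
  show "E \<in> set (sub_components k n lams) \<Longrightarrow> square_rep k n E"
    unfolding sub_components_def using square_rep_schur by auto
  show "E \<in> set (quot_components k n mus) \<Longrightarrow> square_rep k n E"
    unfolding quot_components_def using square_rep_schur by auto
  show "E \<in> set (line_components k n ps) \<Longrightarrow> square_rep k n E"
    by (auto simp: line_components_def square_rep_def line_bundle_def)
qed

lemma square_rep_model: "square_rep k n (model_bundle k n lams mus ps)"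
  unfolding model_bundle_def
  by (rule square_rep_direct_sum) (auto intro: square_rep_direct_sum square_rep_components)

lemma rank_model:
  "bundle_rank (model_bundle k n lams mus ps)
    = sum_list (map (schur_dim k) lams) + sum_list (map (schur_dim (n - k)) mus) + length ps"
  by (simp add: model_bundle_def direct_sum_def sub_components_def quot_components_def
      line_components_def o_def schur_def dual_def universal_sub_def universal_quot_def
      line_bundle_def sum_list_triv)

lemma prod_list_power: "prod_list (map (\<lambda>x. a ^ e x) xs) = (a :: complex) ^ sum_list (map e xs)"
  by (induction xs) (auto simp: power_add)

lemma prod_list_power_int:
  "a \<noteq> 0 \<Longrightarrow> prod_list (map (\<lambda>x. a powi x) xs) = (a :: complex) powi sum_list xs"
  by (induction xs) (auto simp: power_int_add)

text \<open>Writing \<open>a\<close> for the inverse determinant of the upper left block of \<open>p\<close>, the cocycles are \<open>a\<close> for \<open>det S\<^sup>*\<close> and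
\<open>a det p\<close> for \<open>det Q\<close>.\<close>

lemma det_model:
  assumes p: "p \<in> parabolic k n" and kn: "0 < k" "k < n"
  shows "det (bundle_rep (model_bundle k n lams mus ps) p) =
    inverse (det (block_sub k p)) powi
      (int (sum_list (map (schur_degree k) lams) + sum_list (map (schur_degree (n - k)) mus)) + sum_list ps)
    * det p ^ sum_list (map (schur_degree (n - k)) mus)"
proof -
  define a where "a = inverse (det (block_sub k p))"
  have a: "a \<noteq> 0" using blocks_GL(1)[OF p] kn by (simp add: a_def GL_iff)
  have q: "det (block_quot k n p) = a * det p"
    using det_parabolic[OF p] kn a by (simp add: a_def)
  have "det (bundle_rep (direct_sum (sub_components k n lams)) p)
      = prod_list (map (\<lambda>E. det (bundle_rep E p)) (sub_components k n lams))"
    by (rule det_direct_sum[OF square_rep_components(1) p])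
  also have "\<dots> = prod_list (map (\<lambda>lam. a ^ schur_degree k lam) lams)"
    using dual_sub_rep[OF p] kn schur_degree_spec(2)[OF kn(1)]
    by (simp add: sub_components_def o_def schur_def a_def)
       (simp add: dual_def universal_sub_def)
  finally have S: "det (bundle_rep (direct_sum (sub_components k n lams)) p)
      = a ^ sum_list (map (schur_degree k) lams)" by (simp add: prod_list_power)
  have "det (bundle_rep (direct_sum (quot_components k n mus)) p)
      = prod_list (map (\<lambda>E. det (bundle_rep E p)) (quot_components k n mus))"
    by (rule det_direct_sum[OF square_rep_components(2) p])
  also have "\<dots> = prod_list (map (\<lambda>mu. (a * det p) ^ schur_degree (n - k) mu) mus)"
    using blocks_GL(2)[OF p] kn schur_degree_spec(2)[of "n - k" "block_quot k n p"] q
    by (simp add: quot_components_def o_def schur_def universal_quot_def block_quot_def)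
  finally have Q: "det (bundle_rep (direct_sum (quot_components k n mus)) p)
      = (a * det p) ^ sum_list (map (schur_degree (n - k)) mus)" by (simp add: prod_list_power)
  have "det (bundle_rep (direct_sum (line_components k n ps)) p)
      = prod_list (map (\<lambda>E. det (bundle_rep E p)) (line_components k n ps))"
    by (rule det_direct_sum[OF square_rep_components(3) p])
  also have "\<dots> = prod_list (map (\<lambda>m. a powi m) ps)"
    using line_bundle_rep[OF p] kn by (simp add: line_components_def o_def det_single a_def)
  finally have L: "det (bundle_rep (direct_sum (line_components k n ps)) p) = a powi sum_list ps"
    using a by (simp add: prod_list_power_int)
  have "det (bundle_rep (model_bundle k n lams mus ps) p)
    = a ^ sum_list (map (schur_degree k) lams)
      * ((a * det p) ^ sum_list (map (schur_degree (n - k)) mus) * a powi sum_list ps)"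
    unfolding model_bundle_def
    by (subst det_direct_sum[OF _ p])
       (auto simp: S Q L intro: square_rep_direct_sum square_rep_components)
  then show ?thesis
    unfolding a_def[symmetric] using a
    by (simp add: power_int_add power_mult_distrib mult_ac)
qed

lemma c1_model:
  assumes "0 < k" "k < n" "square_rep k n F" "bundle_iso k n F (model_bundle k n lams mus ps)"
  shows "c1 k n F =
    int (sum_list (map (schur_degree k) lams) + sum_list (map (schur_degree (n - k)) mus)) + sum_list ps"
  by (rule c1_eqI[OF assms(1-3) square_rep_model assms(4) det_model]) (use assms in auto)

lemma sum_list_0_replicate: "sum_list (xs :: nat list) = 0 \<Longrightarrow> xs = replicate (length xs) 0"
  by (induction xs) auto

lemma weight_sum_1:
  assumes "sorted_wrt (\<ge>) xs" "sum_list (xs :: nat list) = 1"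
  shows "\<exists>j. xs = [1] @ replicate j 0"
proof (cases xs)
  case (Cons a ys)
  have "a \<noteq> 0"
  proof
    assume "a = 0"
    then have "\<forall>y\<in>set ys. y = 0" using assms(1) Cons by auto
    then have "sum_list ys = 0" by (simp add: sum_list_eq_0_iff)
    moreover have "sum_list xs = sum_list ys" using Cons \<open>a = 0\<close> by simp
    ultimately show False using assms(2) by linarith
  qed
  moreover have "a + sum_list ys = 1" using assms(2) Cons by simp
  ultimately have "a = 1" "sum_list ys = 0" by arith+
  then show ?thesis using Cons sum_list_0_replicate by auto
qed (use assms in simp)

lemma weight_sum_2:
  assumes "sorted_wrt (\<ge>) xs" "sum_list (xs :: nat list) = 2"
  shows "\<exists>j. xs = [2] @ replicate j 0 \<or> xs = [1, 1] @ replicate j 0"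
proof (cases xs)
  case (Cons a ys)
  have "a \<noteq> 0"
  proof
    assume "a = 0"
    then have "\<forall>y\<in>set ys. y = 0" using assms(1) Cons by auto
    then have "sum_list ys = 0" by (simp add: sum_list_eq_0_iff)
    moreover have "sum_list xs = sum_list ys" using Cons \<open>a = 0\<close> by simp
    ultimately show False using assms(2) by linarith
  qed
  moreover have "a + sum_list ys = 2" using assms(2) Cons by simp
  ultimately have "a = 2 \<and> sum_list ys = 0 \<or> a = 1 \<and> sum_list ys = 1" by arith
  then show ?thesis
  proof (elim disjE conjE)
    assume "a = 2" "sum_list ys = 0"
    then show ?thesis using Cons sum_list_0_replicate by auto
  next
    assume 1: "a = 1" "sum_list ys = 1"
    then obtain j where "ys = [1] @ replicate j 0" using weight_sum_1[of ys] assms(1) Cons by auto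
    then show ?thesis using 1 Cons by auto
  qed
qed (use assms in simp)

lemma nonconstant_weight_pos:
  assumes "nonconstant_weight m lam" "0 < m"
  shows "0 < sum_list lam"
proof (rule ccontr)
  assume "\<not> 0 < sum_list lam"
  then have "lam = replicate m 0"
    using assms sum_list_0_replicate[of lam] by (simp add: nonconstant_weight_def)
  then show False using assms by (simp add: nonconstant_weight_def)
qed

text \<open>The only nonconstant weight of size 1 is \<open>(1, 0, \<dots>, 0)\<close>, whose Schur functor is the identity.\<close>

lemma weight_ge_2_of_not_component:
  assumes nc: "\<not> is_component k n E (map (\<lambda>lam. schur lam E) lams)" and sq: "square_rep k n E"
    and lam: "lam \<in> set lams" "nonconstant_weight m lam" "0 < m"
  shows "2 \<le> sum_list lam"
proof -
  have "sum_list lam \<noteq> 1"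
  proof
    assume "sum_list lam = 1"
    then obtain j where "lam = [1] @ replicate j 0"
      using weight_sum_1 lam unfolding nonconstant_weight_def by blast
    then have "bundle_iso k n (schur lam E) E"
      using schur_1_iso[OF sq] by (simp only: schur_append_zeros)
    then show False using nc lam(1) unfolding is_component_def by auto
  qed
  then show ?thesis using nonconstant_weight_pos[OF lam(2,3)] by linarith
qed

lemma weight_ne_2_of_not_component:
  assumes "\<not> is_component k n (Sym2 E) (map (\<lambda>lam. schur lam E) lams)"
    "\<not> is_component k n (Wedge2 E) (map (\<lambda>lam. schur lam E) lams)"
    and lam: "lam \<in> set lams" "nonconstant_weight m lam"
  shows "sum_list lam \<noteq> 2"
proof
  assume "sum_list lam = 2"
  then obtain j where "lam = [2] @ replicate j 0 \<or> lam = [1, 1] @ replicate j 0"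
    using weight_sum_2 lam unfolding nonconstant_weight_def by blast
  then have "schur lam E = Sym2 E \<or> schur lam E = Wedge2 E"
    using schur_append_zeros by metis
  then show False
    using assms(1,2) lam(1) bundle_iso_refl[OF square_rep_schur] unfolding is_component_def by auto
qed


section \<open>The bound on the size of the Grassmannian\<close>

lemma choose_two_le:
  assumes "2 \<le> j" "j + 2 \<le> N"
  shows "N choose 2 \<le> N choose j"
proof (cases "2 * j \<le> N")
  case True
  then show ?thesis using binomial_mono[of 2 j N] assms by simp
next
  case False
  then have "N choose 2 \<le> N choose (N - j)" using binomial_mono[of 2 "N - j" N] assms by simp
  then show ?thesis using binomial_symmetric[of j N] assms by simp
qed

lemma sum_list_scaled:
  fixes f g :: "'a \<Rightarrow> nat"
  assumes "\<And>x. x \<in> set xs \<Longrightarrow> a * f x \<le> b * g x"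
  shows "a * sum_list (map f xs) \<le> b * sum_list (map g xs)"
  using assms by (induction xs) (auto simp: distrib_left intro: add_mono)

text \<open>By the absorption identity for binomial coefficients, \<open>m e = r s \<ge> s (m choose s) = m (m - 1 choose s - 1)\<close>,
and \<open>m - 1 choose s - 1\<close> is at least \<open>m - 1 choose 2\<close> for \<open>2 \<le> s - 1 \<le> m - 3\<close>.\<close>

lemma large_quotient_component:
  fixes m e r s :: nat
  assumes "m * e = r * s" "m choose s \<le> r" "3 \<le> s" "s + 2 \<le> m"
  shows "(m - 1) * (m - 2) \<le> 2 * e"
proof -
  have "m * ((m - 1) choose (s - 1)) = s * (m choose s)"
    using times_binomial_minus1_eq[of s m] assms by simp
  also have "\<dots> \<le> m * e" using assms by (simp add: mult.commute)
  finally have "(m - 1) choose (s - 1) \<le> e"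
    using nat_mult_le_cancel1[of m "(m - 1) choose (s - 1)" e] assms(4) by linarith
  moreover have "(m - 1) choose 2 \<le> (m - 1) choose (s - 1)"
    by (rule choose_two_le) (use assms in auto)
  moreover have "2 \<le> m" using assms(4) by simp
  then obtain t where t: "m = 2 + t" using le_Suc_ex by blast
  moreover have "2 * ((t + 1) choose 2) = (t + 1) * t"
    by (simp add: choose_two)
  ultimately show ?thesis by simp
qed

text \<open>Here \<open>r\<close>, \<open>e\<close> and \<open>s\<close> stand for the rank, the degree and the size of the weight of a summand of \<open>F\<^sup>S\<close> or
\<open>F\<^sup>Q\<close>, \<open>L\<close> is the number of line bundles and \<open>SP\<close> their total degree.\<close>

lemma rank_degree_bound:
  fixes d k m L SP :: nat and rS rQ eS eQ sS sQ :: "'a \<Rightarrow> nat"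
  assumes d: "0 < d" and k: "2 \<le> k" "k \<le> m"
    and S: "\<And>x. x \<in> set xs \<Longrightarrow> k * eS x = rS x * sS x"
      "\<And>x. x \<in> set xs \<Longrightarrow> 1 \<le> rS x" "\<And>x. x \<in> set xs \<Longrightarrow> 2 \<le> sS x"
    and Q: "\<And>y. y \<in> set ys \<Longrightarrow> m * eQ y = rQ y * sQ y"
      "\<And>y. y \<in> set ys \<Longrightarrow> 1 \<le> rQ y" "\<And>y. y \<in> set ys \<Longrightarrow> 2 \<le> sQ y"
      "\<And>y. y \<in> set ys \<Longrightarrow> k < m \<Longrightarrow> 3 \<le> sQ y" "\<And>y. y \<in> set ys \<Longrightarrow> m choose sQ y \<le> rQ y"
    and L: "L \<le> SP"
    and rank: "sum_list (map rS xs) + sum_list (map rQ ys) + L + d = k * m"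
    and deg: "sum_list (map eS xs) + sum_list (map eQ ys) + SP = k + m"
  shows "k + m \<le> 12 * d + 12"
proof (cases "k = m")
  case True
  define RS where "RS = sum_list (map rS xs)"
  define RQ where "RQ = sum_list (map rQ ys)"
  define XS where "XS = sum_list (map (\<lambda>x. rS x * (sS x - 2)) xs)"
  define XQ where "XQ = sum_list (map (\<lambda>y. rQ y * (sQ y - 2)) ys)"
  have excess: "k * sum_list (map e zs) = 2 * sum_list (map r zs) + sum_list (map (\<lambda>x. r x * (s x - 2)) zs)"
    if "\<And>x. x \<in> set zs \<Longrightarrow> k * e x = r x * s x" "\<And>x. x \<in> set zs \<Longrightarrow> 2 \<le> s x"
    for e r s :: "'a \<Rightarrow> nat" and zs
    using that
  proof (induction zs)
    case (Cons z zs)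
    obtain t where "s z = 2 + t" using le_Suc_ex[OF Cons.prems(2)[of z]] by auto
    then have "k * e z = 2 * r z + r z * (s z - 2)"
      using Cons.prems(1)[of z] by (simp add: distrib_left)
    moreover have "k * sum_list (map e zs) = 2 * sum_list (map r zs) + sum_list (map (\<lambda>x. r x * (s x - 2)) zs)"
      by (rule Cons.IH) (use Cons.prems in auto)
    ultimately show ?case by (simp add: distrib_left)
  qed simp
  have eS: "k * sum_list (map eS xs) = 2 * RS + XS" unfolding RS_def XS_def by (rule excess) (use S in auto)
  have eQ: "k * sum_list (map eQ ys) = 2 * RQ + XQ" unfolding RQ_def XQ_def by (rule excess) (use Q True in auto)
  have "k * (sum_list (map eS xs) + sum_list (map eQ ys) + SP) = k * (k + k)" using deg True by simp
  then have tot: "2 * RS + XS + (2 * RQ + XQ) + k * SP = 2 * (k * k)"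
    using eS eQ by (simp add: distrib_left)
  have rk: "RS + RQ + L + d = k * k" using rank True by (simp add: RS_def RQ_def)
  \<comment> \<open>The excesses add up to \<open>2 d\<close>; for the line bundles the excess is \<open>k SP - 2 L\<close>.\<close>
  have main: "XS + XQ + k * SP = 2 * L + 2 * d" using tot rk by linarith
  show ?thesis
  proof (rule ccontr)
    assume "\<not> ?thesis"
    then have big: "6 * d + 6 < k" using True by simp
    obtain j where "k = 2 + j" using le_Suc_ex[OF k(1)] by auto
    then have "(k - 2) * L + 2 * L = k * L" by (simp add: distrib_right)
    then have "(k - 2) * L + 2 * L \<le> k * SP" using L by simp
    then have line: "XS + XQ + (k - 2) * L \<le> 2 * d" using main by linarith
    \<comment> \<open>A positive excess \<open>r (s - 2)\<close> bounds \<open>r\<close>, hence \<open>k e = r (s - 2) + 2 r\<close>, by a multiple of \<open>d\<close>,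
      although \<open>k e \<ge> k\<close>.\<close>
    have zero: "r z * (s z - 2) = 0"
      if zs: "sum_list (map (\<lambda>x. r x * (s x - 2)) zs) \<le> 2 * d" "z \<in> set zs"
        "k * e z = r z * s z" "1 \<le> r z" "2 \<le> s z" for e r s :: "'a \<Rightarrow> nat" and z zs
    proof (rule ccontr)
      assume nz: "r z * (s z - 2) \<noteq> 0"
      have x: "r z * (s z - 2) \<le> 2 * d"
        using member_le_sum_list[of "r z * (s z - 2)" "map (\<lambda>x. r x * (s x - 2)) zs"] zs by auto
      have "r z * 1 \<le> r z * (s z - 2)" using nz by (intro mult_left_mono) auto
      then have "r z \<le> 2 * d" using x by linarith
      moreover obtain t where "s z = 2 + t" using le_Suc_ex[OF zs(5)] by auto
      then have "k * e z = r z * (s z - 2) + 2 * r z"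
        using zs(3) by (simp add: distrib_left)
      ultimately have "k * e z \<le> 6 * d" using x by linarith
      moreover have "0 < e z" using zs by (cases "e z") auto
      then have "k * 1 \<le> k * e z" by (intro mult_left_mono) auto
      ultimately show False using big by linarith
    qed
    have "XS = 0"
      unfolding XS_def using zero[where zs = xs and r = rS and s = sS and e = eS] line S
      by (simp add: XS_def sum_list_eq_0_iff)
    moreover have "XQ = 0"
      unfolding XQ_def using zero[where zs = ys and r = rQ and s = sQ and e = eQ] line Q True
      by (simp add: XQ_def sum_list_eq_0_iff)
    moreover have "L = 0"
    proof (rule ccontr)
      assume "L \<noteq> 0"
      then have "(k - 2) * 1 \<le> (k - 2) * L" by (intro mult_left_mono) auto
      then show False using line big by linarith
    qed
    ultimately have "k * SP = 2 * d" using main by simp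
    then have "SP \<noteq> 0" using d by (intro notI) simp
    then have "k * 1 \<le> k * SP" by (intro mult_left_mono) auto
    then show False using \<open>k * SP = 2 * d\<close> big by linarith
  qed
next
  case False
  then have km: "k < m" using k by simp
  define RS where "RS = int (sum_list (map rS xs))"
  define RQ where "RQ = int (sum_list (map rQ ys))"
  define ES where "ES = int (sum_list (map eS xs))"
  define EQ where "EQ = int (sum_list (map eQ ys))"
  show ?thesis
  proof (cases "m < 7")
    case False
    then have m: "7 \<le> m" by simp
    have "2 * rS x \<le> k * eS x" if "x \<in> set xs" for x
      using S(1,3)[OF that] by (simp add: mult.commute)
    then have S': "2 * sum_list (map rS xs) \<le> k * sum_list (map eS xs)"
      by (rule sum_list_scaled)
    have "(m - 1) * rQ y \<le> m * eQ y" if y: "y \<in> set ys" for y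
    proof (cases "sQ y + 2 \<le> m")
      case True
      have "(m - 1) * (m - 2) \<le> 2 * eQ y"
        by (rule large_quotient_component[OF Q(1)[OF y] Q(5)[OF y] Q(4)[OF y km] True])
      also have "eQ y \<le> sum_list (map eQ ys)" using y by (intro member_le_sum_list) auto
      also have "\<dots> \<le> 2 * m - 1" using deg km by simp
      finally have "(m - 1) * (m - 2) \<le> 2 * (2 * m - 1)" by simp
      moreover obtain j where "m = 7 + j" using m le_Suc_ex by blast
      ultimately have False by (simp add: algebra_simps)
      then show ?thesis ..
    next
      case False
      then have "m - 1 \<le> sQ y" by simp
      then show ?thesis using Q(1)[OF y] by (simp add: mult.commute)
    qed
    then have Q': "(m - 1) * sum_list (map rQ ys) \<le> m * sum_list (map eQ ys)"
      by (rule sum_list_scaled)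
    have iS: "2 * RS \<le> int k * ES"
      using S' unfolding RS_def ES_def by (metis of_nat_le_iff of_nat_mult of_nat_numeral)
    have "int ((m - 1) * sum_list (map rQ ys)) \<le> int (m * sum_list (map eQ ys))"
      using Q' of_nat_le_iff by blast
    then have iQ: "(int m - 1) * RQ \<le> int m * EQ"
      using m unfolding RQ_def EQ_def by (simp add: of_nat_diff)
    have "int (sum_list (map rS xs) + sum_list (map rQ ys) + L + d) = int (k * m)" using rank by simp
    then have irank: "RS + RQ + int L + int d = int k * int m" unfolding RS_def RQ_def by simp
    have "int (sum_list (map eS xs) + sum_list (map eQ ys) + SP) = int (k + m)" using deg by simp
    then have ideg: "ES + EQ + int SP = int k + int m" unfolding ES_def EQ_def by simp
    have nn: "0 \<le> RS" "0 \<le> RQ" "0 \<le> ES" "0 \<le> EQ" by (auto simp: RS_def RQ_def ES_def EQ_def)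
    show ?thesis
    proof (cases "k = 2")
      case True
      have "RS \<le> ES" using iS True by simp
      then have "(int m - 1) * RS \<le> int m * ES" using m nn by (intro mult_mono) auto
      moreover have "(int m - 1) * int L \<le> int m * int SP" using L m by (intro mult_mono) auto
      ultimately have "(int m - 1) * (RS + RQ + int L) \<le> int m * (ES + EQ + int SP)"
        using iQ by (simp add: distrib_left)
      moreover have "RS + RQ + int L = 2 * int m - int d" "ES + EQ + int SP = int m + 2"
        using irank ideg True by auto
      ultimately have "(int m - 1) * (2 * int m - int d) \<le> int m * (int m + 2)" by simp
      then have "int m * int m + int d \<le> int m * (4 + int d)" by (simp add: algebra_simps)
      then have "int m * int m \<le> int m * (4 + int d)" by simp
      then have "int m \<le> 4 + int d" using m by (simp add: mult_le_cancel_left)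
      then show ?thesis using True by linarith
    next
      case False
      then have k3: "3 \<le> k" using k by simp
      have "2 * int m \<le> 3 * (int m - 1)" using m by simp
      also have "\<dots> \<le> int k * (int m - 1)" using k3 m by (intro mult_right_mono) auto
      finally have "2 * int m * RQ \<le> int k * (int m - 1) * RQ" using nn by (intro mult_right_mono) auto
      also have "\<dots> \<le> int k * (int m * EQ)"
        unfolding mult.assoc by (intro mult_left_mono iQ) simp
      finally have "int m * (2 * RQ) \<le> int m * (int k * EQ)" by (simp add: mult_ac)
      then have "2 * RQ \<le> int k * EQ" using m by (simp add: mult_le_cancel_left)
      moreover have "2 * int L \<le> int k * int SP" using L k by (intro mult_mono) auto
      ultimately have "2 * (RS + RQ + int L) \<le> int k * (ES + EQ + int SP)"
        using iS by (simp add: distrib_left)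
      then have "2 * (int k * int m - int d) \<le> int k * (int k + int m)"
        using irank ideg by (metis add_diff_cancel_right')
      then have *: "int k * (int m - int k) \<le> 2 * int d" by (simp add: algebra_simps)
      have "int k * 1 \<le> int k * (int m - int k)" using km by (intro mult_left_mono) auto
      moreover have "1 * (int m - int k) \<le> int k * (int m - int k)" using km k by (intro mult_right_mono) auto
      ultimately have "int k * 1 \<le> 2 * int d" "1 * (int m - int k) \<le> 2 * int d"
        using * by (blast intro: order_trans)+
      then have "int k \<le> 2 * int d" "int m \<le> 2 * int d + int k"
        by (simp_all only: mult_1_right mult_1_left diff_le_eq)
      then have "int (k + m) \<le> int (12 * d + 12)"
        unfolding of_nat_add of_nat_mult of_nat_numeral using of_nat_0_le_iff[of d] by linarith
      then show ?thesis by (simp only: of_nat_le_iff)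
    qed
  qed (use km in simp)
qed


section \<open>Finiteness\<close>

text \<open>Since each rank \<open>r\<close> is positive, the total rank bounds the number of summands, and \<open>r |\<lambda>| = m e\<close> bounds
the size of each weight by the total degree.\<close>

lemma components_bounded:
  fixes f :: "nat list \<Rightarrow> nat"
  assumes "\<And>lam. lam \<in> set lams \<Longrightarrow> length lam = m \<and> 1 \<le> r lam \<and> m * e lam = r lam * sum_list lam"
    and "sum_list (map r lams) \<le> B" "m * sum_list (map e lams) \<le> B" "m \<le> B"
  shows "lams \<in> {xs. set xs \<subseteq> {l. set l \<subseteq> {..B} \<and> length l \<le> B} \<and> length xs \<le> B}"
proof -
  have "length lams \<le> sum_list (map r lams)"
    using assms(1) by (induction lams) (auto simp: add_mono, fastforce)
  moreover have "set l \<subseteq> {..B}" if l: "l \<in> set lams" for l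
  proof
    fix x assume "x \<in> set l"
    then have "x \<le> sum_list l" by (rule member_le_sum_list) simp
    also have "\<dots> \<le> r l * sum_list l" using assms(1)[OF l] by simp
    also have "\<dots> = m * e l" using assms(1)[OF l] by simp
    also have "\<dots> \<le> m * sum_list (map e lams)" using l by (intro mult_left_mono member_le_sum_list) auto
    finally show "x \<in> {..B}" using assms(3) by simp
  qed
  ultimately show ?thesis using assms by auto
qed

theorem proposition2p2:
  fixes d :: nat
  assumes "d > 0"
  shows "finite {(k, n, iso_class k n F) | k n F.
    0 < k \<and> k < n \<and>
    homogeneous_bundle k n F \<and> globally_generated k n F \<and>
    int (bundle_rank F) = int (k * (n - k)) - int d \<and>
    c1 k n F = int n \<and>
    (\<exists>lams mus ps. decomposition k n F lams mus ps \<and>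
      k \<ge> 2 \<and>
      n \<ge> 2 * k \<and>
      (\<not> is_component k n (dual (universal_sub k n)) (sub_components k n lams) \<and>
       \<not> is_component k n (universal_quot k n) (quot_components k n mus)) \<and>
      (n > 2 * k \<longrightarrow>
        \<not> is_component k n (Sym2 (universal_quot k n)) (quot_components k n mus) \<and>
        \<not> is_component k n (Wedge2 (universal_quot k n)) (quot_components k n mus)))}"
  (is "finite ?X")
proof -
  define N where "N = 12 * d + 12"
  define B where "B = N * N"
  define W :: "nat list list set" where
    "W = {xs. set xs \<subseteq> {l. set l \<subseteq> {..B} \<and> length l \<le> B} \<and> length xs \<le> B}"
  define P :: "int list set" where "P = {xs. set xs \<subseteq> {0..int B} \<and> length xs \<le> B}"
  have fin: "finite ({..N} \<times> {..N} \<times> W \<times> W \<times> P)"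
    unfolding W_def P_def
    by (intro finite_cartesian_product finite_lists_length_le) auto
  have "?X \<subseteq> (\<lambda>(k, n, lams, mus, ps). (k, n, iso_class k n (model_bundle k n lams mus ps)))
      ` ({..N} \<times> {..N} \<times> W \<times> W \<times> P)"
  proof
    fix z assume "z \<in> ?X"
    then obtain k n F lams mus ps where z: "z = (k, n, iso_class k n F)"
      and kn: "0 < k" "k < n" and F: "homogeneous_bundle k n F"
      and rank: "int (bundle_rank F) = int (k * (n - k)) - int d" and c1: "c1 k n F = int n"
      and dec: "decomposition k n F lams mus ps" and A1: "2 \<le> k" and A2: "2 * k \<le> n"
      and A3: "\<not> is_component k n (dual (universal_sub k n)) (sub_components k n lams)"
        "\<not> is_component k n (universal_quot k n) (quot_components k n mus)"
      and A4: "2 * k < n \<Longrightarrow> \<not> is_component k n (Sym2 (universal_quot k n)) (quot_components k n mus)"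
        "2 * k < n \<Longrightarrow> \<not> is_component k n (Wedge2 (universal_quot k n)) (quot_components k n mus)"
      by blast
    define m where "m = n - k"
    have m: "k \<le> m" "n = k + m" "0 < m" using A2 kn by (auto simp: m_def)
    have wt: "\<And>lam. lam \<in> set lams \<Longrightarrow> nonconstant_weight k lam"
      "\<And>mu. mu \<in> set mus \<Longrightarrow> nonconstant_weight m mu" and ps: "\<And>p. p \<in> set ps \<Longrightarrow> 0 < p"
      and iso: "bundle_iso k n F (model_bundle k n lams mus ps)"
      using dec by (auto simp: decomposition_def model_bundle_def m_def)
    have sqF: "square_rep k n F" by (rule homogeneous_square_rep[OF F])
    have sqS: "square_rep k n (dual (universal_sub k n))"
      using dual_sub_rep(1) kn by (auto simp: square_rep_def GL_iff dual_def universal_sub_def)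
    have sqQ: "square_rep k n (universal_quot k n)"
      by (simp add: square_rep_def universal_quot_def)
    define SP where "SP = nat (sum_list ps)"
    have SP: "length ps \<le> SP" "sum_list ps = int SP"
    proof -
      have "int (length ps) \<le> sum_list ps" using ps by (induction ps) force+
      then show "length ps \<le> SP" "sum_list ps = int SP" by (auto simp: SP_def)
    qed
    have "int (bundle_rank F + d) = int (k * m)" using rank unfolding m_def by linarith
    then have "bundle_rank F + d = k * m" using of_nat_eq_iff by blast
    then have rk: "sum_list (map (schur_dim k) lams) + sum_list (map (schur_dim m) mus) + length ps + d = k * m"
      using bundle_iso_rank[OF iso] by (simp add: rank_model m_def)
    have "int n = int (sum_list (map (schur_degree k) lams) + sum_list (map (schur_degree m) mus) + SP)"
      using c1_model[OF kn sqF iso] unfolding c1 SP(2) m_def by simp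
    then have dg: "sum_list (map (schur_degree k) lams) + sum_list (map (schur_degree m) mus) + SP = k + m"
      using m(2) of_nat_eq_iff by metis
    have S2: "2 \<le> sum_list lam" if "lam \<in> set lams" for lam
      by (rule weight_ge_2_of_not_component[OF A3(1)[unfolded sub_components_def] sqS that wt(1)[OF that] kn(1)])
    have Q2: "2 \<le> sum_list mu" if "mu \<in> set mus" for mu
      by (rule weight_ge_2_of_not_component[OF A3(2)[unfolded quot_components_def] sqQ that wt(2)[OF that] m(3)])
    have Q3: "3 \<le> sum_list mu" if "mu \<in> set mus" "k < m" for mu
    proof -
      have "2 * k < n" using that m by simp
      then have "sum_list mu \<noteq> 2"
        by (intro weight_ne_2_of_not_component[OF A4(1)[unfolded quot_components_def]
              A4(2)[unfolded quot_components_def] that(1) wt(2)[OF that(1)]])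
      then show ?thesis using Q2[OF that(1)] by linarith
    qed
    have dimS: "1 \<le> schur_dim k lam" "length lam = k" if "lam \<in> set lams" for lam
      using schur_dim_pos[of lam k] wt(1)[OF that] by (auto simp: nonconstant_weight_def)
    have dimQ: "1 \<le> schur_dim m mu" "length mu = m" if "mu \<in> set mus" for mu
      using schur_dim_pos[of mu m] wt(2)[OF that] by (auto simp: nonconstant_weight_def)
    have "k + m \<le> N" unfolding N_def
      by (rule rank_degree_bound[OF assms A1 m(1) schur_degree_spec(1)[OF kn(1)] dimS(1) S2
            schur_degree_spec(1)[OF m(3)] dimQ(1) Q2 Q3 schur_dim_ge_binomial SP(1) rk dg])
    then have kmN: "k \<le> N" "m \<le> N" "n \<le> N" using m by auto
    then have "k * m \<le> B" unfolding B_def by (intro mult_mono) auto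
    have "k * (k + m) \<le> B" "m * (k + m) \<le> B" unfolding B_def using kmN m by (auto intro!: mult_mono)
    have NB: "N \<le> B" unfolding B_def N_def by simp
    have "lams \<in> W" unfolding W_def
    proof (rule components_bounded[of lams k "schur_dim k" "schur_degree k"])
      show "k * sum_list (map (schur_degree k) lams) \<le> B"
        using dg \<open>k * (k + m) \<le> B\<close> by (metis add.assoc le_add1 le_trans mult_le_mono2)
    qed (use dimS schur_degree_spec(1)[OF kn(1)] rk \<open>k * m \<le> B\<close> kmN NB in auto)
    moreover have "mus \<in> W" unfolding W_def
    proof (rule components_bounded[of mus m "schur_dim m" "schur_degree m"])
      have "sum_list (map (schur_degree m) mus) \<le> k + m" using dg by linarith
      then show "m * sum_list (map (schur_degree m) mus) \<le> B"
        using \<open>m * (k + m) \<le> B\<close> by (meson le_trans mult_le_mono2)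
    qed (use dimQ schur_degree_spec(1)[OF m(3)] rk \<open>k * m \<le> B\<close> kmN NB in auto)
    moreover have "ps \<in> P"
    proof -
      have "p \<le> sum_list ps" if "p \<in> set ps" for p
        using that ps
      proof (induction ps)
        case (Cons q qs)
        have "0 \<le> sum_list qs" using Cons.prems by (intro sum_list_nonneg) force
        then show ?case using Cons by force
      qed simp
      moreover have "sum_list ps \<le> int B" using SP(2) dg kmN NB m by linarith
      ultimately show ?thesis unfolding P_def using ps rk \<open>k * m \<le> B\<close> by force
    qed
    moreover have "z = (k, n, iso_class k n (model_bundle k n lams mus ps))"
      unfolding z iso_class_cong[OF F square_rep_model iso] ..
    ultimately show "z \<in> (\<lambda>(k, n, lams, mus, ps). (k, n, iso_class k n (model_bundle k n lams mus ps)))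
      ` ({..N} \<times> {..N} \<times> W \<times> W \<times> P)"
      using kmN(1,3) by (intro image_eqI[of _ _ "(k, n, lams, mus, ps)"]) simp_all
  qed
  then show ?thesis by (rule finite_subset[OF _ finite_imageI[OF fin]])
qed

end
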